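(* (Pointwise bias and variance.) Assume that $f$ is twice continuously differentiable on $\mathcal S_d$. Then, as $n\to\infty$ and uniformly for $s\in\mathcal S_d$, $$\mathrm{Bias}[\hat f_{n,b}(s)]=f_b(s)-f(s)=b\,g(s)+o(b),$$ where $$g(s)=\sum_{i\in[d]}\bigl(1-(d+1)s_i\bigr)\frac{\partial}{\partial s_i}f(s)+\frac12\sum_{i,j\in[d]}s_i\bigl(\mathbf 1_{\{i=j\}}-s_j\bigr)\frac{\partial^2}{\partial s_i\partial s_j}f(s).$$ Assume instead that $f$ is Lipschitz continuous on $\mathcal S_d$. For every subset of indices $\mathcal J\subseteq[d]$, denote $$\psi(s)=\psi_{\emptyset}(s)\quad\text{and}\quad\psi_{\mathcal J}(s)=\Bigl[(4\pi)^{d-|\mathcal J|}\cdot(1-\|s\|_1)\prod_{i\in[d]\setminus\mathcal J}s_i\Bigr]^{-1/2}.$$ Then, for any $s\in\mathrm{Int}(\mathcal S_d)$, any subset $\emptyset\neq\mathcal J\subseteq[d]$, and any $\kappa\in(0,\infty)^d$, we have, as $n\to\infty$: (i) if $s_i/b\to\infty$ for all $i\in[d]$ and $(1-\|s\|_1)/b\to\infty$, then $$\mathrm{Var}(\hat f_{n,b}(s))=n^{-1}b^{-d/2}\cdot\bigl(\psi(s)f(s)+O_s(b^{1/2})\bigr);$$ (ii) if $s_i/b\to\kappa_i$ for all $i\in\mathcal J$, $s_i/b\to\infty$ for all $i\in[d]\setminus\mathcal J$, and $(1-\|s\|_1)/b\to\infty$, then $$\mathrm{Var}(\hat f_{n,b}(s))=n^{-1}b^{-(d+|\mathcal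 J|)/2}\cdot\Bigl(\psi_{\mathcal J}(s)f(s)\prod_{i\in\mathcal J}\frac{\Gamma(2\kappa_i+1)}{2^{2\kappa_i+1}\Gamma^2(\kappa_i+1)}+O_{\kappa,s}(b^{1/2})\Bigr).$$
   Context: Let $d\in\mathbb N$, $[d]=\{1,\dots,d\}$, $\|s\|_1=\sum_{i=1}^d|s_i|$, $\mathcal S_d=\{s\in[0,1]^d:\|s\|_1\le1\}$ and $\mathrm{Int}(\mathcal S_d)=\{s\in(0,1)^d:\|s\|_1<1\}$. For $\alpha_1,\dots,\alpha_d,\beta>0$, the Dirichlet$(\alpha,\beta)$ density is $$K_{\alpha,\beta}(s)=\frac{\Gamma(\|\alpha\|_1+\beta)}{\Gamma(\beta)\prod_{i=1}^d\Gamma(\alpha_i)}\cdot(1-\|s\|_1)^{\beta-1}\prod_{i=1}^ds_i^{\alpha_i-1},\qquad s\in\mathcal S_d.$$ Let $X_1,\dots,X_n$ be i.i.d. observations with an unknown density $f$ supported on $\mathcal S_d$. The bandwidth parameter $b=b(n)>0$ is implicitly a function of the number of observations $n$, with $b\to0$ as $n\to\infty$. The Dirichlet kernel estimator is $$\hat f_{n,b}(s)=\frac1n\sum_{i=1}^nK_{s/b+1,\,(1-\|s\|_1)/b+1}(X_i),\qquad s\in\mathcal S_d,$$ where $s/b+1=(s_1/b+1,\dots,s_d/b+1)$. Write $f_b(s)=\mathbb E[\hat f_{n,b}(s)]$ and $\mathrm{Bias}[\hat f_{n,b}(s)]=\mathbb E[\hat f_{n,b}(s)]-f(s)$. Here $\Gamma$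 is the gamma function and $\mathbf 1$ denotes an indicator. Notation: $u=O(v)$ means $\limsup|u/v|<C<\infty$ as $n\to\infty$, where the positive constant $C$ can depend on the target density $f$ and the dimension $d$, but on no other variable unless written as a subscript of $O$; $u=o(v)$ means $\lim|u/v|=0$. In the variance statements, $s$ is allowed to vary with $n$ through the stated limits of $s_i/b$ and $(1-\|s\|_1)/b$.
   Formalization: For s varying with n, a fixed constant in O_s, O_{κ,s} fails (e.g. s_i/b=κ_i+1/log(1/b)); constants are taken at s(n), and in (ii) the remainder is also at most C'(κ,(s_i) for i not in J) times (b^{1/2}+sum over J of |s_i/b-κ_i|). *)

theory Defs
  imports "HOL-Probability.Probability"
begin

definition l1_norm :: "real ^ 'd \<Rightarrow> real" where
  "l1_norm s = (\<Sum>i\<in>UNIV. \<bar>s $ i\<bar>)"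

definition unit_simplex :: "(real ^ 'd) set" where
  "unit_simplex = {s. (\<forall>i. 0 \<le> s $ i \<and> s $ i \<le> 1) \<and> l1_norm s \<le> 1}"

definition int_simplex :: "(real ^ 'd) set" where
  "int_simplex = {s. (\<forall>i. 0 < s $ i \<and> s $ i < 1) \<and> l1_norm s < 1}"

(* The density is extended by 0 outside the simplex. Since 0 powr 0 = 0, its value at a point of
   the boundary of the simplex can differ from the usual convention 0^0 = 1; the boundary is a
   Lebesgue null set, so this does not affect any expectation under an absolutely continuous law. *)
definition dirichlet_density :: "real ^ 'd \<Rightarrow> real \<Rightarrow> real ^ 'd \<Rightarrow> real" where
  "dirichlet_density \<alpha> \<beta> x =
     (if x \<in> unit_simplex then
        Gamma (l1_norm \<alpha> + \<beta>) / (Gamma \<beta> * (\<Prod>i\<in>UNIV. Gamma (\<alpha> $ i)))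
        * (1 - l1_norm x) powr (\<beta> - 1) * (\<Prod>i\<in>UNIV. (x $ i) powr (\<alpha> $ i - 1))
      else 0)"

definition dirichlet_kde ::
  "(nat \<Rightarrow> 'a \<Rightarrow> real ^ 'd) \<Rightarrow> nat \<Rightarrow> real \<Rightarrow> real ^ 'd \<Rightarrow> 'a \<Rightarrow> real" where
  "dirichlet_kde X n b s \<omega> =
     1 / real n * (\<Sum>k = 1..n. dirichlet_density (\<chi> i. s $ i / b + 1) ((1 - l1_norm s) / b + 1) (X k \<omega>))"

definition kde_mean :: "'a measure \<Rightarrow> (nat \<Rightarrow> 'a \<Rightarrow> real ^ 'd) \<Rightarrow> nat \<Rightarrow> real \<Rightarrow> real ^ 'd \<Rightarrow> real" where
  "kde_mean M X n b s = prob_space.expectation M (dirichlet_kde X n b s)"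

definition kde_variance :: "'a measure \<Rightarrow> (nat \<Rightarrow> 'a \<Rightarrow> real ^ 'd) \<Rightarrow> nat \<Rightarrow> real \<Rightarrow> real ^ 'd \<Rightarrow> real" where
  "kde_variance M X n b s = prob_space.variance M (dirichlet_kde X n b s)"

definition iid_sample ::
  "'a measure \<Rightarrow> (nat \<Rightarrow> 'a \<Rightarrow> real ^ 'd) \<Rightarrow> (real ^ 'd \<Rightarrow> real) \<Rightarrow> bool" where
  "iid_sample M X f \<longleftrightarrow>
     prob_space.indep_vars M (\<lambda>_. borel) X {1..} \<and>
     (\<forall>k\<ge>1. distributed M lborel (X k) (\<lambda>x. ennreal (f x)))"

(* Derivatives are taken within S, hence one-sided at boundary points. On a convex set with
   nonempty interior such as the simplex they are unique, also at vertices, where there may be no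
   segment of S in a coordinate direction. *)
definition partial_within ::
  "(real ^ 'd) set \<Rightarrow> 'd \<Rightarrow> (real ^ 'd \<Rightarrow> real) \<Rightarrow> real ^ 'd \<Rightarrow> real" where
  "partial_within S i f x = frechet_derivative f (at x within S) (axis i 1)"

(* Continuity of f and of its first partial derivatives follows from their differentiability. *)
definition C2_on :: "(real ^ 'd) set \<Rightarrow> (real ^ 'd \<Rightarrow> real) \<Rightarrow> bool" where
  "C2_on S f \<longleftrightarrow>
     f differentiable_on S \<and>
     (\<forall>i. partial_within S i f differentiable_on S) \<and>
     (\<forall>i j. continuous_on S (partial_within S i (partial_within S j f)))"

definition bias_term :: "(real ^ 'd \<Rightarrow> real) \<Rightarrow> real ^ 'd \<Rightarrow> real" where
  "bias_term f s =
     (\<Sum>i\<in>UNIV. (1 - (real CARD('d) + 1) * s $ i) * partial_within unit_simplex i f s)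
     + 1 / 2 * (\<Sum>i\<in>UNIV. \<Sum>j\<in>UNIV. s $ i * ((if i = j then 1 else 0) - s $ j)
         * partial_within unit_simplex i (partial_within unit_simplex j f) s)"

definition psi :: "'d set \<Rightarrow> real ^ 'd \<Rightarrow> real" where
  "psi J s =
     ((4 * pi) ^ (CARD('d) - card J) * (1 - l1_norm s) * (\<Prod>i\<in>- J. s $ i)) powr (- 1 / 2)"

definition bandwidth :: "(nat \<Rightarrow> real) \<Rightarrow> bool" where
  "bandwidth b \<longleftrightarrow> (\<forall>n. 0 < b n) \<and> b \<longlonglongrightarrow> 0"

(* The part of s seen by a constant that is allowed to depend only on the s_i with i not in J. *)
definition zero_on :: "'d set \<Rightarrow> real ^ 'd \<Rightarrow> real ^ 'd" where
  "zero_on J s = (\<chi> i. if i \<in> J then 0 else s $ i)"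

end

theory Submission
  imports Defs
begin

text \<open>
  With bandwidth \<open>b\<close> the kernel at \<open>s\<close> is the density of a Dirichlet law \<open>kernel_measure b s\<close>, so
  the mean of the estimator is the integral of \<open>f\<close> against that law, and the whole theorem is about
  two features of it: how it concentrates at \<open>s\<close>, and what its squared density looks like.

  \<^emph>\<open>Bias.\<close> The moments of a Dirichlet law are quotients of rising factorials, because multiplying the
  density by a monomial only shifts its parameters (\<open>dirichlet_density_times_monomial\<close>). Hence the
  first two moments about \<open>s\<close> are \<open>b * (1 - (d + 1) * s $ i)\<close> and
  \<open>b * s $ i * (\<delta> - s $ j)\<close> up to a uniform \<open>O(b\<^sup>2)\<close>, and the fourth moments are \<open>O(b\<^sup>2)\<close>
  (\<open>kernel_moment_expansions\<close>). Since the second derivatives are uniformly continuous on the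
  compact simplex, the Taylor remainder is at most \<open>e\<close> times a square plus a large multiple of a
  fourth power of the displacement (\<open>C2_taylor_uniform\<close>); its mean is then
  \<open>O(e * b) + O(b\<^sup>2)\<close>, that is \<open>o(b)\<close>, uniformly in \<open>s\<close>, corners included.

  \<^emph>\<open>Variance.\<close> Squaring the kernel doubles the exponents, which is the same as halving the bandwidth:
  the squared kernel is \<open>kernel_sq_const b s\<close> times the kernel of bandwidth \<open>b / 2\<close>
  (\<open>kernel_square\<close>). By independence, the variance is therefore \<open>1 / n\<close> times
  \<open>kernel_sq_const b s\<close> times a mean of \<open>f\<close> close to \<open>f s\<close>, minus a bounded square. The constant
  splits into one factor for each coordinate and one for the slack \<open>1 - l1_norm s\<close>, through the
  single function
  \<open>central_ratio x = Gamma (2 * x + 1) / (4 powr x * (Gamma (x + 1))\<^sup>2)\<close>,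
  the continuous version of a central binomial coefficient over a power of four
  (\<open>kernel_sq_const_central_ratio\<close>). Coordinates with \<open>s $ i / b\<close> large contribute
  \<open>1 / sqrt (pi * x)\<close>, which produces \<open>psi\<close>; coordinates with \<open>s $ i / b\<close> near
  \<open>\<kappa> $ i\<close> contribute \<open>central_ratio (\<kappa> $ i)\<close>, which is the gamma quotient of the statement.
  The bounds of \<open>stirling_ratio_bounds\<close> hold at every positive argument, so
  \<open>kde_variance_expansion\<close> is one explicit, nonasymptotic error bound that covers both variance
  claims; only the choice of the constants differs.
\<close>

section \<open>The simplex\<close>

lemma l1_norm_simplex: "x \<in> unit_simplex \<Longrightarrow> l1_norm x = (\<Sum>i\<in>UNIV. x $ i)"
  by (simp add: l1_norm_def unit_simplex_def)

text \<open>
  The upper bounds on the coordinates follow from the sum constraint, which leaves closed half-spaces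
  only: closedness and convexity can be read off.
\<close>
lemma unit_simplex_altdef:
  "x \<in> unit_simplex \<longleftrightarrow> (\<forall>i. 0 \<le> x $ i) \<and> (\<Sum>i\<in>UNIV. x $ i) \<le> 1"
proof
  assume "x \<in> unit_simplex"
  then show "(\<forall>i. 0 \<le> x $ i) \<and> (\<Sum>i\<in>UNIV. x $ i) \<le> 1"
    using l1_norm_simplex[of x] by (auto simp: unit_simplex_def)
next
  assume *: "(\<forall>i. 0 \<le> x $ i) \<and> (\<Sum>i\<in>UNIV. x $ i) \<le> 1"
  then have "x $ i \<le> 1" for i
    using member_le_sum[of i UNIV "\<lambda>i. x $ i"] by force
  then show "x \<in> unit_simplex" using * by (simp add: unit_simplex_def l1_norm_def)
qed

lemma unit_simplexD:
  assumes "x \<in> unit_simplex"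
  shows "0 \<le> x $ i" "x $ i \<le> 1" "0 \<le> l1_norm x" "l1_norm x \<le> 1"
  using assms by (auto simp: unit_simplex_def l1_norm_def sum_nonneg)

lemma l1_norm_measurable [measurable]: "l1_norm \<in> borel_measurable borel"
  unfolding l1_norm_def by measurable

lemma unit_simplex_closed: "closed unit_simplex"
proof -
  have "unit_simplex = (\<Inter>i. {x::real^'d. 0 \<le> x $ i}) \<inter> {x. (\<Sum>i\<in>UNIV. x $ i) \<le> 1}"
    by (auto simp: unit_simplex_altdef)
  also have "closed \<dots>"
    by (auto intro!: closed_Int closed_INT closed_Collect_le continuous_intros)
  finally show ?thesis .
qed

lemma unit_simplex_measurable [measurable]: "unit_simplex \<in> sets borel"
  using unit_simplex_closed by (rule borel_closed)

lemma l1_norm_nonneg: "0 \<le> l1_norm x"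
  by (simp add: l1_norm_def sum_nonneg)

lemma int_simplexD:
  assumes "s \<in> int_simplex"
  shows "s \<in> unit_simplex" "0 < s $ i" "l1_norm s < 1"
  using assms by (auto simp: int_simplex_def unit_simplex_def less_imp_le)

lemma convex_unit_simplex: "convex unit_simplex"
proof -
  have "unit_simplex = (\<Inter>i. {x::real^'d. 0 \<le> x $ i}) \<inter> {x. (\<Sum>i\<in>UNIV. x $ i) \<le> 1}"
    by (auto simp: unit_simplex_altdef)
  also have "convex \<dots>"
  proof (intro convex_Int convex_INT)
    fix i show "convex {x::real^'d. 0 \<le> x $ i}"
      by (auto simp: convex_def)
    show "convex {x::real^'d. (\<Sum>i\<in>UNIV. x $ i) \<le> 1}"
    proof (rule convexI)
      fix x y :: "real ^ 'd" and u v :: real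
      assume "x \<in> {x. (\<Sum>i\<in>UNIV. x $ i) \<le> 1}" "y \<in> {x. (\<Sum>i\<in>UNIV. x $ i) \<le> 1}" "0 \<le> u" "0 \<le> v" "u + v = 1"
      then have "u * (\<Sum>i\<in>UNIV. x $ i) + v * (\<Sum>i\<in>UNIV. y $ i) \<le> u * 1 + v * 1"
        by (intro add_mono mult_left_mono) auto
      then show "u *\<^sub>R x + v *\<^sub>R y \<in> {x. (\<Sum>i\<in>UNIV. x $ i) \<le> 1}"
        using \<open>u + v = 1\<close> by (simp add: sum.distrib sum_distrib_left)
    qed
  qed
  finally show ?thesis .
qed

lemma compact_unit_simplex: "compact (unit_simplex :: (real ^ 'd) set)"
proof -
  have "bounded (unit_simplex :: (real ^ 'd) set)"
  proof (rule boundedI[of _ "1"])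
    fix x :: "real ^ 'd" assume "x \<in> unit_simplex"
    then show "norm x \<le> 1"
      using norm_le_l1_cart[of x] unit_simplexD(4)[of x] by (simp add: l1_norm_def)
  qed
  then show ?thesis using unit_simplex_closed by (simp add: compact_eq_bounded_closed)
qed

lemma simplex_bounded_of_continuous:
  fixes g :: "real ^ 'd \<Rightarrow> real"
  assumes "continuous_on unit_simplex g"
  obtains B where "0 \<le> B" "\<And>x. x \<in> unit_simplex \<Longrightarrow> \<bar>g x\<bar> \<le> B"
proof -
  have "bounded (g ` unit_simplex)"
    using assms compact_unit_simplex by (intro compact_imp_bounded compact_continuous_image)
  then obtain B where "\<forall>x\<in>unit_simplex. norm (g x) \<le> B" by (auto simp: bounded_iff)
  then show ?thesis by (intro that[of "max B 0"]) auto
qed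

section \<open>The Dirichlet integral\<close>

text \<open>
  The substitution \<open>y = c * t\<close> reduces this to the Beta integral on the unit interval.
\<close>
lemma nn_integral_Beta_scaled:
  fixes a b c :: real
  assumes "0 < a" "0 < b" "0 \<le> c"
  shows "(\<integral>\<^sup>+ y. ennreal (if 0 \<le> y \<and> y \<le> c then y powr (a - 1) * (c - y) powr (b - 1) else 0) \<partial>lborel)
    = ennreal (c powr (a + b - 1) * Beta a b)"
proof (cases "c = 0")
  case True
  have "(if 0 \<le> y \<and> y \<le> c then y powr (a - 1) * (c - y) powr (b - 1) else 0) = 0" for y :: real
    using True by auto
  then show ?thesis using True by simp
next
  case False
  with assms have c: "0 < c" by simp
  let ?f = "\<lambda>y. if 0 \<le> y \<and> y \<le> c then y powr (a - 1) * (c - y) powr (b - 1) else 0"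
  have unit: "(\<integral>\<^sup>+ t. ennreal (if t \<in> {0..1} then t powr (a - 1) * (1 - t) powr (b - 1) else 0) \<partial>lborel)
      = ennreal (Beta a b)"
    using assms has_integral_Beta_real[OF assms(1,2)]
    by (intro nn_integral_has_integral_lborel) (simp_all only: has_integral_restrict_UNIV, auto)
  have scale: "ennreal (?f (0 + c * t)) =
      ennreal (c powr (a + b - 2)) * ennreal (if t \<in> {0..1} then t powr (a - 1) * (1 - t) powr (b - 1) else 0)" for t
  proof (cases "t \<in> {0..1}")
    case True
    have "c - c * t = c * (1 - t)" by (simp add: algebra_simps)
    then have "(c * t) powr (a - 1) * (c - c * t) powr (b - 1)
        = (c powr (a - 1) * c powr (b - 1)) * (t powr (a - 1) * (1 - t) powr (b - 1))"
      using True c by (simp add: powr_mult)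
    also have "c powr (a - 1) * c powr (b - 1) = c powr (a + b - 2)"
      by (simp add: powr_add[symmetric])
    finally show ?thesis
      using True c by (simp add: ennreal_mult'[symmetric] mult_left_le)
  next
    case False
    then show ?thesis using c by (auto simp: zero_le_mult_iff)
  qed
  have "(\<integral>\<^sup>+ y. ennreal (?f y) \<partial>lborel) = ennreal \<bar>c\<bar> * (\<integral>\<^sup>+ t. ennreal (?f (0 + c * t)) \<partial>lborel)"
    using c by (intro nn_integral_real_affine) auto
  also have "\<dots> = ennreal c * (ennreal (c powr (a + b - 2)) * ennreal (Beta a b))"
    unfolding scale unit[symmetric] using c by (subst nn_integral_cmult) auto
  also have "\<dots> = ennreal (c * c powr (a + b - 2) * Beta a b)"
    using c by (simp add: ennreal_mult'[symmetric] mult.assoc)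
  also have "c * c powr (a + b - 2) = c powr (a + b - 1)"
    using c powr_add[of c 1 "a + b - 2"] by simp
  finally show ?thesis .
qed

text \<open>
  Stated on the product space over an arbitrary finite index set, because the induction removes one
  coordinate at a time, and with \<open>b\<close> arbitrary, because removing a coordinate changes the exponent
  of the slack.
\<close>
lemma nn_integral_Dirichlet_PiM:
  fixes a :: "'i \<Rightarrow> real"
  assumes "finite I" "\<And>i. i \<in> I \<Longrightarrow> 0 < a i" "0 < b"
  shows "(\<integral>\<^sup>+ x. ennreal (if (\<forall>i\<in>I. 0 \<le> x i) \<and> sum x I \<le> 1
            then (1 - sum x I) powr (b - 1) * (\<Prod>i\<in>I. x i powr (a i - 1)) else 0) \<partial>PiM I (\<lambda>_. lborel))
    = ennreal (Gamma b * (\<Prod>i\<in>I. Gamma (a i)) / Gamma (b + sum a I))"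
  using assms
proof (induction I arbitrary: b rule: finite_induct)
  case empty
  interpret product_sigma_finite "\<lambda>_::'i. lborel :: real measure" ..
  have "Gamma b \<noteq> 0" using empty by (metis Gamma_real_pos less_irrefl)
  then show ?case by (simp add: space_PiM_empty)
next
  case (insert j I)
  interpret product_sigma_finite "\<lambda>_::'i. lborel :: real measure" ..
  note [simp] = \<open>finite I\<close>
  have aj: "0 < a j" using insert.prems by simp
  then have baj: "0 < b + a j" using insert.prems(2) by linarith
  let ?g = "\<lambda>b x. if (\<forall>i\<in>I. 0 \<le> x i) \<and> sum x I \<le> 1
            then (1 - sum x I) powr (b - 1) * (\<Prod>i\<in>I. x i powr (a i - 1)) else (0::real)"
  let ?G = "\<lambda>x. if (\<forall>i\<in>insert j I. 0 \<le> x i) \<and> sum x (insert j I) \<le> 1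
            then (1 - sum x (insert j I)) powr (b - 1) * (\<Prod>i\<in>insert j I. x i powr (a i - 1)) else (0::real)"
  have meas: "(\<lambda>x. ennreal (?G x)) \<in> borel_measurable (PiM (insert j I) (\<lambda>_. lborel))"
    by measurable
  have measI: "(\<lambda>x. ennreal (?g b x)) \<in> borel_measurable (PiM I (\<lambda>_. lborel))" for b
    by measurable
  have s: "sum (x(j := y)) (insert j I) = y + sum x I" for x :: "'i \<Rightarrow> real" and y
  proof -
    have "sum (x(j := y)) I = sum x I" by (rule sum.cong) (use insert.hyps in auto)
    then show ?thesis using insert.hyps by simp
  qed
  \<comment> \<open>Integrating out one coordinate leaves a Beta integral on the interval of length
    \<open>1 - sum x I\<close> and raises the exponent of the remaining slack variable by \<open>a j\<close>.\<close>
  have inner: "(\<integral>\<^sup>+ y. ennreal (?G (x(j := y))) \<partial>lborel) = ennreal (Beta (a j) b) * ennreal (?g (b + a j) x)" for x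
  proof (cases "(\<forall>i\<in>I. 0 \<le> x i) \<and> sum x I \<le> 1")
    case True
    have p: "(\<Prod>i\<in>insert j I. (x(j := y)) i powr (a i - 1)) = y powr (a j - 1) * (\<Prod>i\<in>I. x i powr (a i - 1))" for y
    proof -
      have "(\<Prod>i\<in>I. (x(j := y)) i powr (a i - 1)) = (\<Prod>i\<in>I. x i powr (a i - 1))"
        by (rule prod.cong) (use insert.hyps in auto)
      then show ?thesis using insert.hyps by simp
    qed
    have nn: "0 \<le> (\<Prod>i\<in>I. x i powr (a i - 1))" by (simp add: prod_nonneg)
    have c: "(\<forall>i\<in>insert j I. 0 \<le> (x(j := y)) i) \<longleftrightarrow> 0 \<le> y" for y
      using True insert.hyps by auto
    have "ennreal (?G (x(j := y))) = ennreal (\<Prod>i\<in>I. x i powr (a i - 1)) *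
       ennreal (if 0 \<le> y \<and> y \<le> 1 - sum x I then y powr (a j - 1) * (1 - sum x I - y) powr (b - 1) else 0)" for y
      unfolding s p c using nn by (auto simp: ennreal_mult'[symmetric] algebra_simps)
    then have "(\<integral>\<^sup>+ y. ennreal (?G (x(j := y))) \<partial>lborel) = ennreal (\<Prod>i\<in>I. x i powr (a i - 1)) *
       ennreal ((1 - sum x I) powr (a j + b - 1) * Beta (a j) b)"
      using True aj insert.prems by (simp add: nn_integral_cmult nn_integral_Beta_scaled)
    also have "\<dots> = ennreal (Beta (a j) b) * ennreal (?g (b + a j) x)"
      using True nn aj insert.prems
      by (simp add: ennreal_mult'[symmetric] ennreal_mult''[symmetric] algebra_simps)
    finally show ?thesis .
  next
    case False
    have "\<not> ((\<forall>i\<in>insert j I. 0 \<le> (x(j := y)) i) \<and> sum (x(j := y)) (insert j I) \<le> 1)" for y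
    proof -
      note s[of x y]
      moreover have "\<forall>i\<in>I. (x(j := y)) i = x i" using insert.hyps by auto
      ultimately show ?thesis using False by fastforce
    qed
    then have "?G (x(j := y)) = 0" for y by (rule if_not_P)
    moreover have "?g (b + a j) x = 0" using False by (rule if_not_P)
    ultimately show ?thesis by (simp only: ennreal_0 nn_integral_const mult_zero_left mult_zero_right)
  qed
  have "(\<integral>\<^sup>+ x. ennreal (?G x) \<partial>PiM (insert j I) (\<lambda>_. lborel))
      = (\<integral>\<^sup>+ x. ennreal (Beta (a j) b) * ennreal (?g (b + a j) x) \<partial>PiM I (\<lambda>_. lborel))"
    unfolding inner[symmetric] using insert.hyps meas by (intro product_nn_integral_insert) auto
  also have "\<dots> = ennreal (Beta (a j) b) * (\<integral>\<^sup>+ x. ennreal (?g (b + a j) x) \<partial>PiM I (\<lambda>_. lborel))"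
    using measI by (rule nn_integral_cmult)
  also have "\<dots> = ennreal (Beta (a j) b) * ennreal (Gamma (b + a j) * (\<Prod>i\<in>I. Gamma (a i)) / Gamma (b + a j + sum a I))"
    using insert.prems baj by (subst insert.IH) auto
  also have "\<dots> = ennreal (Beta (a j) b * (Gamma (b + a j) * (\<Prod>i\<in>I. Gamma (a i)) / Gamma (b + a j + sum a I)))"
    using insert.prems aj baj by (intro ennreal_mult'[symmetric]) (auto simp: Beta_def add.commute[of "a j" b] intro!: divide_nonneg_nonneg mult_nonneg_nonneg Gamma_real_nonneg)
  also have "Beta (a j) b * (Gamma (b + a j) * (\<Prod>i\<in>I. Gamma (a i)) / Gamma (b + a j + sum a I))
      = Gamma b * (\<Prod>i\<in>insert j I. Gamma (a i)) / Gamma (b + sum a (insert j I))"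
  proof -
    have "Gamma (b + a j) > 0" using baj by (intro Gamma_real_pos) auto
    then show ?thesis using insert.hyps by (simp add: Beta_def add_ac)
  qed
  finally show ?case .
qed

text \<open>
  The Dirichlet integral on vectors: \<open>lborel\<close> is the image of the product measure indexed by the
  basis, so the previous lemma applies with the basis vectors as indices.
\<close>
lemma nn_integral_Dirichlet:
  fixes a :: "real ^ 'd"
  assumes a: "\<And>i. 0 < a $ i" and b: "0 < b"
  shows "(\<integral>\<^sup>+ x. ennreal (if x \<in> unit_simplex
            then (1 - l1_norm x) powr (b - 1) * (\<Prod>i\<in>UNIV. (x $ i) powr (a $ i - 1)) else 0) \<partial>lborel)
    = ennreal (Gamma b * (\<Prod>i\<in>UNIV. Gamma (a $ i)) / Gamma (l1_norm a + b))"
proof -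
  let ?e = "\<lambda>i::'d. axis i (1::real)"
  have Basis: "Basis = range ?e" by (auto simp: Basis_vec_def)
  have inj: "inj ?e" by (auto simp: inj_on_def axis_eq_axis)
  let ?v = "\<lambda>f. \<Sum>b\<in>Basis. f b *\<^sub>R b :: real ^ 'd"
  have coord: "?v f $ i = f (?e i)" for f i
  proof -
    have "?v f $ i = ?v f \<bullet> ?e i" by (simp add: inner_axis)
    also have "\<dots> = f (?e i)" by (rule inner_sum_left_Basis) (auto simp: Basis)
    finally show ?thesis .
  qed
  have aB: "a \<bullet> ?e i = a $ i" for i by (simp add: inner_axis)
  let ?F = "\<lambda>x. if x \<in> unit_simplex
            then (1 - l1_norm x) powr (b - 1) * (\<Prod>i\<in>UNIV. (x $ i) powr (a $ i - 1)) else (0::real)"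
  have F: "?F (?v f) = (if (\<forall>b\<in>Basis. 0 \<le> f b) \<and> sum f Basis \<le> 1
            then (1 - sum f Basis) powr (b - 1) * (\<Prod>b\<in>Basis. f b powr (a \<bullet> b - 1)) else 0)" for f
  proof -
    have s: "(\<Sum>i\<in>UNIV. ?v f $ i) = sum f Basis"
      unfolding coord by (simp add: Basis sum.reindex[OF inj])
    have p: "(\<Prod>i\<in>UNIV. (?v f $ i) powr (a $ i - 1)) = (\<Prod>b\<in>Basis. f b powr (a \<bullet> b - 1))"
      unfolding coord by (simp add: Basis prod.reindex[OF inj] aB)
    have mem: "?v f \<in> unit_simplex \<longleftrightarrow> (\<forall>b\<in>Basis. 0 \<le> f b) \<and> sum f Basis \<le> 1"
      unfolding unit_simplex_altdef s coord by (auto simp: Basis)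
    show ?thesis
    proof (cases "?v f \<in> unit_simplex")
      case True
      then have A: "(\<forall>b\<in>Basis. 0 \<le> f b) \<and> sum f Basis \<le> 1" using mem by blast
      show ?thesis unfolding if_P[OF True] if_P[OF A] p l1_norm_simplex[OF True] s ..
    next
      case False
      then have A: "\<not> ((\<forall>b\<in>Basis. 0 \<le> f b) \<and> sum f Basis \<le> 1)" using mem by blast
      show ?thesis unfolding if_not_P[OF False] if_not_P[OF A] ..
    qed
  qed
  have l1: "l1_norm a = sum (\<lambda>b. a \<bullet> b) Basis"
    unfolding Basis l1_norm_def using inj a by (simp add: sum.reindex aB less_imp_le)
  have pG: "(\<Prod>i\<in>UNIV. Gamma (a $ i)) = (\<Prod>b\<in>Basis. Gamma (a \<bullet> b))"
    unfolding Basis using inj by (simp add: prod.reindex aB)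
  have "(\<integral>\<^sup>+ x. ennreal (?F x) \<partial>lborel) = (\<integral>\<^sup>+ f. ennreal (?F (?v f)) \<partial>PiM Basis (\<lambda>_. lborel))"
  proof -
    have v: "?v \<in> measurable (PiM Basis (\<lambda>_. lborel)) borel" by measurable
    have G: "(\<lambda>x. ennreal (?F x)) \<in> borel_measurable borel" by measurable
    show ?thesis unfolding lborel_eq[where 'a = "real ^ 'd"]
      using G by (intro nn_integral_distr[OF v]) (simp only: measurable_distr_eq1)
  qed
  also have "\<dots> = ennreal (Gamma b * (\<Prod>i\<in>UNIV. Gamma (a $ i)) / Gamma (l1_norm a + b))"
    unfolding F pG l1 add.commute[of "sum _ _" b]
    by (rule nn_integral_Dirichlet_PiM) (use a b in \<open>auto simp: Basis aB\<close>)
  finally show ?thesis .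
qed

section \<open>Dirichlet laws and their moments\<close>

definition dirichlet_measure :: "real ^ 'd \<Rightarrow> real \<Rightarrow> (real ^ 'd) measure" where
  "dirichlet_measure a b = density lborel (\<lambda>x. ennreal (dirichlet_density a b x))"

lemma dirichlet_density_measurable [measurable]: "dirichlet_density a b \<in> borel_measurable borel"
proof -
  have "dirichlet_density a b = (\<lambda>x. if x \<in> unit_simplex then
        Gamma (l1_norm a + b) / (Gamma b * (\<Prod>i\<in>UNIV. Gamma (a $ i)))
        * (1 - l1_norm x) powr (b - 1) * (\<Prod>i\<in>UNIV. (x $ i) powr (a $ i - 1))
      else 0)"
    by (rule ext) (rule dirichlet_density_def)
  also have "\<dots> \<in> borel_measurable borel" by measurable
  finally show ?thesis .
qed

lemma dirichlet_density_nonneg: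
  assumes "\<And>i. 0 < a $ i" "0 < b"
  shows "0 \<le> dirichlet_density a b x"
proof -
  have "0 < l1_norm a + b" using assms(2) l1_norm_nonneg[of a] by simp
  then have "0 < Gamma (l1_norm a + b)" "0 < Gamma b" "0 < (\<Prod>i\<in>UNIV. Gamma (a $ i))"
    using assms by (auto intro!: prod_pos Gamma_real_pos)
  then show ?thesis
    unfolding dirichlet_density_def
    by (auto intro!: mult_nonneg_nonneg divide_nonneg_nonneg prod_nonneg intro: less_imp_le
        simp del: prod_zero_iff simp: assms Gamma_real_pos)
qed

lemma sets_dirichlet_measure [simp, measurable_cong]: "sets (dirichlet_measure a b) = sets borel"
  by (simp add: dirichlet_measure_def)

lemma space_dirichlet_measure [simp]: "space (dirichlet_measure a b) = UNIV"
  by (simp add: dirichlet_measure_def)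

lemma prob_space_dirichlet:
  assumes a: "\<And>i. 0 < a $ i" and b: "0 < b"
  shows "prob_space (dirichlet_measure a b)"
proof
  let ?c = "Gamma (l1_norm a + b) / (Gamma b * (\<Prod>i\<in>UNIV. Gamma (a $ i)))"
  let ?F = "\<lambda>x. if x \<in> unit_simplex
            then (1 - l1_norm x) powr (b - 1) * (\<Prod>i\<in>UNIV. (x $ i) powr (a $ i - 1)) else (0::real)"
  have G: "Gamma b > 0" "(\<Prod>i\<in>UNIV. Gamma (a $ i)) > 0" "Gamma (l1_norm a + b) > 0"
    using a b l1_norm_nonneg[of a] by (auto intro!: prod_pos Gamma_real_pos)
  have D: "ennreal (dirichlet_density a b x) = ennreal ?c * ennreal (?F x)" for x
    using G by (auto simp: dirichlet_density_def ennreal_mult'[symmetric] mult.assoc)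
  have "emeasure (dirichlet_measure a b) (space (dirichlet_measure a b)) = (\<integral>\<^sup>+ x. ennreal (dirichlet_density a b x) \<partial>lborel)"
    by (simp add: dirichlet_measure_def emeasure_density)
  also have "\<dots> = ennreal ?c * (\<integral>\<^sup>+ x. ennreal (?F x) \<partial>lborel)"
    unfolding D by (rule nn_integral_cmult) measurable
  also have "\<dots> = ennreal (?c * (Gamma b * (\<Prod>i\<in>UNIV. Gamma (a $ i)) / Gamma (l1_norm a + b)))"
    unfolding nn_integral_Dirichlet[OF a b] using G by (intro ennreal_mult'[symmetric]) auto
  also have "?c * (Gamma b * (\<Prod>i\<in>UNIV. Gamma (a $ i)) / Gamma (l1_norm a + b)) = 1"
    using G by (simp del: prod_zero_iff)
  finally show "emeasure (dirichlet_measure a b) (space (dirichlet_measure a b)) = 1" by simp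
qed

lemma AE_dirichlet:
  "AE x in dirichlet_measure a b. x \<in> unit_simplex"
  unfolding dirichlet_measure_def by (subst AE_density) (auto simp: dirichlet_density_def)

lemma integral_dirichlet:
  assumes "\<And>i. 0 < a $ i" "0 < b" "g \<in> borel_measurable borel"
  shows "(\<integral>x. g x \<partial>dirichlet_measure a b) = (\<integral>x. dirichlet_density a b x * g x \<partial>lborel)"
  unfolding dirichlet_measure_def
  using assms dirichlet_density_nonneg[OF assms(1,2)] by (subst integral_real_density) auto

lemma integrable_dirichlet:
  fixes g :: "real ^ 'd \<Rightarrow> real"
  assumes "\<And>i. 0 < a $ i" "0 < b" "g \<in> borel_measurable borel"
    and "\<And>x. x \<in> unit_simplex \<Longrightarrow> \<bar>g x\<bar> \<le> B"
  shows "integrable (dirichlet_measure a b) g"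
proof -
  interpret prob_space "dirichlet_measure a b" by (rule prob_space_dirichlet) (use assms in auto)
  show ?thesis
    using AE_dirichlet[of a b] assms(3,4)
    by (intro integrable_const_bound[of _ B]) (auto elim: eventually_mono)
qed

text \<open>
  A monomial times a Dirichlet density is a multiple of the Dirichlet density with shifted parameters,
  and the multiple is a quotient of gamma values, hence of rising factorials. Integrating this
  identity gives all moments at once.
\<close>
lemma dirichlet_density_times_monomial:
  fixes a :: "real ^ 'd" and k :: "'d \<Rightarrow> nat"
  assumes a: "\<And>i. 0 < a $ i" and b: "0 < b"
  shows "dirichlet_density a b x * (\<Prod>i\<in>UNIV. (x $ i) ^ k i) =
    (\<Prod>i\<in>UNIV. pochhammer (a $ i) (k i)) / pochhammer (l1_norm a + b) (\<Sum>i\<in>UNIV. k i)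
      * dirichlet_density (\<chi> i. a $ i + real (k i)) b x"
proof (cases "x \<in> unit_simplex")
  case True
  have A: "0 < l1_norm a + b" using b l1_norm_nonneg[of a] by simp
  have l1: "l1_norm (\<chi> i. a $ i + real (k i)) + b = (l1_norm a + b) + real (\<Sum>i\<in>UNIV. k i)"
    using a by (simp add: l1_norm_def sum.distrib less_imp_le add_nonneg_nonneg)
  have poch: "Gamma (z + real n) = pochhammer z n * Gamma z" if "0 < z" for z n
  proof -
    have "z \<notin> \<int>\<^sub>\<le>\<^sub>0" using that by (auto elim!: nonpos_Ints_cases)
    then show ?thesis using pochhammer_Gamma[of z n] Gamma_real_pos[OF that] by (simp add: field_simps)
  qed
  have G: "Gamma b > 0" "(\<Prod>i\<in>UNIV. Gamma (a $ i)) > 0" "Gamma (l1_norm a + b) > 0"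
    using a b A by (auto intro!: prod_pos Gamma_real_pos)
  have P: "pochhammer (l1_norm a + b) (\<Sum>i\<in>UNIV. k i) > 0" "(\<Prod>i\<in>UNIV. pochhammer (a $ i) (k i)) > 0"
    using A a by (auto intro!: pochhammer_pos prod_pos)
  have pw: "(\<Prod>i\<in>UNIV. (x $ i) powr (a $ i + real (k i) - 1)) =
      (\<Prod>i\<in>UNIV. (x $ i) powr (a $ i - 1)) * (\<Prod>i\<in>UNIV. (x $ i) ^ k i)"
    unfolding prod.distrib[symmetric]
  proof (rule prod.cong[OF refl])
    fix i
    show "(x $ i) powr (a $ i + real (k i) - 1) = (x $ i) powr (a $ i - 1) * (x $ i) ^ k i"
    proof (cases "x $ i = 0")
      case False
      then have "x $ i > 0" using unit_simplexD(1)[OF True, of i] by simp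
      moreover have "a $ i + real (k i) - 1 = (a $ i - 1) + real (k i)" by simp
      ultimately show ?thesis by (simp only: powr_add powr_realpow)
    qed simp
  qed
  have dk: "dirichlet_density (\<chi> i. a $ i + real (k i)) b x =
      (pochhammer (l1_norm a + b) (\<Sum>i\<in>UNIV. k i) * Gamma (l1_norm a + b))
        / (Gamma b * ((\<Prod>i\<in>UNIV. pochhammer (a $ i) (k i)) * (\<Prod>i\<in>UNIV. Gamma (a $ i))))
        * (1 - l1_norm x) powr (b - 1) * ((\<Prod>i\<in>UNIV. (x $ i) powr (a $ i - 1)) * (\<Prod>i\<in>UNIV. (x $ i) ^ k i))"
    unfolding dirichlet_density_def l1 if_P[OF True] poch[OF A]
    by (simp add: poch a pw prod.distrib)
  show ?thesis unfolding dk using True G P by (simp add: dirichlet_density_def del: prod_zero_iff)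
next
  case False
  then show ?thesis by (simp add: dirichlet_density_def)
qed

lemma dirichlet_moment:
  fixes a :: "real ^ 'd" and k :: "'d \<Rightarrow> nat"
  assumes a: "\<And>i. 0 < a $ i" and b: "0 < b"
  shows "(\<integral>x. (\<Prod>i\<in>UNIV. (x $ i) ^ k i) \<partial>dirichlet_measure a b) =
    (\<Prod>i\<in>UNIV. pochhammer (a $ i) (k i)) / pochhammer (l1_norm a + b) (\<Sum>i\<in>UNIV. k i)"
proof -
  have ak: "0 < (\<chi> i. a $ i + real (k i)) $ i" for i using a[of i] by simp
  interpret K: prob_space "dirichlet_measure (\<chi> i. a $ i + real (k i)) b"
    by (rule prob_space_dirichlet[OF ak b])
  have one: "(\<integral>x. dirichlet_density (\<chi> i. a $ i + real (k i)) b x \<partial>lborel) = 1"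
    using integral_dirichlet[OF ak b, of "\<lambda>_. 1"] K.prob_space by simp
  have "(\<integral>x. (\<Prod>i\<in>UNIV. (x $ i) ^ k i) \<partial>dirichlet_measure a b) =
      (\<integral>x. dirichlet_density a b x * (\<Prod>i\<in>UNIV. (x $ i) ^ k i) \<partial>lborel)"
    by (rule integral_dirichlet[OF a b]) measurable
  then show ?thesis unfolding dirichlet_density_times_monomial[OF a b] by (simp add: one)
qed

section \<open>Central moments of the kernel\<close>

text \<open>
  This lemma and the next ones are the algebra behind the moment expansions. Here \<open>N\<close> stands for the
  inverse bandwidth and \<open>D\<close> for the dimension plus one, so that \<open>N + D\<close> is the sum of all
  parameters of the Dirichlet law; the quotients are the moments of one or two coordinates.
\<close>
lemma mean_expansion:
  fixes s N D :: real
  assumes "0 \<le> s" "s \<le> 1" "1 \<le> N" "1 \<le> D"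
  shows "\<bar>((s * N + 1) / (N + D) - s) - (1 - D * s) / N\<bar> \<le> D\<^sup>2 / N\<^sup>2"
proof -
  have Ds: "0 \<le> D * s" "D * s \<le> D" using assms by (auto simp: mult_left_le)
  have "((s * N + 1) / (N + D) - s) - (1 - D * s) / N = - ((1 - D * s) * D / (N * (N + D)))"
    using assms by (simp add: divide_simps) (simp add: algebra_simps)
  moreover have "\<bar>(1 - D * s) * D / (N * (N + D))\<bar> \<le> D * D / (N * N)"
  proof -
    have "\<bar>1 - D * s\<bar> \<le> D" using Ds assms by linarith
    then show ?thesis unfolding abs_divide abs_mult
      using assms by (intro frac_le mult_mono) auto
  qed
  ultimately show ?thesis by (simp add: power2_eq_square)
qed

text \<open>
  Both the variance and the covariance have the form of the quotient below; replacing its denominator by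
  \<open>N\<^sup>2\<close> costs a term of order \<open>1 / N\<^sup>2\<close>.
\<close>
lemma covariance_numerator_bound:
  fixes N D r c :: real
  assumes "1 \<le> N" "1 \<le> D" "\<bar>r\<bar> \<le> 1 + 2 * (D + 1) + D * (D + 1)" "\<bar>c\<bar> \<le> 1"
  shows "\<bar>(c * N + r) / ((N + D) * (N + D + 1)) - c / N\<bar> \<le> 10 * (D + 1)\<^sup>2 / N\<^sup>2"
proof -
  let ?Q = "(N + D) * (N + D + 1)"
  have Q: "N * N \<le> ?Q" using assms by (intro mult_mono) auto
  have Q0: "0 < ?Q" using assms by (intro mult_pos_pos) auto
  have cs: "\<bar>c * ((2 * D + 1) + D * (D + 1) / N)\<bar> \<le> 2 * D + 1 + D * (D + 1)"
  proof -
    have "D * (D + 1) / N \<le> D * (D + 1) / 1" using assms by (intro divide_left_mono) auto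
    moreover have "0 \<le> D * (D + 1) / N" using assms by auto
    ultimately have "\<bar>(2 * D + 1) + D * (D + 1) / N\<bar> \<le> 2 * D + 1 + D * (D + 1)" using assms by simp
    then have "\<bar>c\<bar> * \<bar>(2 * D + 1) + D * (D + 1) / N\<bar> \<le> 1 * (2 * D + 1 + D * (D + 1))"
      using assms by (intro mult_mono) auto
    then show ?thesis by (simp add: abs_mult)
  qed
  have "c / N = c * ?Q / (N * ?Q)" using assms Q0 by simp
  moreover have "(c * N + r) / ?Q = (c * N + r) * N / (N * ?Q)" using assms by simp
  ultimately have "(c * N + r) / ?Q - c / N = ((c * N + r) * N - c * ?Q) / (N * ?Q)"
    by (simp only: diff_divide_distrib)
  also have "(c * N + r) * N - c * ?Q = N * (r - c * ((2 * D + 1) + D * (D + 1) / N))"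
    using assms by (simp add: field_simps)
  finally have "(c * N + r) / ?Q - c / N = (r - c * ((2 * D + 1) + D * (D + 1) / N)) / ?Q"
    using assms by simp
  then have "\<bar>(c * N + r) / ?Q - c / N\<bar> = \<bar>r - c * ((2 * D + 1) + D * (D + 1) / N)\<bar> / ?Q"
    using Q0 by (simp only: abs_divide abs_of_pos)
  also have "\<dots> \<le> (10 * (D + 1)\<^sup>2) / (N * N)"
  proof (intro frac_le)
    have "\<bar>r - c * ((2 * D + 1) + D * (D + 1) / N)\<bar> \<le>
        (1 + 2 * (D + 1) + D * (D + 1)) + (2 * D + 1 + D * (D + 1))"
      using cs assms(3) by linarith
    also have "\<dots> = 2 * D\<^sup>2 + 6 * D + 4" by (simp add: power2_eq_square algebra_simps)
    also have "\<dots> \<le> 10 * (D + 1)\<^sup>2" using assms by (simp add: power2_sum)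
    finally show "\<bar>r - c * ((2 * D + 1) + D * (D + 1) / N)\<bar> \<le> 10 * (D + 1)\<^sup>2" .
  qed (use assms Q in auto)
  finally show ?thesis by (simp add: power2_eq_square)
qed

lemma covariance_expansion:
  fixes s t N D :: real
  assumes "0 \<le> s" "s \<le> 1" "0 \<le> t" "t \<le> 1" "1 \<le> N" "1 \<le> D"
  shows "\<bar>((s * N + 1) * (t * N + 1) / ((N + D) * (N + D + 1))
      - s * ((t * N + 1) / (N + D)) - t * ((s * N + 1) / (N + D)) + s * t) - (- (s * t)) / N\<bar>
    \<le> 10 * (D + 1)\<^sup>2 / N\<^sup>2"
proof -
  let ?r = "1 - (s + t) * (D + 1) + s * t * (D * (D + 1))"
  have nz: "N + D \<noteq> 0" "N + D + 1 \<noteq> 0" using assms by auto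
  have num: "(s * N + 1) * (t * N + 1) / ((N + D) * (N + D + 1))
      - s * ((t * N + 1) / (N + D)) - t * ((s * N + 1) / (N + D)) + s * t
    = (- (s * t) * N + ?r) / ((N + D) * (N + D + 1))"
    using nz by (simp add: divide_simps) (simp add: algebra_simps)
  have st: "0 \<le> s * t" "s * t \<le> 1" using assms by (auto intro: mult_le_one)
  have "0 \<le> (s + t) * (D + 1)" "(s + t) * (D + 1) \<le> 2 * (D + 1)"
    using assms by (auto intro!: mult_right_mono simp del: distrib_left_numeral)
  moreover have "0 \<le> s * t * (D * (D + 1))" "s * t * (D * (D + 1)) \<le> 1 * (D * (D + 1))"
    using st assms by (auto intro!: mult_right_mono simp: mult_le_one)
  ultimately have "\<bar>?r\<bar> \<le> 1 + 2 * (D + 1) + D * (D + 1)" by linarith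
  then show ?thesis
    unfolding num using assms st by (intro covariance_numerator_bound) auto
qed

lemma variance_expansion:
  fixes s N D :: real
  assumes "0 \<le> s" "s \<le> 1" "1 \<le> N" "1 \<le> D"
  shows "\<bar>((s * N + 1) * (s * N + 2) / ((N + D) * (N + D + 1))
      - 2 * s * ((s * N + 1) / (N + D)) + s * s) - (s * (1 - s)) / N\<bar> \<le> 10 * (D + 1)\<^sup>2 / N\<^sup>2"
proof -
  let ?r = "2 - 2 * s * (D + 1) + s * s * (D * (D + 1))"
  have nz: "N + D \<noteq> 0" "N + D + 1 \<noteq> 0" using assms by auto
  have num: "(s * N + 1) * (s * N + 2) / ((N + D) * (N + D + 1))
      - 2 * s * ((s * N + 1) / (N + D)) + s * s
    = ((s * (1 - s)) * N + ?r) / ((N + D) * (N + D + 1))"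
    using nz by (simp add: divide_simps) (simp add: algebra_simps)
  have st: "0 \<le> s * s" "s * s \<le> 1" using assms by (auto intro: mult_le_one)
  have ss: "0 \<le> s * (1 - s)" "s * (1 - s) \<le> 1" using assms by (auto intro: mult_le_one)
  have "0 \<le> 2 * s * (D + 1)" "2 * s * (D + 1) \<le> 2 * (D + 1)"
    using assms by (auto intro!: mult_right_mono simp del: distrib_left_numeral)
  moreover have "0 \<le> s * s * (D * (D + 1))" "s * s * (D * (D + 1)) \<le> 1 * (D * (D + 1))"
    using st assms by (auto intro!: mult_right_mono simp: mult_le_one)
  moreover have "0 \<le> D * (D + 1)" using assms by auto
  ultimately have "\<bar>?r\<bar> \<le> 1 + 2 * (D + 1) + D * (D + 1)"
    unfolding abs_le_iff mult_1_left using assms(4) by (smt (verit))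
  then show ?thesis
    unfolding num using assms ss by (intro covariance_numerator_bound) auto
qed

lemma quadratic_bound:
  fixes N :: real
  assumes "1 \<le> N" "\<bar>c2\<bar> \<le> B2" "\<bar>c1\<bar> \<le> B1" "\<bar>c0\<bar> \<le> B0"
  shows "\<bar>c2 * N^2 + c1 * N + c0\<bar> \<le> (B2 + B1 + B0) * N^2"
proof -
  have N: "1 \<le> N^2" "N \<le> N^2"
    using assms mult_mono[of 1 N 1 N] mult_mono[of 1 N N N] by (auto simp: power2_eq_square)
  have "\<bar>c2 * N^2\<bar> \<le> B2 * N^2" unfolding abs_mult
    using assms by (intro mult_mono) auto
  moreover have "\<bar>c1 * N\<bar> \<le> B1 * N^2" unfolding abs_mult
    using assms N by (intro mult_mono) auto
  moreover have "\<bar>c0 * 1\<bar> \<le> B0 * N^2" unfolding abs_mult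
    using assms N by (intro mult_mono) auto
  ultimately show ?thesis by (simp add: distrib_right)
qed

text \<open>
  Over the common denominator, the coefficients of \<open>N ^ 4\<close> and \<open>N ^ 3\<close> cancel. The numerator is
  quadratic in \<open>N\<close>, while the denominator has degree four, which gives order \<open>1 / N\<^sup>2\<close>.
\<close>
lemma fourth_moment_expansion:
  fixes s N D :: real
  assumes "0 \<le> s" "s \<le> 1" "1 \<le> N" "1 \<le> D"
  shows "\<bar>(s * N + 1) * (s * N + 2) * (s * N + 3) * (s * N + 4) / ((N + D) * (N + D + 1) * (N + D + 2) * (N + D + 3))
      - 4 * s * ((s * N + 1) * (s * N + 2) * (s * N + 3) / ((N + D) * (N + D + 1) * (N + D + 2)))
      + 6 * s^2 * ((s * N + 1) * (s * N + 2) / ((N + D) * (N + D + 1)))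
      - 4 * s^3 * ((s * N + 1) / (N + D)) + s^4\<bar> \<le> 700 * D^4 / N\<^sup>2"
proof -
  let ?q = "(N + D) * (N + D + 1) * (N + D + 2) * (N + D + 3)"
  let ?c0 = "24 * (s^0 * D^0) - 72 * (s^1 * D^0) - 24 * (s^1 * D^1) + 72 * (s^2 * D^0) + 60 * (s^2 * D^1) + 12 * (s^2 * D^2) - 24 * (s^3 * D^0) - 44 * (s^3 * D^1) - 24 * (s^3 * D^2) - 4 * (s^3 * D^3) + 6 * (s^4 * D^1) + 11 * (s^4 * D^2) + 6 * (s^4 * D^3) + 1 * (s^4 * D^4)"
  let ?c1 = "26 * (s^1 * D^0) - 72 * (s^2 * D^0) - 20 * (s^2 * D^1) + 64 * (s^3 * D^0) + 42 * (s^3 * D^1) + 6 * (s^3 * D^2) - 18 * (s^4 * D^0) - 22 * (s^4 * D^1) - 6 * (s^4 * D^2)"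
  let ?c2 = "3 * (s^2 * D^0) - 6 * (s^3 * D^0) + 3 * (s^4 * D^0)"
  let ?num = "?c2 * N^2 + ?c1 * N + ?c0"
  have nz: "N + D \<noteq> 0" "N + D + 1 \<noteq> 0" "N + D + 2 \<noteq> 0" "N + D + 3 \<noteq> 0" using assms by auto
  have e1: "(s * N + 1) / (N + D) = (s * N + 1) * ((N + D + 1) * (N + D + 2) * (N + D + 3)) / ?q"
    using nz by (simp add: divide_simps)
  have e2: "(s * N + 1) * (s * N + 2) / ((N + D) * (N + D + 1))
      = (s * N + 1) * (s * N + 2) * ((N + D + 2) * (N + D + 3)) / ?q"
    using nz by (simp add: divide_simps)
  have e3: "(s * N + 1) * (s * N + 2) * (s * N + 3) / ((N + D) * (N + D + 1) * (N + D + 2))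
      = (s * N + 1) * (s * N + 2) * (s * N + 3) * (N + D + 3) / ?q"
    using nz by (simp add: divide_simps)
  have e0: "s^4 = s^4 * ?q / ?q" using nz by simp
  have "(s * N + 1) * (s * N + 2) * (s * N + 3) * (s * N + 4) / ?q
      - 4 * s * ((s * N + 1) * (s * N + 2) * (s * N + 3) / ((N + D) * (N + D + 1) * (N + D + 2)))
      + 6 * s^2 * ((s * N + 1) * (s * N + 2) / ((N + D) * (N + D + 1)))
      - 4 * s^3 * ((s * N + 1) / (N + D)) + s^4
    = ((s * N + 1) * (s * N + 2) * (s * N + 3) * (s * N + 4)
      - 4 * s * ((s * N + 1) * (s * N + 2) * (s * N + 3) * (N + D + 3))
      + 6 * s^2 * ((s * N + 1) * (s * N + 2) * ((N + D + 2) * (N + D + 3)))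
      - 4 * s^3 * ((s * N + 1) * ((N + D + 1) * (N + D + 2) * (N + D + 3))) + s^4 * ?q) / ?q"
    by (subst e0, subst e1, subst e2, subst e3) (simp only: times_divide_eq_right add_divide_distrib diff_divide_distrib)
  also have "((s * N + 1) * (s * N + 2) * (s * N + 3) * (s * N + 4)
      - 4 * s * ((s * N + 1) * (s * N + 2) * (s * N + 3) * (N + D + 3))
      + 6 * s^2 * ((s * N + 1) * (s * N + 2) * ((N + D + 2) * (N + D + 3)))
      - 4 * s^3 * ((s * N + 1) * ((N + D + 1) * (N + D + 2) * (N + D + 3))) + s^4 * ?q) = ?num"
    by algebra
  finally have eq: "(s * N + 1) * (s * N + 2) * (s * N + 3) * (s * N + 4) / ?q
      - 4 * s * ((s * N + 1) * (s * N + 2) * (s * N + 3) / ((N + D) * (N + D + 1) * (N + D + 2)))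
      + 6 * s^2 * ((s * N + 1) * (s * N + 2) / ((N + D) * (N + D + 1)))
      - 4 * s^3 * ((s * N + 1) / (N + D)) + s^4 = ?num / ?q" .
  have m: "0 \<le> s^i * D^j \<and> s^i * D^j \<le> D^4" if "j \<le> 4" for i j
  proof -
    have "s^i * D^j \<le> 1 * D^4"
      using assms that by (intro mult_mono power_increasing power_le_one) auto
    then show ?thesis using assms by simp
  qed
  have le: "(0::nat) \<le> 4" "(1::nat) \<le> 4" "(2::nat) \<le> 4" "(3::nat) \<le> 4" "(4::nat) \<le> 4"
    by simp_all
  have c0: "\<bar>?c0\<bar> \<le> 384 * D^4"
    unfolding abs_le_iff using m[OF le(1), of 0] m[OF le(1), of 1] m[OF le(2), of 1] m[OF le(1), of 2] m[OF le(2), of 2] m[OF le(3), of 2] m[OF le(1), of 3] m[OF le(2), of 3] m[OF le(3), of 3] m[OF le(4), of 3] m[OF le(2), of 4] m[OF le(3), of 4] m[OF le(4), of 4] m[OF le(5), of 4] by linarith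
  have c1: "\<bar>?c1\<bar> \<le> 276 * D^4"
    unfolding abs_le_iff using m[OF le(1), of 1] m[OF le(1), of 2] m[OF le(2), of 2] m[OF le(1), of 3] m[OF le(2), of 3] m[OF le(3), of 3] m[OF le(1), of 4] m[OF le(2), of 4] m[OF le(3), of 4] by linarith
  have c2: "\<bar>?c2\<bar> \<le> 12 * D^4"
    unfolding abs_le_iff using m[OF le(1), of 2] m[OF le(1), of 3] m[OF le(1), of 4] by linarith
  have num: "\<bar>?num\<bar> \<le> (12 * D^4 + 276 * D^4 + 384 * D^4) * N^2"
    by (rule quadratic_bound[OF assms(3) c2 c1 c0])
  have "N * N * N * N \<le> ?q" using assms by (intro mult_mono) auto
  then have q: "N^2 * N^2 \<le> ?q" by (simp add: power2_eq_square mult.assoc)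
  have "(12 * D^4 + 276 * D^4 + 384 * D^4) * N^2 \<le> 700 * D^4 * N^2"
    by (intro mult_right_mono) auto
  with num have num': "\<bar>?num\<bar> \<le> 700 * D^4 * N^2" by (rule order_trans)
  have q0: "0 < N^2 * N^2" using assms by simp
  then have "\<bar>?q\<bar> = ?q" using q by (intro abs_of_pos) (rule less_le_trans)
  then have "\<bar>?num / ?q\<bar> \<le> 700 * D^4 * N^2 / (N^2 * N^2)"
    unfolding abs_divide using num' q q0 by (simp only:) (intro frac_le; simp)
  also have "\<dots> = 700 * D^4 / N^2"
    using assms by (intro nonzero_mult_divide_mult_cancel_right) simp
  finally show ?thesis unfolding eq .
qed

definition kernel_measure :: "real \<Rightarrow> real ^ 'd \<Rightarrow> (real ^ 'd) measure" where
  "kernel_measure b s = dirichlet_measure (\<chi> i. s $ i / b + 1) ((1 - l1_norm s) / b + 1)"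

lemma sets_kernel_measure [simp, measurable_cong]: "sets (kernel_measure b s) = sets borel"
  by (simp add: kernel_measure_def)

lemma kernel_params_pos:
  fixes s :: "real ^ 'd"
  assumes "s \<in> unit_simplex" "0 < b"
  shows "0 < (\<chi> i. s $ i / b + 1) $ i" "0 < (1 - l1_norm s) / b + 1"
  using unit_simplexD[OF assms(1)] assms(2) by (auto intro!: add_nonneg_pos divide_nonneg_pos)

text \<open>
  The sum of the parameters does not depend on \<open>s\<close>, so all moments of one order share a denominator,
  which is what makes their expansions uniform in \<open>s\<close>.
\<close>
lemma kernel_params_sum:
  fixes s :: "real ^ 'd"
  assumes "s \<in> unit_simplex" "0 < b"
  shows "l1_norm (\<chi> i. s $ i / b + 1) + ((1 - l1_norm s) / b + 1) = 1 / b + (real CARD('d) + 1)"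
proof -
  have "l1_norm (\<chi> i. s $ i / b + 1) = (\<Sum>i\<in>UNIV. s $ i / b + 1)"
    unfolding l1_norm_def using unit_simplexD(1)[OF assms(1)] assms(2)
    by (intro sum.cong) (auto intro!: abs_of_nonneg add_nonneg_nonneg divide_nonneg_pos)
  also have "\<dots> = l1_norm s / b + real CARD('d)"
    by (simp add: sum.distrib l1_norm_simplex[OF assms(1)] sum_divide_distrib)
  finally show ?thesis by (simp add: diff_divide_distrib)
qed

lemma prob_space_kernel:
  assumes "s \<in> unit_simplex" "0 < b"
  shows "prob_space (kernel_measure b s)"
  unfolding kernel_measure_def using kernel_params_pos[OF assms] by (intro prob_space_dirichlet)

lemma AE_kernel: "AE x in kernel_measure b s. x \<in> unit_simplex"
  unfolding kernel_measure_def by (rule AE_dirichlet)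

lemma integrable_kernel:
  fixes g :: "real ^ 'd \<Rightarrow> real"
  assumes "s \<in> unit_simplex" "0 < b" "g \<in> borel_measurable borel" "continuous_on unit_simplex g"
  shows "integrable (kernel_measure b s) g"
proof -
  obtain B where "\<And>x. x \<in> unit_simplex \<Longrightarrow> \<bar>g x\<bar> \<le> B"
    using simplex_bounded_of_continuous[OF assms(4)] by blast
  then show ?thesis
    unfolding kernel_measure_def using kernel_params_pos[OF assms(1,2)] assms(3)
    by (intro integrable_dirichlet)
qed

lemma kernel_moment:
  fixes s :: "real ^ 'd"
  assumes "s \<in> unit_simplex" "0 < b"
  shows "(\<integral>x. (x $ i) ^ m \<partial>kernel_measure b s)
    = pochhammer (s $ i / b + 1) m / pochhammer (1 / b + (real CARD('d) + 1)) m"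
proof -
  let ?k = "\<lambda>j. if j = i then m else 0"
  have p: "(\<Prod>j\<in>UNIV. (x $ j) ^ ?k j) = (x $ i) ^ m" for x :: "real ^ 'd"
    by (simp add: if_distrib[of "\<lambda>n. _ ^ n"] cong: if_cong)
  have q: "(\<Prod>j\<in>UNIV. pochhammer ((\<chi> i. s $ i / b + 1) $ j) (?k j)) = pochhammer (s $ i / b + 1) m"
    by (simp add: if_distrib[of "pochhammer _"] cong: if_cong)
  show ?thesis
    using dirichlet_moment[OF kernel_params_pos[OF assms], of ?k]
    unfolding p q kernel_params_sum[OF assms] kernel_measure_def[symmetric] by simp
qed

lemma kernel_moment_mixed:
  fixes s :: "real ^ 'd"
  assumes "s \<in> unit_simplex" "0 < b" "i \<noteq> j"
  shows "(\<integral>x. x $ i * x $ j \<partial>kernel_measure b s)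
    = (s $ i / b + 1) * (s $ j / b + 1) / pochhammer (1 / b + (real CARD('d) + 1)) 2"
proof -
  let ?k = "\<lambda>l. (if l = i then 1 else 0) + (if l = j then 1 else (0::nat))"
  have "(\<Prod>l\<in>UNIV. (x $ l) ^ ?k l) = x $ i * x $ j" for x :: "real ^ 'd"
    by (simp add: power_add prod.distrib if_distrib[of "\<lambda>n. _ ^ n"] cong: if_cong)
  moreover have "(\<Prod>l\<in>UNIV. pochhammer ((\<chi> i. s $ i / b + 1) $ l) (?k l)) = (s $ i / b + 1) * (s $ j / b + 1)"
  proof -
    have "pochhammer ((\<chi> i. s $ i / b + 1) $ l) (?k l)
        = (if l = i then s $ i / b + 1 else 1) * (if l = j then s $ j / b + 1 else 1)" for l
      using assms(3) by auto
    then show ?thesis by (simp add: prod.distrib)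
  qed
  moreover have "(\<Sum>l\<in>UNIV. ?k l) = 2"
    by (simp only: sum.distrib) simp
  ultimately show ?thesis
    using dirichlet_moment[OF kernel_params_pos[OF assms(1,2)], of ?k]
    unfolding kernel_params_sum[OF assms(1,2)] kernel_measure_def[symmetric] by (simp only:)
qed

text \<open>
  Up to \<open>O(b\<^sup>2)\<close>, the mean and the covariance are \<open>b\<close> times the weights of the first and second
  derivatives in \<open>bias_term\<close>, whose factor \<open>1 / 2\<close> is that of Taylor's formula. The constants depend on the dimension only.
\<close>
lemma kernel_moment_expansions:
  fixes s :: "real ^ 'd"
  assumes s: "s \<in> unit_simplex" and b: "0 < b" "b \<le> 1"
  defines "D \<equiv> real CARD('d) + 1"
  shows kernel_mean: "\<bar>(\<integral>x. x $ i - s $ i \<partial>kernel_measure b s) - b * (1 - D * s $ i)\<bar> \<le> D\<^sup>2 * b\<^sup>2"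
    and kernel_covariance: "\<bar>(\<integral>x. (x $ i - s $ i) * (x $ j - s $ j) \<partial>kernel_measure b s)
          - b * (s $ i * ((if i = j then 1 else 0) - s $ j))\<bar> \<le> 10 * (D + 1)\<^sup>2 * b\<^sup>2"
    and kernel_fourth_moment: "(\<integral>x. (x $ i - s $ i) ^ 4 \<partial>kernel_measure b s) \<le> 700 * D ^ 4 * b\<^sup>2"
proof -
  interpret K: prob_space "kernel_measure b s" using s b by (intro prob_space_kernel) auto
  let ?E = "\<lambda>g. \<integral>x. g x \<partial>kernel_measure b s"
  define N where "N = 1 / b"
  have N: "1 \<le> N" using b by (simp add: N_def)
  have D: "1 \<le> D" by (simp add: D_def)
  have bN: "x / N = b * x" "x / N\<^sup>2 = x * b\<^sup>2" for x by (auto simp: N_def power_divide)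
  have int: "integrable (kernel_measure b s) g"
    if "g \<in> borel_measurable borel" "continuous_on unit_simplex g" for g :: "real ^ 'd \<Rightarrow> real"
    using integrable_kernel[OF s b(1) that] .
  have intp: "integrable (kernel_measure b s) (\<lambda>x. (x $ k) ^ m)" for k m
    by (rule int) (measurable, intro continuous_intros)
  have int1: "integrable (kernel_measure b s) (\<lambda>x. x $ k)" for k
    using intp[of k 1] by simp
  have int2: "integrable (kernel_measure b s) (\<lambda>x. x $ k * x $ l)" for k l
    by (rule int) (measurable, intro continuous_intros)
  have m1: "?E (\<lambda>x. x $ k) = (s $ k * N + 1) / (N + D)" for k
    using kernel_moment[OF s b(1), of k 1] by (simp add: N_def D_def)
  have m2: "?E (\<lambda>x. (x $ k) ^ 2) = (s $ k * N + 1) * (s $ k * N + 2) / ((N + D) * (N + D + 1))" for k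
    using kernel_moment[OF s b(1), of k 2]
    by (simp add: N_def D_def pochhammer_rec numeral_eq_Suc algebra_simps)
  have m3: "?E (\<lambda>x. (x $ k) ^ 3) = (s $ k * N + 1) * (s $ k * N + 2) * (s $ k * N + 3)
      / ((N + D) * (N + D + 1) * (N + D + 2))" for k
    using kernel_moment[OF s b(1), of k 3]
    by (simp add: N_def D_def pochhammer_Suc eval_nat_numeral(3) numeral_2_eq_2 add.assoc mult.assoc)
  have m4: "?E (\<lambda>x. (x $ k) ^ 4) = (s $ k * N + 1) * (s $ k * N + 2) * (s $ k * N + 3) * (s $ k * N + 4)
      / ((N + D) * (N + D + 1) * (N + D + 2) * (N + D + 3))" for k
    using kernel_moment[OF s b(1), of k 4]
    by (simp add: N_def D_def pochhammer_Suc eval_nat_numeral(2,3) numeral_2_eq_2 add.assoc mult.assoc)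
  have m11: "?E (\<lambda>x. x $ k * x $ l) = (s $ k * N + 1) * (s $ l * N + 1) / ((N + D) * (N + D + 1))"
    if "k \<noteq> l" for k l
    using kernel_moment_mixed[OF s b(1) that]
    by (simp add: N_def D_def pochhammer_Suc numeral_2_eq_2 add.assoc mult.assoc)
  note s01 = unit_simplexD(1,2)[OF s]
  show "\<bar>?E (\<lambda>x. x $ i - s $ i) - b * (1 - D * s $ i)\<bar> \<le> D\<^sup>2 * b\<^sup>2"
    using mean_expansion[OF s01[of i] N D] int1[of i]
    by (simp add: K.prob_space m1 bN)
  show "\<bar>?E (\<lambda>x. (x $ i - s $ i) * (x $ j - s $ j)) - b * (s $ i * ((if i = j then 1 else 0) - s $ j))\<bar>
      \<le> 10 * (D + 1)\<^sup>2 * b\<^sup>2"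
  proof (cases "i = j")
    case True
    have "?E (\<lambda>x. (x $ i - s $ i) * (x $ i - s $ i)) = ?E (\<lambda>x. (x $ i) ^ 2 - 2 * s $ i * x $ i + s $ i * s $ i)"
      by (simp add: algebra_simps power2_eq_square)
    also have "\<dots> = ?E (\<lambda>x. (x $ i) ^ 2) - 2 * s $ i * ?E (\<lambda>x. x $ i) + s $ i * s $ i"
      using intp[of i 2] int1[of i] by (simp add: K.prob_space)
    finally show ?thesis
      using variance_expansion[OF s01[of i] N D] True by (simp add: m1 m2 bN)
  next
    case False
    have "?E (\<lambda>x. (x $ i - s $ i) * (x $ j - s $ j))
        = ?E (\<lambda>x. x $ i * x $ j - s $ i * x $ j - s $ j * x $ i + s $ i * s $ j)"
      by (simp add: algebra_simps)
    also have "\<dots> = ?E (\<lambda>x. x $ i * x $ j) - s $ i * ?E (\<lambda>x. x $ j) - s $ j * ?E (\<lambda>x. x $ i) + s $ i * s $ j"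
      using int2[of i j] int1 by (simp add: K.prob_space)
    finally show ?thesis
      using covariance_expansion[OF s01[of i] s01[of j] N D] False by (simp add: m1 m11 bN)
  qed
  have "?E (\<lambda>x. (x $ i - s $ i) ^ 4) = ?E (\<lambda>x. (x $ i) ^ 4 - 4 * s $ i * (x $ i) ^ 3 + 6 * (s $ i)^2 * (x $ i) ^ 2
      - 4 * (s $ i)^3 * x $ i + (s $ i)^4)"
    by (rule arg_cong[where f = "integral\<^sup>L _"], rule ext) algebra
  also have "\<dots> = ?E (\<lambda>x. (x $ i) ^ 4) - 4 * s $ i * ?E (\<lambda>x. (x $ i) ^ 3) + 6 * (s $ i)^2 * ?E (\<lambda>x. (x $ i) ^ 2)
      - 4 * (s $ i)^3 * ?E (\<lambda>x. x $ i) + (s $ i)^4"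
    using intp[of i] int1[of i] by (simp add: K.prob_space)
  finally show "?E (\<lambda>x. (x $ i - s $ i) ^ 4) \<le> 700 * D ^ 4 * b\<^sup>2"
    using fourth_moment_expansion[OF s01[of i] N D] unfolding m1 m2 m3 m4 bN by linarith
qed

lemma kernel_variance_bound:
  fixes s :: "real ^ 'd"
  assumes s: "s \<in> unit_simplex" and b: "0 < b" "b \<le> 1"
  shows "(\<integral>x. (x $ i - s $ i)\<^sup>2 \<partial>kernel_measure b s) \<le> (1 + 10 * (real CARD('d) + 2)\<^sup>2) * b"
proof -
  let ?c = "10 * (real CARD('d) + 1 + 1)\<^sup>2"
  have "(\<integral>x. (x $ i - s $ i)\<^sup>2 \<partial>kernel_measure b s) \<le> b * (s $ i * (1 - s $ i)) + ?c * b\<^sup>2"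
    using kernel_covariance[OF assms, of i i] by (simp add: power2_eq_square)
  also have "\<dots> \<le> b * 1 + ?c * b"
    using b unit_simplexD(1,2)[OF s, of i]
    by (intro add_mono mult_left_mono) (auto intro: mult_le_one simp: power2_eq_square)
  finally show ?thesis by (simp add: algebra_simps)
qed

section \<open>Second-order Taylor expansion on the simplex\<close>

text \<open>
  The chain rule along a segment inside \<open>S\<close>. The derivative within \<open>S\<close> is only ever evaluated on a
  linear combination of axes, and it is linear, so the partials determine the directional derivative
  even at corners where no axis direction points into \<open>S\<close>.
\<close>
lemma partial_within_along_segment:
  fixes f :: "real ^ 'd \<Rightarrow> real"
  assumes f: "f differentiable_on S" and S: "convex S" "s \<in> S" "x \<in> S" and t: "t \<in> {0..1}"
  shows "((\<lambda>t. f (s + t *\<^sub>R (x - s))) has_real_derivative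
    (\<Sum>j\<in>UNIV. (x $ j - s $ j) * partial_within S j f (s + t *\<^sub>R (x - s)))) (at t within {0..1})"
proof -
  let ?p = "\<lambda>t. s + t *\<^sub>R (x - s)"
  let ?F = "\<lambda>z. frechet_derivative f (at z within S)"
  have F: "(f has_derivative ?F z) (at z within S)" if "z \<in> S" for z
    using f that by (simp add: differentiable_on_def frechet_derivative_works)
  have pS: "?p ` {0..1} \<subseteq> S"
  proof (clarsimp)
    fix t :: real assume "0 \<le> t" "t \<le> 1"
    then have "(1 - t) *\<^sub>R s + t *\<^sub>R x \<in> S" using S by (intro convexD) auto
    then show "?p t \<in> S" by (simp add: algebra_simps)
  qed
  have "(?p has_derivative (\<lambda>h. h *\<^sub>R (x - s))) (at t within {0..1})"
    by (auto intro!: derivative_eq_intros)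
  from has_derivative_in_compose2[OF F pS t this]
  have D: "((\<lambda>t. f (?p t)) has_derivative (\<lambda>h. ?F (?p t) (h *\<^sub>R (x - s)))) (at t within {0..1})" by simp
  have lin: "linear (?F (?p t))"
    using F pS t by (intro has_derivative_linear) blast
  have "?F (?p t) (h *\<^sub>R (x - s)) = (\<Sum>j\<in>UNIV. (x $ j - s $ j) * partial_within S j f (?p t)) * h" for h
  proof -
    have "x - s = (\<Sum>j\<in>UNIV. (x - s) $ j *\<^sub>R axis j 1)"
      using basis_expansion[of "x - s"] by (simp add: scalar_mult_eq_scaleR)
    then have "?F (?p t) (x - s) = ?F (?p t) (\<Sum>j\<in>UNIV. (x - s) $ j *\<^sub>R axis j 1)"
      by (rule arg_cong)
    also have "\<dots> = (\<Sum>j\<in>UNIV. (x - s) $ j *\<^sub>R ?F (?p t) (axis j 1))"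
      by (simp only: linear_sum[OF lin] linear_cmul[OF lin])
    finally show ?thesis
      using linear_cmul[OF lin, of h "x - s"] by (simp add: partial_within_def)
  qed
  with D show ?thesis by (simp add: has_field_derivative_def)
qed

text \<open>
  Restricting to the segment from \<open>s\<close> to \<open>x\<close> makes this a statement in one variable; the mean value
  inequality is applied first to the derivative and then to the function, both corrected by their
  Taylor polynomial. Derivatives at the end points are one-sided throughout.
\<close>
lemma C2_taylor_segment:
  fixes f :: "real ^ 'd \<Rightarrow> real"
  assumes f: "C2_on S f" and S: "convex S" "s \<in> S" "x \<in> S" and e: "0 \<le> e"
    and H: "\<And>z i j. z \<in> closed_segment s x \<Longrightarrow>
      \<bar>partial_within S i (partial_within S j f) z - partial_within S i (partial_within S j f) s\<bar> \<le> e"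
  shows "\<bar>f x - f s - (\<Sum>j\<in>UNIV. (x $ j - s $ j) * partial_within S j f s)
     - 1 / 2 * (\<Sum>j\<in>UNIV. \<Sum>i\<in>UNIV. (x $ j - s $ j) * ((x $ i - s $ i) * partial_within S i (partial_within S j f) s))\<bar>
    \<le> e * (\<Sum>i\<in>UNIV. \<bar>x $ i - s $ i\<bar>)\<^sup>2"
proof -
  let ?p = "\<lambda>t. s + t *\<^sub>R (x - s)"
  let ?v = "\<lambda>j. x $ j - s $ j"
  let ?w = "\<Sum>i\<in>UNIV. \<bar>?v i\<bar>"
  define g where "g t = f (?p t)" for t
  define g1 where "g1 t = (\<Sum>j\<in>UNIV. ?v j * partial_within S j f (?p t))" for t
  define g2 where "g2 t = (\<Sum>j\<in>UNIV. ?v j * (\<Sum>i\<in>UNIV. ?v i * partial_within S i (partial_within S j f) (?p t)))" for t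
  have Dg: "(g has_real_derivative g1 t) (at t within {0..1})" if "t \<in> {0..1}" for t
    unfolding g_def g1_def using f S that by (intro partial_within_along_segment) (auto simp: C2_on_def)
  have Dg1: "(g1 has_real_derivative g2 t) (at t within {0..1})" if "t \<in> {0..1}" for t
    unfolding g1_def g2_def using f S that
    by (intro DERIV_sum DERIV_cmult partial_within_along_segment) (auto simp: C2_on_def)
  have g2: "\<bar>g2 t - g2 0\<bar> \<le> e * ?w\<^sup>2" if "t \<in> {0..1}" for t
  proof -
    have seg: "?p t \<in> closed_segment s x"
      using that by (auto simp: closed_segment_def algebra_simps intro!: exI[of _ t])
    have "g2 t - g2 0 = (\<Sum>j\<in>UNIV. \<Sum>i\<in>UNIV. ?v j * (?v i *
        (partial_within S i (partial_within S j f) (?p t) - partial_within S i (partial_within S j f) s)))"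
      by (simp add: g2_def sum_distrib_left sum_subtractf[symmetric] algebra_simps)
    also have "\<bar>\<dots>\<bar> \<le> (\<Sum>j\<in>UNIV. \<Sum>i\<in>UNIV. \<bar>?v j\<bar> * (\<bar>?v i\<bar> * e))"
      by (intro order_trans[OF sum_abs] sum_mono)
         (auto simp: abs_mult intro!: mult_left_mono H[OF seg])
    also have "\<dots> = e * ?w\<^sup>2"
      by (simp add: power2_eq_square sum_product sum_distrib_left mult_ac)
    finally show ?thesis .
  qed
  have E: "0 \<le> e * ?w\<^sup>2" using e by simp
  have g1: "\<bar>g1 t - g1 0 - t * g2 0\<bar> \<le> e * ?w\<^sup>2" if "t \<in> {0..1}" for t
  proof -
    have "norm ((\<lambda>t. g1 t - t * g2 0) t - (\<lambda>t. g1 t - t * g2 0) 0) \<le> e * ?w\<^sup>2 * norm (t - 0)"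
      using that g2
      by (intro field_differentiable_bound[where S = "{0..1}" and f' = "\<lambda>t. g2 t - g2 0"])
         (auto intro!: derivative_eq_intros Dg1)
    also have "\<dots> \<le> e * ?w\<^sup>2 * 1" using that E by (intro mult_left_mono) auto
    finally show ?thesis by (simp add: algebra_simps)
  qed
  have "norm ((\<lambda>t. g t - t * g1 0 - t\<^sup>2 / 2 * g2 0) 1 - (\<lambda>t. g t - t * g1 0 - t\<^sup>2 / 2 * g2 0) 0)
      \<le> e * ?w\<^sup>2 * norm (1 - 0 :: real)"
    using g1
    by (intro field_differentiable_bound[where S = "{0..1}" and f' = "\<lambda>t. g1 t - g1 0 - t * g2 0"])
       (auto intro!: derivative_eq_intros Dg)
  then have "\<bar>g 1 - g 0 - g1 0 - 1 / 2 * g2 0\<bar> \<le> e * ?w\<^sup>2"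
    by (simp add: algebra_simps)
  then show ?thesis by (simp add: g_def g1_def g2_def sum_distrib_left)
qed

text \<open>
  If the displacement is shorter than the radius \<open>r\<close> of uniform continuity, the second partials vary
  little and the remainder is a small multiple of the squared displacement. If it is longer, the crude
  quadratic bound is multiplied by (displacement / \<open>r\<close>) squared, which is at least one, and becomes a
  fourth power.
\<close>
lemma C2_taylor_uniform:
  fixes f :: "real ^ 'd \<Rightarrow> real"
  assumes f: "C2_on unit_simplex f" and e: "0 < e"
  obtains K where "0 \<le> K"
    "\<And>s x. s \<in> unit_simplex \<Longrightarrow> x \<in> unit_simplex \<Longrightarrow>
      \<bar>f x - f s - (\<Sum>j\<in>UNIV. (x $ j - s $ j) * partial_within unit_simplex j f s)
         - 1 / 2 * (\<Sum>j\<in>UNIV. \<Sum>i\<in>UNIV. (x $ j - s $ j) * ((x $ i - s $ i)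
              * partial_within unit_simplex i (partial_within unit_simplex j f) s))\<bar>
      \<le> e * (\<Sum>i\<in>UNIV. (x $ i - s $ i)\<^sup>2) + K * (\<Sum>i\<in>UNIV. (x $ i - s $ i) ^ 4)"
proof -
  let ?S = "unit_simplex :: (real ^ 'd) set"
  let ?d = "real CARD('d)"
  let ?H = "\<lambda>i j. partial_within ?S i (partial_within ?S j f)"
  have d: "0 < ?d" by simp
  have cont: "continuous_on ?S (?H i j)" for i j using f by (simp add: C2_on_def)
  \<comment> \<open>Collecting the second partials in one matrix gives one modulus of continuity for all of them.\<close>
  define G where "G z = (\<chi> i. \<chi> j. ?H i j z)" for z
  have contG: "continuous_on ?S G" unfolding G_def by (intro continuous_intros cont)
  have HG: "\<bar>?H i j z - ?H i j s\<bar> \<le> dist (G z) (G s)" for i j z s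
  proof -
    have "\<bar>?H i j z - ?H i j s\<bar> = norm ((G z - G s) $ i $ j)" by (simp add: G_def)
    also have "\<dots> \<le> norm ((G z - G s) $ i)"
      using component_le_norm_cart[of "(G z - G s) $ i" j] by simp
    also have "\<dots> \<le> norm (G z - G s)" by (rule Finite_Cartesian_Product.norm_nth_le)
    finally show ?thesis by (simp add: dist_norm)
  qed
  have "uniformly_continuous_on ?S G"
    using compact_uniformly_continuous[OF contG compact_unit_simplex] .
  then obtain r where r: "0 < r" "\<And>s z. s \<in> ?S \<Longrightarrow> z \<in> ?S \<Longrightarrow> dist z s < r \<Longrightarrow> dist (G z) (G s) < e / ?d"
    using e d unfolding uniformly_continuous_on_def by (metis divide_pos_pos)
  obtain B where B: "0 \<le> B" "\<And>z. z \<in> ?S \<Longrightarrow> norm (G z) \<le> B"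
    using simplex_bounded_of_continuous[OF continuous_on_norm[OF contG]] by (metis abs_norm_cancel)
  let ?K = "2 * B / r\<^sup>2 * ?d ^ 3"
  show ?thesis
  proof (rule that[of ?K])
    show "0 \<le> ?K" using B r by simp
    fix s x assume s: "s \<in> ?S" and x: "x \<in> ?S"
    let ?v = "\<lambda>j. x $ j - s $ j"
    let ?R = "f x - f s - (\<Sum>j\<in>UNIV. ?v j * partial_within ?S j f s)
         - 1 / 2 * (\<Sum>j\<in>UNIV. \<Sum>i\<in>UNIV. ?v j * (?v i * ?H i j s))"
    let ?w = "\<Sum>i\<in>UNIV. \<bar>?v i\<bar>"
    have w2: "?w\<^sup>2 \<le> ?d * (\<Sum>i\<in>UNIV. (?v i)\<^sup>2)"
      using sum_squared_le_sum_of_squares[of "\<lambda>i. \<bar>?v i\<bar>" "UNIV :: 'd set"] by (simp add: mult.commute)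
    have w4: "?w ^ 4 \<le> ?d ^ 3 * (\<Sum>i\<in>UNIV. (?v i) ^ 4)"
    proof -
      have "(?w\<^sup>2)\<^sup>2 \<le> (?d * (\<Sum>i\<in>UNIV. (?v i)\<^sup>2))\<^sup>2"
        using w2 by (intro power_mono) auto
      also have "\<dots> \<le> ?d\<^sup>2 * (?d * (\<Sum>i\<in>UNIV. ((?v i)\<^sup>2)\<^sup>2))"
        unfolding power_mult_distrib
        using sum_squared_le_sum_of_squares[of "\<lambda>i. (?v i)\<^sup>2" "UNIV :: 'd set"]
        by (intro mult_left_mono) (auto simp: mult.commute)
      finally show ?thesis by (simp add: power2_eq_square power3_eq_cube power4_eq_xxxx mult_ac)
    qed
    have nw: "norm (x - s) \<le> ?w" using norm_le_l1_cart[of "x - s"] by simp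
    have sum2: "0 \<le> (\<Sum>i\<in>UNIV. (?v i)\<^sup>2)" and sum4: "0 \<le> (\<Sum>i\<in>UNIV. (?v i) ^ 4)"
      by (auto intro!: sum_nonneg)
    have segS: "closed_segment s x \<subseteq> ?S"
      by (rule closed_segment_subset[OF s x convex_unit_simplex])
    show "\<bar>?R\<bar> \<le> e * (\<Sum>i\<in>UNIV. (?v i)\<^sup>2) + ?K * (\<Sum>i\<in>UNIV. (?v i) ^ 4)"
    proof (cases "norm (x - s) < r")
      case True
      have "\<bar>?R\<bar> \<le> e / ?d * ?w\<^sup>2"
      proof (rule C2_taylor_segment[OF f convex_unit_simplex s x])
        show "0 \<le> e / ?d" using e by simp
        fix z i j assume z: "z \<in> closed_segment s x"
        then have "dist z s < r"
          using True segment_bound(1)[OF z] by (simp add: dist_norm norm_minus_commute)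
        then have "dist (G z) (G s) < e / ?d" using r(2)[OF s, of z] z segS by blast
        then show "\<bar>?H i j z - ?H i j s\<bar> \<le> e / ?d" using HG[where i=i and j=j and z=z and s=s] by linarith
      qed
      also have "\<dots> \<le> e / ?d * (?d * (\<Sum>i\<in>UNIV. (?v i)\<^sup>2))"
        using w2 e by (intro mult_left_mono) auto
      also have "\<dots> = e * (\<Sum>i\<in>UNIV. (?v i)\<^sup>2)" by simp
      finally show ?thesis using B r sum4 by (simp add: add_increasing2)
    next
      case False
      have "\<bar>?R\<bar> \<le> 2 * B * ?w\<^sup>2"
      proof (rule C2_taylor_segment[OF f convex_unit_simplex s x])
        show "0 \<le> 2 * B" using B by simp
        fix z i j assume z: "z \<in> closed_segment s x"
        then have "dist (G z) (G s) \<le> 2 * B"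
          using B(2)[of z] B(2)[OF s] segS norm_triangle_ineq4[of "G z" "G s"] by (auto simp: dist_norm)
        then show "\<bar>?H i j z - ?H i j s\<bar> \<le> 2 * B" using HG[where i=i and j=j and z=z and s=s] by linarith
      qed
      also have "\<dots> \<le> 2 * B * (?w ^ 4 / r\<^sup>2)"
      proof -
        have "r \<le> ?w" using False nw by simp
        then have "r\<^sup>2 \<le> ?w\<^sup>2" using r by (intro power_mono) auto
        then have "?w\<^sup>2 * r\<^sup>2 \<le> ?w\<^sup>2 * ?w\<^sup>2" by (intro mult_left_mono) auto
        then have "?w\<^sup>2 \<le> ?w ^ 4 / r\<^sup>2" using r
          by (simp add: pos_le_divide_eq power4_eq_xxxx power2_eq_square mult.assoc)
        then show ?thesis using B by (intro mult_left_mono) auto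
      qed
      also have "\<dots> \<le> 2 * B * (?d ^ 3 * (\<Sum>i\<in>UNIV. (?v i) ^ 4) / r\<^sup>2)"
        using w4 B r by (intro mult_left_mono divide_right_mono) auto
      also have "\<dots> = ?K * (\<Sum>i\<in>UNIV. (?v i) ^ 4)" by simp
      finally show ?thesis using e sum2 by (simp add: add_increasing)
    qed
  qed
qed

section \<open>Mean and variance of the estimator\<close>

text \<open>
  The mixed terms of the squared sum of the centred variables vanish in expectation.
\<close>
lemma (in prob_space) variance_sum_indep:
  fixes Y :: "'i \<Rightarrow> 'a \<Rightarrow> real"
  assumes I: "finite I" and ind: "indep_vars (\<lambda>_. borel) Y I"
    and int: "\<And>i. i \<in> I \<Longrightarrow> integrable M (Y i)" and int2: "\<And>i. i \<in> I \<Longrightarrow> integrable M (\<lambda>x. (Y i x)\<^sup>2)"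
  shows "variance (\<lambda>x. \<Sum>i\<in>I. Y i x) = (\<Sum>i\<in>I. variance (Y i))"
proof -
  define Z where "Z i x = Y i x - expectation (Y i)" for i x
  have iZ: "integrable M (Z i)" if "i \<in> I" for i
    unfolding Z_def using int[OF that] by simp
  have eZ: "expectation (Z i) = 0" if "i \<in> I" for i
    unfolding Z_def using int[OF that] by (simp add: prob_space)
  have iZ2: "integrable M (\<lambda>x. Z i x * Z i x)" if "i \<in> I" for i
  proof -
    have "Z i x * Z i x = (Y i x)\<^sup>2 - 2 * expectation (Y i) * Y i x + (expectation (Y i))\<^sup>2" for x
      by (simp add: Z_def power2_eq_square algebra_simps)
    then show ?thesis using int[OF that] int2[OF that] by simp
  qed
  have indZ: "indep_vars (\<lambda>_. borel) Z I"
    unfolding Z_def using ind by (rule indep_vars_compose2) auto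
  have pair: "integrable M (\<lambda>x. Z i x * Z j x) \<and> expectation (\<lambda>x. Z i x * Z j x) = 0"
    if "i \<in> I" "j \<in> I" "i \<noteq> j" for i j
  proof -
    have sub: "indep_vars (\<lambda>_. borel) Z {i, j}"
      using indZ that by (intro indep_vars_subset[OF indZ]) auto
    have "integrable M (\<lambda>x. \<Prod>k\<in>{i, j}. Z k x)"
      by (rule indep_vars_integrable[OF _ sub]) (use that iZ in auto)
    moreover have "expectation (\<lambda>x. \<Prod>k\<in>{i, j}. Z k x) = (\<Prod>k\<in>{i, j}. expectation (Z k))"
      by (rule indep_vars_lebesgue_integral[OF _ sub]) (use that iZ in auto)
    ultimately show ?thesis using that eZ by simp
  qed
  have intZ: "integrable M (\<lambda>x. Z i x * Z j x)" if "i \<in> I" "j \<in> I" for i j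
    using iZ2 pair that by (cases "i = j") auto
  have "variance (\<lambda>x. \<Sum>i\<in>I. Y i x) = expectation (\<lambda>x. (\<Sum>i\<in>I. Z i x)\<^sup>2)"
    using int by (simp add: Z_def sum_subtractf)
  also have "\<dots> = expectation (\<lambda>x. \<Sum>i\<in>I. \<Sum>j\<in>I. Z i x * Z j x)"
    by (simp add: power2_eq_square sum_product)
  also have "\<dots> = (\<Sum>i\<in>I. \<Sum>j\<in>I. expectation (\<lambda>x. Z i x * Z j x))"
    using intZ by simp
  also have "\<dots> = (\<Sum>i\<in>I. \<Sum>j\<in>I. if j = i then variance (Y i) else 0)"
    using pair by (intro sum.cong refl) (auto simp: Z_def power2_eq_square)
  also have "\<dots> = (\<Sum>i\<in>I. variance (Y i))" using I by (simp add: sum.delta)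
  finally show ?thesis .
qed

definition dirichlet_kernel :: "real \<Rightarrow> real ^ 'd \<Rightarrow> real ^ 'd \<Rightarrow> real" where
  "dirichlet_kernel b s = dirichlet_density (\<chi> i. s $ i / b + 1) ((1 - l1_norm s) / b + 1)"

lemma kernel_measurable [measurable]: "dirichlet_kernel b s \<in> borel_measurable borel"
  unfolding dirichlet_kernel_def by measurable

lemma integral_kernel:
  assumes "s \<in> unit_simplex" "0 < b" "g \<in> borel_measurable borel"
  shows "(\<integral>x. dirichlet_kernel b s x * g x \<partial>lborel) = (\<integral>x. g x \<partial>kernel_measure b s)"
  unfolding dirichlet_kernel_def kernel_measure_def
  using kernel_params_pos[OF assms(1,2)] assms(3) by (intro integral_dirichlet[symmetric])

text \<open>
  All parameters are at least one, so no factor of the density blows up at the boundary.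
\<close>
lemma kernel_bounded:
  fixes s :: "real ^ 'd"
  assumes s: "s \<in> unit_simplex" and b: "0 < b"
  obtains B where "\<And>x. \<bar>dirichlet_kernel b s x\<bar> \<le> B"
proof
  fix x :: "real ^ 'd"
  let ?a = "\<chi> i. s $ i / b + 1"
  let ?c = "Gamma (l1_norm ?a + ((1 - l1_norm s) / b + 1)) / (Gamma ((1 - l1_norm s) / b + 1) * (\<Prod>i\<in>UNIV. Gamma (?a $ i)))"
  note s01 = unit_simplexD[OF s]
  show "\<bar>dirichlet_kernel b s x\<bar> \<le> \<bar>?c\<bar>"
  proof (cases "x \<in> unit_simplex")
    case True
    have "\<bar>(1 - l1_norm x) powr ((1 - l1_norm s) / b)\<bar> \<le> 1"
      using unit_simplexD(3,4)[OF True] s01(4) b by (auto intro!: powr_le1)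
    moreover have "\<bar>\<Prod>i\<in>UNIV. (x $ i) powr (s $ i / b)\<bar> \<le> 1"
      unfolding abs_prod using unit_simplexD(1,2)[OF True] s01(1) b
      by (intro prod_le_1) (auto intro!: powr_le1)
    ultimately have "\<bar>(1 - l1_norm x) powr ((1 - l1_norm s) / b)\<bar> * \<bar>\<Prod>i\<in>UNIV. (x $ i) powr (s $ i / b)\<bar> \<le> 1"
      by (intro mult_le_one) auto
    then have "\<bar>?c\<bar> * (\<bar>(1 - l1_norm x) powr ((1 - l1_norm s) / b)\<bar> * \<bar>\<Prod>i\<in>UNIV. (x $ i) powr (s $ i / b)\<bar>) \<le> \<bar>?c\<bar> * 1"
      by (intro mult_left_mono) auto
    moreover have "dirichlet_kernel b s x = ?c * ((1 - l1_norm x) powr ((1 - l1_norm s) / b) * (\<Prod>i\<in>UNIV. (x $ i) powr (s $ i / b)))"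
      using True by (simp add: dirichlet_kernel_def dirichlet_density_def)
    ultimately show ?thesis by (simp only: abs_mult mult_1_right)
  next
    case False
    then show ?thesis by (simp add: dirichlet_kernel_def dirichlet_density_def)
  qed
qed

text \<open>
  The squared normalising constant of the kernel with bandwidth \<open>b\<close> over the normalising constant of the
  kernel with bandwidth \<open>b / 2\<close>.
\<close>
definition kernel_sq_const :: "real \<Rightarrow> real ^ 'd \<Rightarrow> real" where
  "kernel_sq_const b s =
    (Gamma (1 / b + (real CARD('d) + 1)) / (Gamma ((1 - l1_norm s) / b + 1) * (\<Prod>i\<in>UNIV. Gamma (s $ i / b + 1))))\<^sup>2
    * (Gamma (2 * ((1 - l1_norm s) / b) + 1) * (\<Prod>i\<in>UNIV. Gamma (2 * (s $ i / b) + 1)))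
    / Gamma (2 / b + (real CARD('d) + 1))"

text \<open>
  Squaring doubles the exponents \<open>s $ i / b\<close> and \<open>(1 - l1_norm s) / b\<close>, that is, halves \<open>b\<close>.
\<close>
lemma kernel_square:
  fixes s :: "real ^ 'd"
  assumes s: "s \<in> unit_simplex" and b: "0 < b"
  shows "(dirichlet_kernel b s x)\<^sup>2 = kernel_sq_const b s * dirichlet_kernel (b / 2) s x"
proof (cases "x \<in> unit_simplex")
  case True
  have b2: "0 < b / 2" using b by simp
  have half: "u / (b / 2) = 2 * (u / b)" for u by simp
  have K: "dirichlet_kernel c s x = Gamma (1 / c + (real CARD('d) + 1))
       / (Gamma ((1 - l1_norm s) / c + 1) * (\<Prod>i\<in>UNIV. Gamma (s $ i / c + 1)))
       * ((1 - l1_norm x) powr ((1 - l1_norm s) / c) * (\<Prod>i\<in>UNIV. (x $ i) powr (s $ i / c)))" if "0 < c" for c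
    unfolding dirichlet_kernel_def dirichlet_density_def if_P[OF True] kernel_params_sum[OF s that] by simp
  have "((1 - l1_norm x) powr ((1 - l1_norm s) / b) * (\<Prod>i\<in>UNIV. (x $ i) powr (s $ i / b)))\<^sup>2
      = (1 - l1_norm x) powr (2 * ((1 - l1_norm s) / b)) * (\<Prod>i\<in>UNIV. (x $ i) powr (2 * (s $ i / b)))"
  proof -
    have sq: "(u powr v)\<^sup>2 = u powr (2 * v)" for u v :: real
      by (simp only: power2_eq_square mult_2 powr_add)
    show ?thesis unfolding power_mult_distrib prod_power_distrib sq ..
  qed
  moreover have "Gamma (2 / b + (real CARD('d) + 1)) > 0" using b by (intro Gamma_real_pos) (simp add: add_nonneg_pos)
  moreover have "Gamma (2 * ((1 - l1_norm s) / b) + 1) > 0" "(\<Prod>i\<in>UNIV. Gamma (2 * (s $ i / b) + 1)) > 0"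
    using unit_simplexD(1,4)[OF s] b by (auto intro!: prod_pos Gamma_real_pos add_nonneg_pos)
  ultimately show ?thesis
    unfolding K[OF b] K[OF b2] half kernel_sq_const_def power_mult_distrib
    by (simp del: prod_zero_iff)
next
  case False
  then show ?thesis by (simp add: dirichlet_kernel_def dirichlet_density_def)
qed

text \<open>
  Identical distribution reduces both quantities to one observation, whose law has density \<open>f\<close>.
  Exchanging the roles of \<open>f\<close> and of the kernel turns the integrals into means of \<open>f\<close> under the
  Dirichlet law, and \<open>kernel_square\<close> does the same for the second moment.
\<close>
lemma kde_mean_variance:
  fixes M :: "'a measure" and X :: "nat \<Rightarrow> 'a \<Rightarrow> real ^ 'd" and f :: "real ^ 'd \<Rightarrow> real"
  assumes M: "prob_space M" and f0: "\<And>x. 0 \<le> f x" and iid: "iid_sample M X f"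
    and s: "s \<in> unit_simplex" and b: "0 < b" and n: "1 \<le> n"
  shows "f \<in> borel_measurable borel"
    and "kde_mean M X n b s = (\<integral>x. f x \<partial>kernel_measure b s)"
    and "kde_variance M X n b s = 1 / real n *
      (kernel_sq_const b s * (\<integral>x. f x \<partial>kernel_measure (b / 2) s) - (\<integral>x. f x \<partial>kernel_measure b s)\<^sup>2)"
proof -
  interpret prob_space M by fact
  have ind: "indep_vars (\<lambda>_. borel) X {1..}" and dist: "\<And>k. 1 \<le> k \<Longrightarrow> distributed M lborel (X k) (\<lambda>x. ennreal (f x))"
    using iid by (auto simp: iid_sample_def)
  have "f \<in> borel_measurable lborel"
    using distributed_real_measurable[OF _ dist[of 1]] f0 by simp
  then show [measurable]: "f \<in> borel_measurable borel" by simp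
  have X [measurable]: "X k \<in> borel_measurable M" if "1 \<le> k" for k
    using distributed_measurable[OF dist[OF that]] by simp
  obtain B where B: "\<And>x. \<bar>dirichlet_kernel b s x\<bar> \<le> B" using kernel_bounded[OF s b] by blast
  have B2: "\<bar>(dirichlet_kernel b s x)\<^sup>2\<bar> \<le> B\<^sup>2" for x
    using B[of x] by (simp add: abs_le_square_iff[symmetric])
  define Y where "Y k \<omega> = dirichlet_kernel b s (X k \<omega>)" for k \<omega>
  have intY: "integrable M (Y k)" and intY2: "integrable M (\<lambda>x. (Y k x)\<^sup>2)" if "1 \<le> k" for k
  proof -
    have [measurable]: "X k \<in> borel_measurable M" using X[OF that] .
    show "integrable M (Y k)" unfolding Y_def using B by (intro integrable_const_bound[of _ B]) auto
    show "integrable M (\<lambda>x. (Y k x)\<^sup>2)"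
      unfolding Y_def using B2 by (intro integrable_const_bound[of _ "B\<^sup>2"]) auto
  qed
  have EY: "expectation (Y k) = (\<integral>x. f x \<partial>kernel_measure b s)" if "1 \<le> k" for k
  proof -
    have "expectation (Y k) = (\<integral>x. f x * dirichlet_kernel b s x \<partial>lborel)"
      unfolding Y_def using f0 by (intro distributed_integral[OF dist[OF that], symmetric]) auto
    then show ?thesis using integral_kernel[OF s b, of f] by (simp add: mult.commute)
  qed
  have EY2: "expectation (\<lambda>x. (Y k x)\<^sup>2) = kernel_sq_const b s * (\<integral>x. f x \<partial>kernel_measure (b / 2) s)" if "1 \<le> k" for k
  proof -
    have "expectation (\<lambda>x. (Y k x)\<^sup>2) = (\<integral>x. f x * (dirichlet_kernel b s x)\<^sup>2 \<partial>lborel)"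
      unfolding Y_def using f0 by (intro distributed_integral[OF dist[OF that], symmetric]) auto
    also have "\<dots> = (\<integral>x. kernel_sq_const b s * (dirichlet_kernel (b / 2) s x * f x) \<partial>lborel)"
      unfolding kernel_square[OF s b] by (simp add: mult_ac)
    also have "\<dots> = kernel_sq_const b s * (\<integral>x. dirichlet_kernel (b / 2) s x * f x \<partial>lborel)"
      by simp
    finally show ?thesis using integral_kernel[OF s, of "b / 2" f] b by simp
  qed
  have VY: "variance (Y k) = kernel_sq_const b s * (\<integral>x. f x \<partial>kernel_measure (b / 2) s) - (\<integral>x. f x \<partial>kernel_measure b s)\<^sup>2"
    if "1 \<le> k" for k
    using variance_eq[OF intY intY2] EY EY2 that by simp
  have kde: "dirichlet_kde X n b s = (\<lambda>\<omega>. 1 / real n * (\<Sum>k = 1..n. Y k \<omega>))"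
    by (simp add: dirichlet_kde_def Y_def dirichlet_kernel_def fun_eq_iff)
  have "kde_mean M X n b s = 1 / real n * (\<Sum>k = 1..n. expectation (Y k))"
    unfolding kde_mean_def kde using intY by simp
  also have "\<dots> = (\<integral>x. f x \<partial>kernel_measure b s)" using n by (simp add: EY)
  finally show "kde_mean M X n b s = (\<integral>x. f x \<partial>kernel_measure b s)" .
  have indY: "indep_vars (\<lambda>_. borel) Y {1..n}"
    unfolding Y_def
    by (rule indep_vars_compose2[where Y = "\<lambda>_. dirichlet_kernel b s", OF indep_vars_subset[OF ind]]) auto
  have "kde_variance M X n b s = (1 / real n)\<^sup>2 * variance (\<lambda>\<omega>. \<Sum>k = 1..n. Y k \<omega>)"
  proof -
    have "(c * u - c * v)\<^sup>2 = c\<^sup>2 * (u - v)\<^sup>2" for c u v :: real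
      by (simp add: power2_eq_square algebra_simps)
    then show ?thesis
      unfolding kde_variance_def kde integral_mult_right_zero by (simp only: integral_mult_right_zero)
  qed
  also have "variance (\<lambda>\<omega>. \<Sum>k = 1..n. Y k \<omega>) = (\<Sum>k = 1..n. variance (Y k))"
    using indY intY intY2 by (intro variance_sum_indep) auto
  also have "\<dots> = real n * (kernel_sq_const b s * (\<integral>x. f x \<partial>kernel_measure (b / 2) s) - (\<integral>x. f x \<partial>kernel_measure b s)\<^sup>2)"
    by (simp add: VY)
  finally show "kde_variance M X n b s = 1 / real n *
      (kernel_sq_const b s * (\<integral>x. f x \<partial>kernel_measure (b / 2) s) - (\<integral>x. f x \<partial>kernel_measure b s)\<^sup>2)"
    using n by (simp add: power2_eq_square)
qed

section \<open>The bias\<close>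

lemma C2_on_partials_bounded:
  fixes f :: "real ^ 'd \<Rightarrow> real"
  assumes f: "C2_on unit_simplex f"
  obtains B where "0 \<le> B"
    "\<And>s j. s \<in> unit_simplex \<Longrightarrow> \<bar>partial_within unit_simplex j f s\<bar> \<le> B"
    "\<And>s i j. s \<in> unit_simplex \<Longrightarrow> \<bar>partial_within unit_simplex i (partial_within unit_simplex j f) s\<bar> \<le> B"
proof -
  let ?P = "\<lambda>j. partial_within unit_simplex j f" and ?H = "\<lambda>i j. partial_within unit_simplex i (partial_within unit_simplex j f)"
  let ?g = "\<lambda>s. (\<Sum>j\<in>UNIV. \<bar>?P j s\<bar>) + (\<Sum>i\<in>UNIV. \<Sum>j\<in>UNIV. \<bar>?H i j s\<bar>)"
  have "continuous_on unit_simplex (?P j)" "continuous_on unit_simplex (?H i j)" for i j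
    using f by (auto simp: C2_on_def intro!: differentiable_imp_continuous_on)
  then have "continuous_on unit_simplex ?g" by (intro continuous_intros)
  then obtain B where B: "0 \<le> B" "\<And>x. x \<in> unit_simplex \<Longrightarrow> \<bar>?g x\<bar> \<le> B"
    using simplex_bounded_of_continuous by blast
  have nn: "0 \<le> (\<Sum>j\<in>UNIV. \<bar>?P j s\<bar>)" "0 \<le> (\<Sum>i\<in>UNIV. \<Sum>j\<in>UNIV. \<bar>?H i j s\<bar>)" for s
    by (auto intro!: sum_nonneg)
  have P: "\<bar>?P j s\<bar> \<le> (\<Sum>j\<in>UNIV. \<bar>?P j s\<bar>)" for j s
    by (rule member_le_sum) auto
  have H: "\<bar>?H i j s\<bar> \<le> (\<Sum>i\<in>UNIV. \<Sum>j\<in>UNIV. \<bar>?H i j s\<bar>)" for i j s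
    by (rule order_trans[OF member_le_sum[of j UNIV "\<lambda>j. \<bar>?H i j s\<bar>"] member_le_sum[of i UNIV "\<lambda>i. \<Sum>j\<in>UNIV. \<bar>?H i j s\<bar>"]])
       (auto intro!: sum_nonneg)
  show ?thesis
  proof (rule that[OF B(1)])
    fix s :: "real ^ 'd" and i j assume s: "s \<in> unit_simplex"
    show "\<bar>?P j s\<bar> \<le> B" using P[of j s] nn[of s] B(2)[OF s] by linarith
    show "\<bar>?H i j s\<bar> \<le> B" using H[of i j s] nn[of s] B(2)[OF s] by linarith
  qed
qed

text \<open>
  Integrating the Taylor expansion term by term: the moment expansions turn the polynomial part into
  \<open>b * bias_term f s\<close>, and the remainder is controlled by second moments of order \<open>b\<close>, with a
  coefficient as small as desired, and by fourth moments of order \<open>b\<^sup>2\<close>.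
\<close>
lemma kernel_bias_bound:
  fixes f :: "real ^ 'd \<Rightarrow> real"
  assumes f: "C2_on unit_simplex f" and fm: "f \<in> borel_measurable borel" and e: "0 < e"
  obtains C where "0 \<le> C"
    "\<And>s b. s \<in> unit_simplex \<Longrightarrow> 0 < b \<Longrightarrow> b \<le> 1 \<Longrightarrow>
      \<bar>(\<integral>x. f x \<partial>kernel_measure b s) - f s - b * bias_term f s\<bar> \<le> e * b + C * b\<^sup>2"
proof -
  let ?P = "\<lambda>j. partial_within unit_simplex j f" and ?H = "\<lambda>i j. partial_within unit_simplex i (partial_within unit_simplex j f)"
  define d where "d = real CARD('d)"
  have d: "0 < d" by (simp add: d_def)
  define D where "D = d + 1"
  define c where "c = 1 + 10 * (d + 2)\<^sup>2"
  have c: "0 < c" by (simp add: c_def add_pos_nonneg)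
  obtain B where B: "0 \<le> B" "\<And>s j. s \<in> unit_simplex \<Longrightarrow> \<bar>?P j s\<bar> \<le> B"
    "\<And>s i j. s \<in> unit_simplex \<Longrightarrow> \<bar>?H i j s\<bar> \<le> B"
    using C2_on_partials_bounded[OF f] by blast
  \<comment> \<open>Summing \<open>d\<close> second moments, each at most \<open>c * b\<close>, against this coefficient gives \<open>e * b\<close>.\<close>
  have "0 < e / (d * c)" using e d c by simp
  from C2_taylor_uniform[OF f this] obtain K where K: "0 \<le> K"
    "\<And>s x. s \<in> unit_simplex \<Longrightarrow> x \<in> unit_simplex \<Longrightarrow>
      \<bar>f x - f s - (\<Sum>j\<in>UNIV. (x $ j - s $ j) * ?P j s)
         - 1 / 2 * (\<Sum>j\<in>UNIV. \<Sum>i\<in>UNIV. (x $ j - s $ j) * ((x $ i - s $ i) * ?H i j s))\<bar>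
      \<le> e / (d * c) * (\<Sum>i\<in>UNIV. (x $ i - s $ i)\<^sup>2) + K * (\<Sum>i\<in>UNIV. (x $ i - s $ i) ^ 4)"
    by blast
  have fc: "continuous_on unit_simplex f"
    using f by (auto simp: C2_on_def intro!: differentiable_imp_continuous_on)
  let ?C = "K * (d * (700 * D ^ 4)) + (d * (B * D\<^sup>2) + 1 / 2 * (d * (d * (B * (10 * (D + 1)\<^sup>2)))))"
  show ?thesis
  proof (rule that[of ?C])
    show "0 \<le> ?C" using K(1) B(1) d by (auto simp: D_def intro!: add_nonneg_nonneg mult_nonneg_nonneg)
    fix s :: "real ^ 'd" and b :: real
    assume s: "s \<in> unit_simplex" and b: "0 < b" "b \<le> 1"
    interpret K: prob_space "kernel_measure b s" using s b by (intro prob_space_kernel) auto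
    let ?E = "\<lambda>g. \<integral>x. g x \<partial>kernel_measure b s"
    let ?T = "\<lambda>x. (\<Sum>j\<in>UNIV. (x $ j - s $ j) * ?P j s)
         + 1 / 2 * (\<Sum>i\<in>UNIV. \<Sum>j\<in>UNIV. ((x $ i - s $ i) * (x $ j - s $ j)) * ?H i j s)"
    let ?G = "\<lambda>x. e / (d * c) * (\<Sum>i\<in>UNIV. (x $ i - s $ i)\<^sup>2) + K * (\<Sum>i\<in>UNIV. (x $ i - s $ i) ^ 4)"
    have int: "integrable (kernel_measure b s) g"
      if "g \<in> borel_measurable borel" "continuous_on unit_simplex g" for g :: "real ^ 'd \<Rightarrow> real"
      using integrable_kernel[OF s b(1) that] .
    have int1: "integrable (kernel_measure b s) (\<lambda>x. x $ i - s $ i)" for i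
      by (rule int) (measurable, intro continuous_intros)
    have int2: "integrable (kernel_measure b s) (\<lambda>x. (x $ i - s $ i) * (x $ j - s $ j))" for i j
      by (rule int) (measurable, intro continuous_intros)
    have intp: "integrable (kernel_measure b s) (\<lambda>x. (x $ i - s $ i) ^ m)" for i m
      by (rule int) (measurable, intro continuous_intros)
    have intf: "integrable (kernel_measure b s) f" by (rule int[OF fm fc])
    have intT: "integrable (kernel_measure b s) ?T"
      using int1 int2 by (intro Bochner_Integration.integrable_add integrable_mult_right
          Bochner_Integration.integrable_sum integrable_mult_left) auto
    have intG: "integrable (kernel_measure b s) ?G"
      using intp by (intro Bochner_Integration.integrable_add integrable_mult_right
          Bochner_Integration.integrable_sum) auto
    have R: "\<bar>f x - f s - ?T x\<bar> \<le> ?G x" if "x \<in> unit_simplex" for x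
    proof -
      have "(\<Sum>j\<in>UNIV. \<Sum>i\<in>UNIV. (x $ j - s $ j) * ((x $ i - s $ i) * ?H i j s))
          = (\<Sum>i\<in>UNIV. \<Sum>j\<in>UNIV. ((x $ i - s $ i) * (x $ j - s $ j)) * ?H i j s)"
        by (subst sum.swap) (simp add: mult_ac)
      then show ?thesis using K(2)[OF s that] by (simp only: diff_diff_eq)
    qed
    have ER: "\<bar>?E (\<lambda>x. f x - f s - ?T x)\<bar> \<le> e * b + K * (d * (700 * D ^ 4)) * b\<^sup>2"
    proof -
      have "\<bar>?E (\<lambda>x. f x - f s - ?T x)\<bar> \<le> ?E (\<lambda>x. \<bar>f x - f s - ?T x\<bar>)"
        by (rule integral_abs_bound)
      also have "\<dots> \<le> ?E ?G"
      proof (rule integral_mono_AE)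
        show "AE x in kernel_measure b s. \<bar>f x - f s - ?T x\<bar> \<le> ?G x"
          using AE_kernel[of b s] by eventually_elim (rule R)
      qed (use intf intT intG in auto)
      also have "\<dots> = e / (d * c) * (\<Sum>i\<in>UNIV. ?E (\<lambda>x. (x $ i - s $ i)\<^sup>2)) + K * (\<Sum>i\<in>UNIV. ?E (\<lambda>x. (x $ i - s $ i) ^ 4))"
        using intp by simp
      also have "\<dots> \<le> e / (d * c) * (\<Sum>i\<in>(UNIV :: 'd set). c * b) + K * (\<Sum>i\<in>(UNIV :: 'd set). 700 * D ^ 4 * b\<^sup>2)"
        using e d c K(1) kernel_variance_bound[OF s b] kernel_fourth_moment[OF s b]
        by (intro add_mono mult_left_mono sum_mono) (auto simp: c_def D_def d_def)
      also have "\<dots> = e * b + K * (d * (700 * D ^ 4)) * b\<^sup>2"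
        using d c by (simp add: d_def[symmetric])
      finally show ?thesis .
    qed
    let ?m = "\<lambda>i. ?E (\<lambda>x. x $ i - s $ i)" and ?v = "\<lambda>i j. ?E (\<lambda>x. (x $ i - s $ i) * (x $ j - s $ j))"
    let ?m' = "\<lambda>i. b * (1 - D * s $ i)" and ?v' = "\<lambda>i j. b * (s $ i * ((if i = j then 1 else 0) - s $ j))"
    have ET: "?E ?T = (\<Sum>j\<in>UNIV. ?m j * ?P j s) + 1 / 2 * (\<Sum>i\<in>UNIV. \<Sum>j\<in>UNIV. ?v i j * ?H i j s)"
    proof -
      have "?E ?T = ?E (\<lambda>x. \<Sum>j\<in>UNIV. (x $ j - s $ j) * ?P j s)
         + ?E (\<lambda>x. 1 / 2 * (\<Sum>i\<in>UNIV. \<Sum>j\<in>UNIV. ((x $ i - s $ i) * (x $ j - s $ j)) * ?H i j s))"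
        using int1 int2 by (intro Bochner_Integration.integral_add integrable_mult_right
          Bochner_Integration.integrable_sum integrable_mult_left) auto
      also have "?E (\<lambda>x. \<Sum>j\<in>UNIV. (x $ j - s $ j) * ?P j s) = (\<Sum>j\<in>UNIV. ?m j * ?P j s)"
        using int1 by (subst Bochner_Integration.integral_sum) (auto simp del: Bochner_Integration.integral_diff)
      also have "?E (\<lambda>x. 1 / 2 * (\<Sum>i\<in>UNIV. \<Sum>j\<in>UNIV. ((x $ i - s $ i) * (x $ j - s $ j)) * ?H i j s))
          = 1 / 2 * (\<Sum>i\<in>UNIV. \<Sum>j\<in>UNIV. ?v i j * ?H i j s)"
        using int2 by (simp add: Bochner_Integration.integral_sum)
      finally show ?thesis .
    qed
    have bias: "b * bias_term f s = (\<Sum>j\<in>UNIV. ?m' j * ?P j s) + 1 / 2 * (\<Sum>i\<in>UNIV. \<Sum>j\<in>UNIV. ?v' i j * ?H i j s)"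
      unfolding bias_term_def D_def d_def
      by (simp add: sum_distrib_left distrib_left mult.assoc mult.left_commute[of b])
    have dev: "\<bar>?E ?T - b * bias_term f s\<bar> \<le> (d * (B * D\<^sup>2) + 1 / 2 * (d * (d * (B * (10 * (D + 1)\<^sup>2))))) * b\<^sup>2"
    proof -
      have m: "\<bar>(?m j - ?m' j) * ?P j s\<bar> \<le> D\<^sup>2 * b\<^sup>2 * B" for j
        unfolding abs_mult using kernel_mean[OF s b, of j] B(2)[OF s, of j]
        by (intro mult_mono) (auto simp: D_def d_def)
      have v: "\<bar>(?v i j - ?v' i j) * ?H i j s\<bar> \<le> 10 * (D + 1)\<^sup>2 * b\<^sup>2 * B" for i j
        unfolding abs_mult using kernel_covariance[OF s b, of i j] B(3)[OF s, of i j]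
        by (intro mult_mono) (auto simp: D_def d_def)
      have abs_half: "\<bar>u + 1 / 2 * w\<bar> \<le> \<bar>u\<bar> + 1 / 2 * \<bar>w\<bar>" for u w :: real by linarith
      have eq: "?E ?T - b * bias_term f s = (\<Sum>j\<in>UNIV. (?m j - ?m' j) * ?P j s)
          + 1 / 2 * (\<Sum>i\<in>UNIV. \<Sum>j\<in>UNIV. (?v i j - ?v' i j) * ?H i j s)"
        unfolding ET bias by (simp only: left_diff_distrib sum_subtractf right_diff_distrib)
      have "\<bar>?E ?T - b * bias_term f s\<bar> \<le> \<bar>\<Sum>j\<in>UNIV. (?m j - ?m' j) * ?P j s\<bar>
          + 1 / 2 * \<bar>\<Sum>i\<in>UNIV. \<Sum>j\<in>UNIV. (?v i j - ?v' i j) * ?H i j s\<bar>"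
        unfolding eq by (rule abs_half)
      also have "\<dots> \<le> (\<Sum>j\<in>(UNIV :: 'd set). D\<^sup>2 * b\<^sup>2 * B)
          + 1 / 2 * (\<Sum>i\<in>(UNIV :: 'd set). \<Sum>j\<in>(UNIV :: 'd set). 10 * (D + 1)\<^sup>2 * b\<^sup>2 * B)"
      proof -
        have S: "\<bar>\<Sum>j\<in>UNIV. g j\<bar> \<le> (\<Sum>j\<in>(UNIV :: 'd set). q)" if "\<And>j. \<bar>g j\<bar> \<le> q" for g :: "'d \<Rightarrow> real" and q
          by (rule order_trans, rule sum_abs, rule sum_mono, rule that)
        have "u + 1 / 2 * w \<le> p + 1 / 2 * q" if "u \<le> p" "w \<le> q" for u w p q :: real
          using that by linarith
        from this[OF S[OF m] S[OF S[OF v]]] show ?thesis .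
      qed
      also have "\<dots> = (d * (B * D\<^sup>2) + 1 / 2 * (d * (d * (B * (10 * (D + 1)\<^sup>2))))) * b\<^sup>2"
        by (simp add: d_def[symmetric] algebra_simps)
      finally show ?thesis .
    qed
    have "?E f = ?E (\<lambda>x. f x - f s - ?T x) + f s + ?E ?T"
      using intf intT by (simp add: K.prob_space)
    moreover have "\<bar>F - u - v\<bar> \<le> p + q" if "F = R + u + T" "\<bar>R\<bar> \<le> p" "\<bar>T - v\<bar> \<le> q"
      for F u v R T p q :: real using that by linarith
    ultimately have "\<bar>?E f - f s - b * bias_term f s\<bar> \<le> (e * b + K * (d * (700 * D ^ 4)) * b\<^sup>2)
        + (d * (B * D\<^sup>2) + 1 / 2 * (d * (d * (B * (10 * (D + 1)\<^sup>2))))) * b\<^sup>2"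
      using ER dev by blast
    then show "\<bar>?E f - f s - b * bias_term f s\<bar> \<le> e * b + ?C * b\<^sup>2"
      by (simp only: distrib_right add.assoc)
  qed
qed

text \<open>
  The constants of \<open>kernel_bias_bound\<close> do not depend on \<open>s\<close>, which is the uniformity claimed.
\<close>
lemma kde_bias_uniform:
  fixes M :: "'a measure" and X :: "nat \<Rightarrow> 'a \<Rightarrow> real ^ 'd" and f :: "real ^ 'd \<Rightarrow> real"
  assumes M: "prob_space M" and f0: "\<And>x. 0 \<le> f x" and iid: "iid_sample M X f"
    and f: "C2_on unit_simplex f" and b: "bandwidth b"
  shows "uniform_limit unit_simplex
            (\<lambda>n s. ((kde_mean M X n (b n) s - f s) - b n * bias_term f s) / b n) (\<lambda>_. 0) sequentially"
proof (rule uniform_limitI)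
  fix e :: real assume e: "0 < e"
  have bpos: "\<And>n. 0 < b n" and blim: "b \<longlonglongrightarrow> 0" using b by (auto simp: bandwidth_def)
  have "(0 :: real ^ 'd) \<in> unit_simplex" by (simp add: unit_simplex_altdef)
  then have fm: "f \<in> borel_measurable borel"
    using kde_mean_variance(1)[OF M f0 iid _ zero_less_one order_refl] by blast
  obtain C where C: "0 \<le> C" "\<And>s b. s \<in> unit_simplex \<Longrightarrow> 0 < b \<Longrightarrow> b \<le> 1 \<Longrightarrow>
      \<bar>(\<integral>x. f x \<partial>kernel_measure b s) - f s - b * bias_term f s\<bar> \<le> e / 2 * b + C * b\<^sup>2"
    using kernel_bias_bound[OF f fm half_gt_zero[OF e]] by blast
  have "\<forall>\<^sub>F n in sequentially. b n < min 1 (e / 2 / (C + 1))"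
    using e C(1) by (intro order_tendstoD(2)[OF blim]) auto
  then show "\<forall>\<^sub>F n in sequentially. \<forall>s\<in>unit_simplex.
      dist (((kde_mean M X n (b n) s - f s) - b n * bias_term f s) / b n) 0 < e"
    using eventually_ge_at_top[of 1]
  proof eventually_elim
    fix n :: nat assume bn: "b n < min 1 (e / 2 / (C + 1))" and n: "1 \<le> n"
    show "\<forall>s\<in>unit_simplex. dist (((kde_mean M X n (b n) s - f s) - b n * bias_term f s) / b n) 0 < e"
    proof
      fix s :: "real ^ 'd" assume s: "s \<in> unit_simplex"
      have "\<bar>(kde_mean M X n (b n) s - f s) - b n * bias_term f s\<bar> \<le> e / 2 * b n + C * (b n)\<^sup>2"
        unfolding kde_mean_variance(2)[OF M f0 iid s bpos n] using bn by (intro C(2)[OF s bpos]) simp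
      also have "\<dots> = (e / 2 + C * b n) * b n" by (simp add: power2_eq_square algebra_simps)
      also have "\<dots> < e * b n"
      proof -
        have "C * b n \<le> (C + 1) * b n" using bpos[of n] by (intro mult_right_mono) auto
        also have "(C + 1) * b n < e / 2"
        proof -
          have "b n < e / 2 / (C + 1)" using bn by simp
          then have "b n * (C + 1) < e / 2" using C(1) by (subst (asm) pos_less_divide_eq) auto
          then show ?thesis by (simp only: mult.commute)
        qed
        finally show ?thesis using bpos[of n] by (intro mult_strict_right_mono) linarith+
      qed
      finally show "dist (((kde_mean M X n (b n) s - f s) - b n * bias_term f s) / b n) 0 < e"
        using bpos[of n] by (simp add: abs_divide pos_divide_less_eq)
    qed
  qed
qed

section \<open>Central binomial ratios of real argument\<close>

text \<open>
  For natural \<open>x\<close> this is the central binomial coefficient \<open>2 * x choose x\<close> divided by \<open>4 ^ x\<close>.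
\<close>
definition central_ratio :: "real \<Rightarrow> real" where
  "central_ratio x = Gamma (2 * x + 1) / (2 powr (2 * x) * (Gamma (x + 1))\<^sup>2)"

text \<open>
  Legendre's formula is a statement about complex numbers; on positive reals both sides are real.
\<close>
lemma Gamma_duplication_real:
  fixes x :: real
  assumes "0 \<le> x"
  shows "Gamma (x + 1 / 2) * Gamma (x + 1) = 2 powr (- 2 * x) * sqrt pi * Gamma (2 * x + 1)"
proof -
  have nn: "complex_of_real u \<notin> \<int>\<^sub>\<le>\<^sub>0" if "0 < u" for u
    using that by (auto elim!: nonpos_Ints_cases simp: complex_eq_iff)
  define z0 where "z0 = complex_of_real (x + 1 / 2)"
  have z: "z0 = complex_of_real (x + 1 / 2)" "z0 + 1 / 2 = complex_of_real (x + 1)" "2 * z0 = complex_of_real (2 * x + 1)" "1 - 2 * z0 = complex_of_real (- 2 * x)"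
    by (auto simp: complex_eq_iff z0_def)
  have "Gamma z0 * Gamma (z0 + 1 / 2) = exp ((1 - 2 * z0) * of_real (ln 2)) * of_real (sqrt pi) * Gamma (2 * z0)"
  proof (intro Gamma_legendre_duplication)
    show "z0 \<notin> \<int>\<^sub>\<le>\<^sub>0" unfolding z(1) using assms by (intro nn) simp
    show "z0 + 1 / 2 \<notin> \<int>\<^sub>\<le>\<^sub>0" unfolding z(2) using assms by (intro nn) simp
  qed
  then have "complex_of_real (Gamma (x + 1 / 2) * Gamma (x + 1)) =
      complex_of_real (exp (- 2 * x * ln 2) * sqrt pi * Gamma (2 * x + 1))"
    unfolding z(4) unfolding z(2,3) unfolding z(1) by (simp only: Gamma_complex_of_real of_real_mult[symmetric] exp_of_real)
  then show ?thesis
    by (simp only: of_real_eq_iff powr_def) simp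
qed

text \<open>
  Duplication removes the doubled argument, so that log-convexity of the gamma function can compare
  numerator and denominator.
\<close>
lemma central_ratio_Gamma:
  assumes "0 \<le> x"
  shows "central_ratio x = Gamma (x + 1 / 2) / (sqrt pi * Gamma (x + 1))"
proof -
  have G: "Gamma (x + 1) > 0" using assms by (intro Gamma_real_pos) simp
  have "Gamma (x + 1 / 2) / (sqrt pi * Gamma (x + 1)) = (Gamma (x + 1 / 2) * Gamma (x + 1)) / (sqrt pi * (Gamma (x + 1))\<^sup>2)"
    using G by (simp add: power2_eq_square)
  also have "\<dots> = 2 powr (- 2 * x) * Gamma (2 * x + 1) / (Gamma (x + 1))\<^sup>2"
    unfolding Gamma_duplication_real[OF assms] by simp
  also have "\<dots> = central_ratio x"
    unfolding central_ratio_def by (simp add: powr_minus divide_simps)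
  finally show ?thesis ..
qed

lemma central_ratio_pos: "0 \<le> x \<Longrightarrow> 0 < central_ratio x"
  unfolding central_ratio_def by (intro divide_pos_pos mult_pos_pos zero_less_power Gamma_real_pos) auto

text \<open>
  Up to the factor \<open>pi\<close>, the central ratio is \<open>Beta (x + 1 / 2) (1 / 2)\<close>, which decreases in \<open>x\<close>
  from \<open>Beta (1 / 2) (1 / 2) = pi\<close>. A bound by one lets products of such factors be compared
  without extra constants.
\<close>
lemma central_ratio_le_1:
  assumes "0 \<le> x"
  shows "central_ratio x \<le> 1"
proof -
  have "Beta (x + 1 / 2) (1 / 2) \<le> Beta (1 / 2) (1 / 2 :: real)"
    using assms by (intro Beta_real_mono) auto
  moreover have "x + 1 / 2 + 1 / 2 = x + 1" by simp
  ultimately have "Gamma (x + 1 / 2) * sqrt pi / Gamma (x + 1) \<le> pi"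
    unfolding Beta_def by (simp add: Gamma_one_half_real)
  moreover have "g / (r * h) \<le> 1" if "g * r / h \<le> r * r" "0 < r" "0 < h" for g h r :: real
    using that by (simp add: divide_le_eq)
  ultimately have "Gamma (x + 1 / 2) / (sqrt pi * Gamma (x + 1)) \<le> 1"
    using assms by (simp add: Gamma_real_pos)
  then show ?thesis using central_ratio_Gamma[OF assms] by simp
qed

lemma Gamma_midpoint_le:
  fixes u :: real
  assumes "0 < u"
  shows "(Gamma (u + 1 / 2))\<^sup>2 \<le> Gamma u * Gamma (u + 1)"
proof -
  have G: "Gamma u > 0" "Gamma (u + 1) > 0" "Gamma (u + 1 / 2) > 0"
    using assms by (auto intro!: Gamma_real_pos)
  have "(ln \<circ> Gamma) ((1 - 1 / 2) *\<^sub>R u + (1 / 2) *\<^sub>R (u + 1)) \<le> (1 - 1 / 2) * (ln \<circ> Gamma) u + 1 / 2 * (ln \<circ> Gamma) (u + 1)"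
    using assms by (intro convex_onD[OF log_convex_Gamma_real]) auto
  moreover have "(1 - 1 / 2) *\<^sub>R u + (1 / 2) *\<^sub>R (u + 1) = u + 1 / 2" by (simp add: field_simps)
  ultimately have "2 * ln (Gamma (u + 1 / 2)) \<le> ln (Gamma u) + ln (Gamma (u + 1))" by simp
  then have "ln ((Gamma (u + 1 / 2))\<^sup>2) \<le> ln (Gamma u * Gamma (u + 1))"
    using G by (simp add: ln_mult ln_realpow)
  then show ?thesis using G by (subst (asm) ln_le_cancel_iff) auto
qed

text \<open>
  The central ratio relative to its asymptotic value \<open>1 / sqrt (pi * x)\<close>; it tends to one.
\<close>
definition stirling_ratio :: "real \<Rightarrow> real" where
  "stirling_ratio x = sqrt (pi * x) * central_ratio x"

text \<open>
  Log-convexity at the midpoints of \<open>[x, x + 1]\<close> and \<open>[x + 1 / 2, x + 3 / 2]\<close> gives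
  \<open>x / (x + 1 / 2) \<le> (stirling_ratio x)\<^sup>2 \<le> 1\<close>, which is sharp enough and holds for every
  positive \<open>x\<close>.
\<close>
lemma stirling_ratio_bounds:
  assumes "0 < x"
  shows "stirling_ratio x \<le> 1" "1 - 1 / (2 * x) \<le> stirling_ratio x" "1 / stirling_ratio x \<le> 1 + 1 / (2 * x)"
    "0 < stirling_ratio x"
proof -
  have G: "Gamma x > 0" "Gamma (x + 1) > 0" "Gamma (x + 1 / 2) > 0"
    using assms by (auto intro!: Gamma_real_pos)
  have q: "stirling_ratio x = sqrt x * (Gamma (x + 1 / 2) / Gamma (x + 1))"
    using assms central_ratio_Gamma[of x] by (simp add: stirling_ratio_def real_sqrt_mult)
  show pos: "0 < stirling_ratio x" unfolding q using assms G by simp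
  have G1: "Gamma (x + 1) = x * Gamma x" using assms by (intro Gamma_plus1) (auto elim!: nonpos_Ints_cases)
  have sq: "(stirling_ratio x)\<^sup>2 = x * (Gamma (x + 1 / 2))\<^sup>2 / (Gamma (x + 1))\<^sup>2"
    unfolding q using assms by (simp add: power_mult_distrib power_divide)
  have "x * (Gamma (x + 1 / 2))\<^sup>2 \<le> x * (Gamma x * Gamma (x + 1))"
    using assms Gamma_midpoint_le[of x] by (intro mult_left_mono) auto
  also have "\<dots> = (Gamma (x + 1))\<^sup>2" by (simp add: G1 power2_eq_square)
  finally have "(stirling_ratio x)\<^sup>2 \<le> 1\<^sup>2" unfolding sq using G by (simp add: divide_le_eq)
  then show le1: "stirling_ratio x \<le> 1" by (rule power2_le_imp_le) simp
  have G2: "Gamma (x + 1 / 2 + 1) = (x + 1 / 2) * Gamma (x + 1 / 2)"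
    using assms by (intro Gamma_plus1) (auto elim!: nonpos_Ints_cases)
  have "(Gamma (x + 1))\<^sup>2 \<le> (x + 1 / 2) * (Gamma (x + 1 / 2))\<^sup>2"
    using Gamma_midpoint_le[of "x + 1 / 2"] assms unfolding G2 by (simp add: power2_eq_square mult_ac add.assoc)
  moreover have "x / (x + 1 / 2) \<le> x * p / q" if "0 < q" "q \<le> (x + 1 / 2) * p" for p q
  proof -
    have "x * q \<le> x * ((x + 1 / 2) * p)" using assms that by (intro mult_left_mono) auto
    then show ?thesis using assms that by (simp add: divide_le_eq le_divide_eq mult_ac)
  qed
  ultimately have "x / (x + 1 / 2) \<le> (stirling_ratio x)\<^sup>2"
    unfolding sq using G by simp
  also have "(stirling_ratio x)\<^sup>2 \<le> stirling_ratio x"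
    using pos le1 by (simp add: power2_eq_square mult_left_le)
  finally have lower': "x / (x + 1 / 2) \<le> stirling_ratio x" .
  have "1 - 1 / (2 * x) \<le> x / (x + 1 / 2)" using assms by (simp add: field_simps)
  with lower' show "1 - 1 / (2 * x) \<le> stirling_ratio x" by simp
  have "1 / stirling_ratio x \<le> 1 / (x / (x + 1 / 2))"
    using lower' assms pos by (intro divide_left_mono) auto
  also have "\<dots> = 1 + 1 / (2 * x)" using assms by (simp add: field_simps)
  finally show "1 / stirling_ratio x \<le> 1 + 1 / (2 * x)" .
qed

text \<open>
  Differentiability at \<open>k\<close> bounds the difference quotient near \<open>k\<close>. This controls the error made by
  replacing \<open>s $ i / b\<close> by its limit.
\<close>
lemma central_ratio_lipschitz_at:
  assumes "0 < k"
  obtains L where "0 \<le> L" "\<forall>\<^sub>F x in nhds k. \<bar>central_ratio x - central_ratio k\<bar> \<le> L * \<bar>x - k\<bar>"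
proof -
  have nn: "u \<notin> \<int>\<^sub>\<le>\<^sub>0" if "0 < u" for u :: real
    using that by (auto elim!: nonpos_Ints_cases)
  have "Gamma (k + 1) \<noteq> 0" using Gamma_real_pos[of "k + 1"] assms by linarith
  moreover have "2 * k + 1 \<notin> \<int>\<^sub>\<le>\<^sub>0" "k + 1 \<notin> \<int>\<^sub>\<le>\<^sub>0" using assms by (auto intro!: nn)
  ultimately have "\<exists>D. (central_ratio has_real_derivative D) (at k)"
    unfolding central_ratio_def[abs_def] by (intro exI) (auto intro!: derivative_eq_intros)
  then obtain D where D: "(central_ratio has_real_derivative D) (at k)" ..
  then have "((\<lambda>x. (central_ratio x - central_ratio k) / (x - k)) \<longlongrightarrow> D) (at k)"
    by (simp add: has_field_derivative_iff)
  then have "\<forall>\<^sub>F x in at k. dist ((central_ratio x - central_ratio k) / (x - k)) D < 1"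
    by (rule tendstoD) simp
  then have "\<forall>\<^sub>F x in at k. \<bar>central_ratio x - central_ratio k\<bar> \<le> (\<bar>D\<bar> + 1) * \<bar>x - k\<bar>"
  proof (eventually_elim)
    fix x assume "dist ((central_ratio x - central_ratio k) / (x - k)) D < 1"
    then have "\<bar>(central_ratio x - central_ratio k) / (x - k)\<bar> \<le> \<bar>D\<bar> + 1"
      unfolding dist_real_def by linarith
    then show "\<bar>central_ratio x - central_ratio k\<bar> \<le> (\<bar>D\<bar> + 1) * \<bar>x - k\<bar>"
      by (cases "x = k") (simp_all add: abs_divide pos_divide_le_eq)
  qed
  then have "\<forall>\<^sub>F x in nhds k. x \<noteq> k \<longrightarrow> \<bar>central_ratio x - central_ratio k\<bar> \<le> (\<bar>D\<bar> + 1) * \<bar>x - k\<bar>"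
    by (simp add: eventually_at_filter)
  then have "\<forall>\<^sub>F x in nhds k. \<bar>central_ratio x - central_ratio k\<bar> \<le> (\<bar>D\<bar> + 1) * \<bar>x - k\<bar>"
    by eventually_elim auto
  then show ?thesis by (intro that[of "\<bar>D\<bar> + 1"]) auto
qed

lemma central_ratio_eq_stirling:
  "0 < x \<Longrightarrow> central_ratio x = stirling_ratio x / sqrt (pi * x)"
  by (simp add: stirling_ratio_def)

section \<open>The normalising constant of the squared kernel\<close>

text \<open>
  By convexity of the power, the graph lies below the chord over the unit interval.
\<close>
lemma power_one_plus_le:
  fixes q t :: real
  assumes "0 \<le> q" "0 \<le> t" "t \<le> 1"
  shows "(1 + q * t) ^ m \<le> 1 + ((1 + q) ^ m - 1) * t"
proof (induction m)
  case (Suc m)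
  let ?A = "(1 + q) ^ m - 1"
  have A: "0 \<le> ?A" using assms by (simp add: one_le_power)
  have "(1 + q * t) ^ Suc m \<le> (1 + q * t) * (1 + ?A * t)"
    using Suc assms by (simp add: mult_left_mono)
  also have "\<dots> = 1 + (?A + q) * t + q * ?A * (t * t)" by (simp add: algebra_simps)
  also have "\<dots> \<le> 1 + (?A + q) * t + q * ?A * t"
    using assms A by (intro add_left_mono mult_left_mono) (auto simp: mult_left_le)
  also have "\<dots> = 1 + ((1 + q) ^ Suc m - 1) * t" by (simp add: algebra_simps)
  finally show ?case .
qed simp

text \<open>
  The quotient is a product of factors \<open>2 * (N + k)\<^sup>2 / ((2 * N + k) * N)\<close> with \<open>1 \<le> k \<le> d\<close>, each
  of which lies between \<open>1\<close> and \<open>(1 + k / N)\<^sup>2\<close>.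
\<close>
lemma pochhammer_ratio_bounds:
  fixes N :: real and d :: nat
  assumes N: "1 \<le> N"
  defines "q \<equiv> 2 * real d + (real d)\<^sup>2"
  shows "1 \<le> (pochhammer (N + 1) d)\<^sup>2 * 2 ^ d / (pochhammer (2 * N + 1) d * N ^ d)"
    and "(pochhammer (N + 1) d)\<^sup>2 * 2 ^ d / (pochhammer (2 * N + 1) d * N ^ d) \<le> (1 + q / N) ^ d"
proof -
  let ?g = "\<lambda>i. 2 * (N + 1 + real i)\<^sup>2 / ((2 * N + 1 + real i) * N)"
  have eq: "(pochhammer (N + 1) d)\<^sup>2 * 2 ^ d / (pochhammer (2 * N + 1) d * N ^ d) = (\<Prod>i = 0..<d. ?g i)"
    unfolding pochhammer_prod prod_dividef prod.distrib prod_power_distrib by (simp add: mult.commute)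
  have pos: "0 < (2 * N + 1 + real i) * N" for i using N by simp
  have lo: "1 \<le> ?g i" for i
  proof -
    have "(2 * N + 1 + real i) * N \<le> 2 * (N + 1 + real i)\<^sup>2"
      using N by (simp add: power2_eq_square algebra_simps)
    then show ?thesis using pos[of i] by (simp only: le_divide_eq_1_pos)
  qed
  have hi: "?g i \<le> 1 + q / N" if "i < d" for i
  proof -
    define k where "k = 1 + real i"
    have k: "0 \<le> k" "k \<le> real d" using that by (auto simp: k_def)
    have "?g i \<le> 2 * (N + k)\<^sup>2 / (2 * N * N)"
      using N k by (intro frac_le) (auto simp: k_def algebra_simps)
    also have "\<dots> = 1 + (2 * k + k\<^sup>2 / N) / N"
      using N by (simp add: field_simps power2_eq_square)
    also have "\<dots> \<le> 1 + q / N"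
    proof -
      have "k\<^sup>2 / N \<le> k\<^sup>2 / 1" using N by (intro divide_left_mono) auto
      also have "\<dots> \<le> (real d)\<^sup>2" using k by (simp add: power_mono)
      finally have "2 * k + k\<^sup>2 / N \<le> q" using k by (simp add: q_def)
      then show ?thesis using N by (intro add_left_mono divide_right_mono) auto
    qed
    finally show ?thesis .
  qed
  show "1 \<le> (pochhammer (N + 1) d)\<^sup>2 * 2 ^ d / (pochhammer (2 * N + 1) d * N ^ d)"
    unfolding eq by (intro prod_ge_1 lo)
  have "(\<Prod>i = 0..<d. ?g i) \<le> (\<Prod>i = 0..<d. 1 + q / N)"
    using hi lo by (intro prod_mono) (auto intro: order_trans[OF zero_le_one])
  then show "(pochhammer (N + 1) d)\<^sup>2 * 2 ^ d / (pochhammer (2 * N + 1) d * N ^ d) \<le> (1 + q / N) ^ d"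
    unfolding eq by simp
qed

text \<open>
  What remains of the gamma values at the total parameters \<open>N + d + 1\<close> and \<open>2 * N + d + 1\<close> after the
  leading term is removed; it is \<open>1 + O(1 / N)\<close>.
\<close>
definition dim_factor :: "nat \<Rightarrow> real \<Rightarrow> real" where
  "dim_factor d N = (pochhammer (N + 1) d)\<^sup>2 * 2 ^ d / (pochhammer (2 * N + 1) d * N ^ d) / stirling_ratio N"

lemma dim_factor_bounds:
  assumes N: "1 \<le> N" and d: "1 \<le> d"
  shows "1 \<le> dim_factor d N" "dim_factor d N \<le> 1 + (1 + 2 * real d + (real d)\<^sup>2) ^ Suc d / N"
proof -
  let ?q = "2 * real d + (real d)\<^sup>2"
  let ?g = "(pochhammer (N + 1) d)\<^sup>2 * 2 ^ d / (pochhammer (2 * N + 1) d * N ^ d)"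
  have r: "0 < stirling_ratio N" "stirling_ratio N \<le> 1" "1 / stirling_ratio N \<le> 1 + 1 / (2 * N)"
    using stirling_ratio_bounds[of N] N by auto
  have eq: "dim_factor d N = ?g * (1 / stirling_ratio N)" by (simp add: dim_factor_def)
  have r1: "1 \<le> 1 / stirling_ratio N" using r by simp
  note g = pochhammer_ratio_bounds[OF N, of d]
  show "1 \<le> dim_factor d N"
    unfolding eq using mult_mono[OF g(1) r1] g(1) by simp
  have "1 / stirling_ratio N \<le> 1 + ?q / N"
  proof -
    have "1 / (2 * N) \<le> ?q / N"
    proof -
      have "1 / 2 \<le> ?q" using d zero_le_power2[of "real d"] by linarith
      then have "1 / 2 / N \<le> ?q / N" using N by (intro divide_right_mono) auto
      then show ?thesis by simp
    qed
    then show ?thesis using r by linarith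
  qed
  then have "dim_factor d N \<le> (1 + ?q / N) ^ d * (1 + ?q / N)"
    unfolding eq using g(1,2) r(1) r1 N by (intro mult_mono) auto
  also have "\<dots> = (1 + ?q * (1 / N)) ^ Suc d" by simp
  also have "\<dots> \<le> 1 + ((1 + ?q) ^ Suc d - 1) * (1 / N)"
    using N by (intro power_one_plus_le) auto
  also have "\<dots> \<le> 1 + (1 + ?q) ^ Suc d * (1 / N)"
    using N by (intro add_left_mono mult_right_mono) auto
  finally show "dim_factor d N \<le> 1 + (1 + 2 * real d + (real d)\<^sup>2) ^ Suc d / N"
    by (simp add: add.assoc)
qed

text \<open>
  The powers of two hidden in the central ratios multiply to \<open>4 powr N\<close>, since \<open>(1 - l1_norm s) / b\<close> and
  the \<open>s $ i / b\<close> add up to \<open>N = 1 / b\<close>; they cancel against the one from the total parameter.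
\<close>
lemma kernel_sq_const_central_ratio:
  fixes s :: "real ^ 'd"
  assumes s: "s \<in> unit_simplex" and b: "0 < b"
  shows "kernel_sq_const b s = dim_factor CARD('d) (1 / b) * (1 / b / 2) ^ CARD('d) * sqrt (pi * (1 / b))
    * (central_ratio ((1 - l1_norm s) / b) * (\<Prod>i\<in>UNIV. central_ratio (s $ i / b)))"
proof -
  define N where "N = 1 / b"
  let ?d = "CARD('d)"
  let ?y = "(1 - l1_norm s) / b" and ?x = "\<lambda>i. s $ i / b"
  have N: "0 < N" using b by (simp add: N_def)
  have x: "0 \<le> ?y" "0 \<le> ?x i" for i
    using unit_simplexD[OF s] b by (auto intro!: divide_nonneg_pos)
  have sum: "?y + (\<Sum>i\<in>UNIV. ?x i) = N"
    by (simp add: N_def l1_norm_simplex[OF s] sum_divide_distrib[symmetric] add_divide_distrib[symmetric])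
  have G1: "Gamma (u + 1) \<noteq> 0" if "0 \<le> u" for u :: real
  proof -
    have "0 < u + 1" using that by simp
    then show ?thesis using Gamma_real_pos by (metis less_irrefl)
  qed
  have dbl: "Gamma (2 * u + 1) = central_ratio u * 2 powr (2 * u) * (Gamma (u + 1))\<^sup>2" if "0 \<le> u" for u
  proof -
    have "Gamma (u + 1) \<noteq> 0" using that by (rule G1)
    then show ?thesis by (simp add: central_ratio_def)
  qed
  have poch: "Gamma (u + (real ?d + 1)) = pochhammer (u + 1) ?d * Gamma (u + 1)" if "0 < u" for u :: real
  proof -
    have "u + 1 \<notin> \<int>\<^sub>\<le>\<^sub>0" using that by (auto elim!: nonpos_Ints_cases)
    moreover have "Gamma (u + 1) \<noteq> 0" using that by (intro G1) simp
    ultimately show ?thesis using pochhammer_Gamma[of "u + 1" ?d] by (simp add: field_simps add_ac)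
  qed
  have G: "Gamma (N + 1) \<noteq> 0" "Gamma (?y + 1) * (\<Prod>i\<in>UNIV. Gamma (?x i + 1)) \<noteq> 0"
  proof -
    show "Gamma (N + 1) \<noteq> 0" using N by (intro G1) simp
    have "Gamma (?x i + 1) \<noteq> 0" for i using x(2) by (rule G1)
    then show "Gamma (?y + 1) * (\<Prod>i\<in>UNIV. Gamma (?x i + 1)) \<noteq> 0" using G1[OF x(1)] by simp
  qed
  have P: "pochhammer (2 * N + 1) ?d > 0" "central_ratio N > 0" "N ^ ?d > 0"
    using N by (auto intro!: pochhammer_pos central_ratio_pos)
  have pw: "2 powr (2 * ?y) * (\<Prod>i\<in>UNIV. 2 powr (2 * ?x i)) = (2::real) powr (2 * N)"
  proof -
    have "(\<Prod>i\<in>UNIV. (2::real) powr (2 * ?x i)) = 2 powr (\<Sum>i\<in>UNIV. 2 * ?x i)"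
      by (simp add: powr_sum)
    then show ?thesis unfolding sum[symmetric] by (simp add: powr_add[symmetric] sum_distrib_left distrib_left)
  qed
  have "Gamma (2 * ?y + 1) * (\<Prod>i\<in>UNIV. Gamma (2 * ?x i + 1))
      = (2 powr (2 * ?y) * (\<Prod>i\<in>UNIV. 2 powr (2 * ?x i))) * (central_ratio ?y * (\<Prod>i\<in>UNIV. central_ratio (?x i)))
        * (Gamma (?y + 1) * (\<Prod>i\<in>UNIV. Gamma (?x i + 1)))\<^sup>2"
    unfolding dbl[OF x(1)] dbl[OF x(2)] prod.distrib prod_power_distrib power_mult_distrib by (simp only: mult_ac)
  then have num: "Gamma (2 * ?y + 1) * (\<Prod>i\<in>UNIV. Gamma (2 * ?x i + 1))
      = 2 powr (2 * N) * (central_ratio ?y * (\<Prod>i\<in>UNIV. central_ratio (?x i)))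
        * (Gamma (?y + 1) * (\<Prod>i\<in>UNIV. Gamma (?x i + 1)))\<^sup>2"
    unfolding pw .
  have N2: "2 / b = 2 * N" by (simp add: N_def)
  have "kernel_sq_const b s = (pochhammer (N + 1) ?d * Gamma (N + 1) / (Gamma (?y + 1) * (\<Prod>i\<in>UNIV. Gamma (?x i + 1))))\<^sup>2
      * (2 powr (2 * N) * (central_ratio ?y * (\<Prod>i\<in>UNIV. central_ratio (?x i)))
        * (Gamma (?y + 1) * (\<Prod>i\<in>UNIV. Gamma (?x i + 1)))\<^sup>2)
      / (pochhammer (2 * N + 1) ?d * (central_ratio N * 2 powr (2 * N) * (Gamma (N + 1))\<^sup>2))"
    unfolding kernel_sq_const_def num N2 using N
    by (simp only: N_def[symmetric] poch dbl mult_pos_pos zero_less_numeral less_imp_le)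
  also have "\<dots> = (pochhammer (N + 1) ?d)\<^sup>2 / (pochhammer (2 * N + 1) ?d * central_ratio N)
      * (central_ratio ?y * (\<Prod>i\<in>UNIV. central_ratio (?x i)))"
  proof -
    have "(p * g / h)\<^sup>2 * (w * c * h\<^sup>2) / (p2 * (cN * w * g\<^sup>2)) = p\<^sup>2 / (p2 * cN) * c"
      if "g \<noteq> 0" "h \<noteq> 0" "w \<noteq> 0" for p g h w c p2 cN :: real
      using that by (simp add: power_mult_distrib power_divide)
    from this[OF G(1,2), of "2 powr (2 * N)"] show ?thesis by simp
  qed
  also have "(pochhammer (N + 1) ?d)\<^sup>2 / (pochhammer (2 * N + 1) ?d * central_ratio N)
      = dim_factor ?d N * (N / 2) ^ ?d * sqrt (pi * N)"
    unfolding dim_factor_def central_ratio_eq_stirling[OF N]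
    using P N by (simp add: power_divide)
  finally show ?thesis by (simp only: N_def)
qed

text \<open>
  Every factor outside \<open>J\<close> is written as a Stirling ratio over its leading term. The leading terms
  combine to \<open>psi J s\<close> and to the power of \<open>b\<close> in the variance; what is left is close to one, apart
  from the factors indexed by \<open>J\<close>.
\<close>
lemma kernel_sq_const_normalised:
  fixes s :: "real ^ 'd" and J :: "'d set"
  assumes s: "s \<in> int_simplex" and b: "0 < b"
  shows "b powr ((real CARD('d) + real (card J)) / 2) * kernel_sq_const b s =
    psi J s * (1 / 2) ^ card J * (dim_factor CARD('d) (1 / b) *
      (stirling_ratio ((1 - l1_norm s) / b) * (\<Prod>i\<in>- J. stirling_ratio (s $ i / b)) * (\<Prod>i\<in>J. central_ratio (s $ i / b))))"
proof -
  let ?d = "CARD('d)" and ?j = "card J" and ?m = "card (- J)"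
  let ?y = "(1 - l1_norm s) / b" and ?x = "\<lambda>i. s $ i / b"
  note sD = int_simplexD[OF s]
  have card: "?d = ?m + ?j" "?d - ?j = ?m"
    using card_mono[of UNIV J] by (auto simp: Compl_eq_Diff_UNIV card_Diff_subset)
  \<comment> \<open>In terms of these square roots the identity between real powers becomes one between natural powers.\<close>
  define a where "a = sqrt (1 / b)"
  define p where "p = sqrt pi"
  define q where "q = sqrt (1 - l1_norm s)"
  define t where "t = sqrt (\<Prod>i\<in>- J. s $ i)"
  have pos: "0 < a" "0 < p" "0 < q" "0 < t"
    using b sD by (auto simp: a_def p_def q_def t_def intro!: prod_pos)
  have a2: "1 / b = a\<^sup>2" using b by (simp add: a_def)
  have bp: "b powr ((real ?d + real ?j) / 2) = 1 / a ^ (?d + ?j)"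
  proof -
    have "b powr ((real ?d + real ?j) / 2) = (b powr (1 / 2)) powr real (?d + ?j)"
      by (simp add: powr_powr)
    also have "\<dots> = sqrt b ^ (?d + ?j)"
      using b by (simp add: powr_half_sqrt powr_realpow del: of_nat_add)
    also have "sqrt b = 1 / a" by (simp add: a_def real_sqrt_divide)
    finally show ?thesis by (simp add: power_one_over)
  qed
  have psi: "psi J s = 1 / (2 ^ ?m * p ^ ?m * q * t)"
  proof -
    have Q: "0 < (4 * pi) ^ ?m * (1 - l1_norm s) * (\<Prod>i\<in>- J. s $ i)"
      using sD by (auto intro!: mult_pos_pos prod_pos)
    have "psi J s = 1 / sqrt ((4 * pi) ^ ?m * (1 - l1_norm s) * (\<Prod>i\<in>- J. s $ i))"
      unfolding psi_def card(2) using Q by (simp add: powr_minus_divide powr_half_sqrt)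
    also have "\<dots> = 1 / (2 ^ ?m * p ^ ?m * q * t)"
      by (simp add: real_sqrt_mult real_sqrt_power p_def q_def t_def power_mult_distrib)
    finally show ?thesis .
  qed
  have c0: "central_ratio ?y = stirling_ratio ?y / (p * a * q)"
  proof -
    have "0 < ?y" using sD b by simp
    moreover have "sqrt (pi * ?y) = p * a * q"
      by (simp add: p_def a_def q_def real_sqrt_mult real_sqrt_divide)
    ultimately show ?thesis by (simp add: central_ratio_eq_stirling)
  qed
  have cJ: "(\<Prod>i\<in>- J. central_ratio (?x i)) = (\<Prod>i\<in>- J. stirling_ratio (?x i)) / (p ^ ?m * a ^ ?m * t)"
  proof -
    have "central_ratio (?x i) = stirling_ratio (?x i) / (p * a * sqrt (s $ i))" for i
    proof -
      have "sqrt (pi * ?x i) = p * a * sqrt (s $ i)"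
        by (simp add: p_def a_def real_sqrt_mult real_sqrt_divide)
      then show ?thesis using sD(2)[of i] b by (simp add: central_ratio_eq_stirling)
    qed
    moreover have "(\<Prod>i\<in>A. sqrt (s $ i)) = sqrt (\<Prod>i\<in>A. s $ i)" for A
      by (induction A rule: infinite_finite_induct) (auto simp: real_sqrt_mult)
    ultimately show ?thesis by (simp add: prod_dividef prod.distrib t_def power_mult_distrib)
  qed
  have split: "(\<Prod>i\<in>UNIV. central_ratio (?x i)) = (\<Prod>i\<in>- J. central_ratio (?x i)) * (\<Prod>i\<in>J. central_ratio (?x i))"
    by (subst prod.union_disjoint[symmetric]) auto
  have sq: "sqrt (pi * (1 / b)) = p * a" by (simp add: p_def a_def real_sqrt_mult real_sqrt_divide)
  have ident: "1 / a ^ (m + j + j) * (D * (a\<^sup>2 / 2) ^ (m + j) * (p * a) * (r0 / (p * a * q) * (r / (p ^ m * a ^ m * t) * c)))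
      = 1 / (2 ^ m * p ^ m * q * t) * (1 / 2) ^ j * (D * (r0 * r * c))" for m j :: nat and D r0 r c
  proof -
    have "(a\<^sup>2) ^ (m + j) = a ^ (m + j + j) * a ^ m"
      unfolding power_mult[symmetric] power_add[symmetric] by (rule arg_cong[where f = "power a"]) simp
    then show ?thesis using pos by (simp add: power_divide power_add field_simps)
  qed
  show ?thesis
    unfolding kernel_sq_const_central_ratio[OF sD(1) b] split c0 cJ bp psi sq
    unfolding a2 unfolding card(1) by (rule ident)
qed

text \<open>
  The error of a product is at most the sum of the errors of its factors, because all factors but
  \<open>dim_factor\<close> lie between zero and one. A factor outside \<open>J\<close> has error at most \<open>1 / x\<close>.
\<close>
lemma kernel_sq_const_approx:
  fixes s :: "real ^ 'd" and J :: "'d set" and k :: "'d \<Rightarrow> real"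
  assumes s: "s \<in> int_simplex" and b: "0 < b" "b \<le> 1" and k: "\<And>i. i \<in> J \<Longrightarrow> 0 \<le> k i"
  defines "C \<equiv> (1 + 2 * real CARD('d) + (real CARD('d))\<^sup>2) ^ Suc CARD('d)"
    and "T \<equiv> b powr ((real CARD('d) + real (card J)) / 2) * kernel_sq_const b s"
  shows "0 \<le> T" "T \<le> psi J s * (1 + C)"
    and "\<bar>T - psi J s * (1 / 2) ^ card J * (\<Prod>i\<in>J. central_ratio (k i))\<bar> \<le>
      psi J s * (C * b + b / (1 - l1_norm s) + (\<Sum>i\<in>- J. b / s $ i)
        + (\<Sum>i\<in>J. \<bar>central_ratio (s $ i / b) - central_ratio (k i)\<bar>))"
proof -
  note sD = int_simplexD[OF s]
  let ?y = "(1 - l1_norm s) / b" and ?x = "\<lambda>i. s $ i / b"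
  let ?D = "dim_factor CARD('d) (1 / b)"
  let ?z = "stirling_ratio ?y" and ?r = "\<Prod>i\<in>- J. stirling_ratio (?x i)"
  let ?c = "\<Prod>i\<in>J. central_ratio (?x i)" and ?k = "\<Prod>i\<in>J. central_ratio (k i)"
  let ?e = "b / (1 - l1_norm s) + (\<Sum>i\<in>- J. b / s $ i) + (\<Sum>i\<in>J. \<bar>central_ratio (?x i) - central_ratio (k i)\<bar>)"
  have C: "0 \<le> C" by (simp add: C_def)
  have psi: "0 \<le> psi J s" by (simp add: psi_def)
  have half: "0 \<le> (1 / 2 :: real) ^ card J" "(1 / 2 :: real) ^ card J \<le> 1" by (auto intro: power_le_one)
  have D: "1 \<le> ?D" "?D \<le> 1 + C * b"
    using dim_factor_bounds[of "1 / b" "CARD('d)"] b by (auto simp: C_def Suc_le_eq)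
  have st: "0 < stirling_ratio u" "stirling_ratio u \<le> 1" "\<bar>stirling_ratio u - 1\<bar> \<le> 1 / u" if "0 < u" for u
  proof -
    show "0 < stirling_ratio u" "stirling_ratio u \<le> 1" using stirling_ratio_bounds[OF that] by auto
    have "1 / (2 * u) \<le> 1 / u" using that by (simp add: field_simps)
    then show "\<bar>stirling_ratio u - 1\<bar> \<le> 1 / u" using stirling_ratio_bounds[OF that] by linarith
  qed
  have x: "0 < ?y" "0 < ?x i" for i using sD b by auto
  have c01: "0 \<le> central_ratio u" "central_ratio u \<le> 1" if "0 \<le> u" for u
    using central_ratio_pos[OF that] central_ratio_le_1[OF that] by auto
  have r0: "0 \<le> ?z" "?z \<le> 1" "\<bar>?z - 1\<bar> \<le> b / (1 - l1_norm s)"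
    using st[OF x(1)] by auto
  have r: "0 \<le> ?r" "?r \<le> 1" using st x by (auto intro!: prod_nonneg prod_le_1 simp: less_imp_le)
  have r1: "\<bar>?r - 1\<bar> \<le> (\<Sum>i\<in>- J. b / s $ i)"
  proof -
    have "norm ((\<Prod>i\<in>- J. stirling_ratio (?x i)) - (\<Prod>i\<in>- J. 1)) \<le> (\<Sum>i\<in>- J. norm (stirling_ratio (?x i) - 1))"
      using st x by (intro norm_prod_diff) (auto simp: abs_of_pos)
    also have "\<dots> \<le> (\<Sum>i\<in>- J. 1 / ?x i)" unfolding real_norm_def using x by (intro sum_mono st(3))
    finally show ?thesis by simp
  qed
  have c: "0 \<le> ?c" "?c \<le> 1" using c01 x by (auto intro!: prod_nonneg prod_le_1 simp: less_imp_le)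
  have c1: "\<bar>?c - ?k\<bar> \<le> (\<Sum>i\<in>J. \<bar>central_ratio (?x i) - central_ratio (k i)\<bar>)"
  proof -
    have "norm (?c - ?k) \<le> (\<Sum>i\<in>J. norm (central_ratio (?x i) - central_ratio (k i)))"
      using c01 x k by (intro norm_prod_diff) (auto simp: abs_le_iff less_imp_le intro: order_trans[OF _ zero_le_one] dest: k)
    then show ?thesis by simp
  qed
  have Teq: "T = psi J s * (1 / 2) ^ card J * (?D * (?z * ?r * ?c))"
    unfolding T_def using kernel_sq_const_normalised[OF s b(1), of J] .
  have rr: "0 \<le> ?z * ?r" "?z * ?r \<le> 1" using r0 r by (auto intro: mult_le_one)
  then have rrc: "0 \<le> ?z * ?r * ?c" "?z * ?r * ?c \<le> 1" using c by (auto intro: mult_le_one)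
  have "0 \<le> ?D" using D by linarith
  from mult_nonneg_nonneg[OF mult_nonneg_nonneg[OF psi half(1)] mult_nonneg_nonneg[OF this rrc(1)]]
  show "0 \<le> T" unfolding Teq .
  have "T \<le> psi J s * 1 * ((1 + C) * 1)"
    unfolding Teq
  proof (intro mult_mono)
    show "?D \<le> 1 + C" using D(2) b C mult_left_mono[of b 1 C] by linarith
  qed (use psi half rrc C D in auto)
  then show "T \<le> psi J s * (1 + C)" by simp
  have "\<bar>?D * (?z * ?r * ?c) - ?k\<bar> \<le> C * b + ?e"
  proof -
    have id: "D * (u * v * w) - z = (D - 1) * (u * v * w) + ((u - 1) * (v * w) + ((v - 1) * w + (w - z)))"
      for D u v w z :: real by (simp add: algebra_simps)
    have "\<bar>(?D - 1) * (?z * ?r * ?c)\<bar> \<le> (C * b) * 1"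
      unfolding abs_mult using D rrc by (intro mult_mono) auto
    moreover have "\<bar>(?z - 1) * (?r * ?c)\<bar> \<le> b / (1 - l1_norm s) * 1"
      unfolding abs_mult[of "?z - 1"] using r0(3) r c by (intro mult_mono) (auto simp: mult_le_one abs_mult)
    moreover have "\<bar>(?r - 1) * ?c\<bar> \<le> (\<Sum>i\<in>- J. b / s $ i) * 1"
      unfolding abs_mult[of "?r - 1"] using r1 c by (intro mult_mono) auto
    moreover have "\<bar>p1 + (p2 + (p3 + p4))\<bar> \<le> q1 + (q2 + q3 + q4)"
      if "\<bar>p1\<bar> \<le> q1 * 1" "\<bar>p2\<bar> \<le> q2 * 1" "\<bar>p3\<bar> \<le> q3 * 1" "\<bar>p4\<bar> \<le> q4" for p1 p2 p3 p4 q1 q2 q3 q4 :: real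
      using that by linarith
    ultimately show ?thesis unfolding id using c1 by blast
  qed
  then have "psi J s * (1 / 2) ^ card J * \<bar>?D * (?z * ?r * ?c) - ?k\<bar> \<le> psi J s * 1 * (C * b + ?e)"
    using psi half by (intro mult_mono) auto
  then show "\<bar>T - psi J s * (1 / 2) ^ card J * ?k\<bar> \<le>
      psi J s * (C * b + b / (1 - l1_norm s) + (\<Sum>i\<in>- J. b / s $ i)
        + (\<Sum>i\<in>J. \<bar>central_ratio (?x i) - central_ratio (k i)\<bar>))"
    unfolding Teq right_diff_distrib[symmetric] abs_mult
    using psi half by (simp add: add.assoc)
qed

section \<open>The variance\<close>

lemma psi_nonneg: "0 \<le> psi J s"
  by (simp add: psi_def)

lemma powr_half_bandwidth:
  fixes b :: real
  assumes "0 < b" "b \<le> 1"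
  shows "b powr (1 / 2) = sqrt b" "b \<le> sqrt b"
proof -
  show "b powr (1 / 2) = sqrt b" using assms by (simp add: powr_half_sqrt)
  have "b * b \<le> b * 1" using assms by (intro mult_left_mono) auto
  then show "b \<le> sqrt b" using assms by (intro real_le_rsqrt) (simp add: power2_eq_square)
qed

lemma bandwidth_eventually_unit:
  assumes "bandwidth b"
  shows "\<forall>\<^sub>F n in sequentially. 0 < b n \<and> b n \<le> 1 \<and> 1 \<le> n"
proof -
  have "b \<longlonglongrightarrow> 0" and pos: "\<And>n. 0 < b n" using assms by (auto simp: bandwidth_def)
  then have "\<forall>\<^sub>F n in sequentially. b n < 1" by (intro order_tendstoD) auto
  then show ?thesis using eventually_ge_at_top[of 1] by eventually_elim (use pos in \<open>auto simp: less_imp_le\<close>)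
qed

text \<open>
  The Lipschitz property bounds the deviation by first absolute moments, and those are of order
  \<open>sqrt b\<close> because the second moments are of order \<open>b\<close>.
\<close>
lemma kernel_mean_lipschitz:
  fixes f :: "real ^ 'd \<Rightarrow> real"
  assumes L: "L-lipschitz_on unit_simplex f" and fm: "f \<in> borel_measurable borel"
    and s: "s \<in> unit_simplex" and b: "0 < b" "b \<le> 1"
  shows "\<bar>(\<integral>x. f x \<partial>kernel_measure b s) - f s\<bar>
    \<le> L * (real CARD('d) * (1 + 10 * (real CARD('d) + 2)\<^sup>2)) * sqrt b"
proof -
  define c where "c = 1 + 10 * (real CARD('d) + 2)\<^sup>2"
  have c: "1 \<le> c" by (simp add: c_def)
  interpret K: prob_space "kernel_measure b s" using s b by (intro prob_space_kernel) auto
  have L0: "0 \<le> L" using L by (rule lipschitz_on_nonneg)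
  have fc: "continuous_on unit_simplex f" using L by (rule lipschitz_on_continuous_on)
  have intf: "integrable (kernel_measure b s) f" by (rule integrable_kernel[OF s b(1) fm fc])
  have inta: "integrable (kernel_measure b s) (\<lambda>x. \<bar>x $ i - s $ i\<bar>)" for i
    by (rule integrable_kernel[OF s b(1)]) (measurable, intro continuous_intros)
  have int2: "integrable (kernel_measure b s) (\<lambda>x. (x $ i - s $ i)\<^sup>2)" for i
    by (rule integrable_kernel[OF s b(1)]) (measurable, intro continuous_intros)
  have absmom: "(\<integral>x. \<bar>x $ i - s $ i\<bar> \<partial>kernel_measure b s) \<le> c * sqrt b" for i
  proof -
    \<comment> \<open>Arithmetic-geometric mean with weight \<open>sqrt b\<close>, in place of the Cauchy-Schwarz inequality.\<close>
    have am: "\<bar>y\<bar> \<le> (y\<^sup>2 / sqrt b + sqrt b) / 2" for y :: real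
    proof -
      have "\<bar>y\<bar> \<le> (y\<^sup>2 / r + r) / 2" if "0 < r" for r :: real
      proof -
        have "0 \<le> (\<bar>y\<bar> - r)\<^sup>2" by simp
        then have "2 * \<bar>y\<bar> * r \<le> y\<^sup>2 + r\<^sup>2" by (simp add: power2_diff)
        then have "2 * \<bar>y\<bar> \<le> (y\<^sup>2 + r\<^sup>2) / r" using that by (simp add: pos_le_divide_eq)
        then show ?thesis using that by (simp add: add_divide_distrib power2_eq_square)
      qed
      then show ?thesis using b by simp
    qed
    have "(\<integral>x. \<bar>x $ i - s $ i\<bar> \<partial>kernel_measure b s)
        \<le> (\<integral>x. ((x $ i - s $ i)\<^sup>2 / sqrt b + sqrt b) / 2 \<partial>kernel_measure b s)"
      using inta int2 am by (intro integral_mono) auto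
    also have "\<dots> = ((\<integral>x. (x $ i - s $ i)\<^sup>2 \<partial>kernel_measure b s) / sqrt b + sqrt b) / 2"
      using int2 by (simp add: K.prob_space)
    also have "\<dots> \<le> (c * b / sqrt b + sqrt b) / 2"
      using kernel_variance_bound[OF s b, of i] b by (auto simp: c_def intro!: divide_right_mono)
    also have "c * b / sqrt b = c * sqrt b"
      using b real_div_sqrt[of b] by (simp only: times_divide_eq_right[symmetric] less_imp_le)
    also have "(c * sqrt b + sqrt b) / 2 = (c + 1) / 2 * sqrt b" by (simp add: algebra_simps)
    also have "\<dots> \<le> c * sqrt b" using c b by (intro mult_right_mono) auto
    finally show ?thesis .
  qed
  have "(\<integral>x. f x \<partial>kernel_measure b s) - f s = (\<integral>x. f x - f s \<partial>kernel_measure b s)"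
    using intf by (simp add: K.prob_space)
  also have "\<bar>\<dots>\<bar> \<le> (\<integral>x. \<bar>f x - f s\<bar> \<partial>kernel_measure b s)" by (rule integral_abs_bound)
  also have "\<dots> \<le> (\<integral>x. L * (\<Sum>i\<in>UNIV. \<bar>x $ i - s $ i\<bar>) \<partial>kernel_measure b s)"
  proof (rule integral_mono_AE)
    show "AE x in kernel_measure b s. \<bar>f x - f s\<bar> \<le> L * (\<Sum>i\<in>UNIV. \<bar>x $ i - s $ i\<bar>)"
      using AE_kernel[of b s]
    proof eventually_elim
      fix x :: "real ^ 'd" assume x: "x \<in> unit_simplex"
      have "\<bar>f x - f s\<bar> \<le> L * norm (x - s)"
        using lipschitz_onD[OF L x s] by (simp add: dist_norm)
      also have "\<dots> \<le> L * (\<Sum>i\<in>UNIV. \<bar>(x - s) $ i\<bar>)"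
        using L0 norm_le_l1_cart[of "x - s"] by (intro mult_left_mono) auto
      finally show "\<bar>f x - f s\<bar> \<le> L * (\<Sum>i\<in>UNIV. \<bar>x $ i - s $ i\<bar>)" by simp
    qed
  qed (use intf inta in auto)
  also have "\<dots> = L * (\<Sum>i\<in>UNIV. \<integral>x. \<bar>x $ i - s $ i\<bar> \<partial>kernel_measure b s)"
    using inta by simp
  also have "\<dots> \<le> L * (\<Sum>i\<in>(UNIV :: 'd set). c * sqrt b)"
    using L0 absmom by (intro mult_left_mono sum_mono)
  also have "\<dots> = L * (real CARD('d) * c) * sqrt b" by simp
  finally show ?thesis unfolding c_def .
qed

lemma kernel_mean_bounded:
  fixes f :: "real ^ 'd \<Rightarrow> real"
  assumes B: "\<And>x. x \<in> unit_simplex \<Longrightarrow> \<bar>f x\<bar> \<le> B" and f: "integrable (kernel_measure b s) f"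
    and s: "s \<in> unit_simplex" and b: "0 < b"
  shows "\<bar>\<integral>x. f x \<partial>kernel_measure b s\<bar> \<le> B"
proof -
  interpret K: prob_space "kernel_measure b s" using s b by (intro prob_space_kernel) auto
  have "\<bar>\<integral>x. f x \<partial>kernel_measure b s\<bar> \<le> (\<integral>x. \<bar>f x\<bar> \<partial>kernel_measure b s)" by (rule integral_abs_bound)
  also have "\<dots> \<le> (\<integral>x. B \<partial>kernel_measure b s)"
  proof (rule integral_mono_AE)
    show "AE x in kernel_measure b s. \<bar>f x\<bar> \<le> B" using AE_kernel[of b s] by eventually_elim (rule B)
  qed (use f in auto)
  finally show ?thesis by (simp add: K.prob_space)
qed

text \<open>
  One constant serves all sets \<open>J\<close>, points, bandwidths and sample sizes. The three sources of error
  are the distance of the mean of \<open>f\<close> from \<open>f s\<close>, the approximation of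
  the squared-kernel constant, and the squared mean. The last one is bounded and is therefore of order
  \<open>sqrt b\<close> relative to the leading power of \<open>b\<close>, whose exponent is at most \<open>- 1 / 2\<close>.
\<close>
lemma kde_variance_expansion:
  fixes M :: "'a measure" and X :: "nat \<Rightarrow> 'a \<Rightarrow> real ^ 'd" and f :: "real ^ 'd \<Rightarrow> real"
  assumes M: "prob_space M" and f0: "\<And>x. 0 \<le> f x" and iid: "iid_sample M X f"
    and L: "L-lipschitz_on unit_simplex f"
  obtains K where "0 \<le> K"
    "\<And>n b s J k. 1 \<le> n \<Longrightarrow> 0 < b \<Longrightarrow> b \<le> 1 \<Longrightarrow> s \<in> int_simplex \<Longrightarrow> (\<And>i. i \<in> J \<Longrightarrow> 0 \<le> k i) \<Longrightarrow>
      \<exists>R. kde_variance M X n b s = 1 / real n * b powr (- (real CARD('d) + real (card J)) / 2)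
            * (psi J s * f s * ((1 / 2) ^ card J * (\<Prod>i\<in>J. central_ratio (k i))) + R)
        \<and> \<bar>R\<bar> \<le> K * (1 + psi J s) * (sqrt b + b / (1 - l1_norm s) + (\<Sum>i\<in>- J. b / s $ i)
            + (\<Sum>i\<in>J. \<bar>central_ratio (s $ i / b) - central_ratio (k i)\<bar>))"
proof -
  let ?d = "real CARD('d)"
  define L' where "L' = L * (?d * (1 + 10 * (?d + 2)\<^sup>2))"
  define C where "C = (1 + 2 * ?d + ?d\<^sup>2) ^ Suc CARD('d)"
  obtain B where B: "0 \<le> B" "\<And>x. x \<in> unit_simplex \<Longrightarrow> \<bar>f x\<bar> \<le> B"
    using simplex_bounded_of_continuous[OF lipschitz_on_continuous_on[OF L]] by blast
  have nn: "0 \<le> L'" "0 \<le> C" using lipschitz_on_nonneg[OF L] by (auto simp: L'_def C_def)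
  have CD: "1 \<le> ?d" by (simp add: Suc_le_eq)
  define K where "K = (1 + C) * L' + B * (C + 1) + B\<^sup>2"
  show ?thesis
  proof (rule that[of K])
    show "0 \<le> K" using nn B by (simp add: K_def)
    fix n :: nat and b :: real and s :: "real ^ 'd" and J :: "'d set" and k :: "'d \<Rightarrow> real"
    assume n: "1 \<le> n" and b: "0 < b" "b \<le> 1" and s: "s \<in> int_simplex" and k: "\<And>i. i \<in> J \<Longrightarrow> 0 \<le> k i"
    note sD = int_simplexD[OF s]
    note kde = kde_mean_variance[OF M f0 iid sD(1) b(1) n]
    have fc: "continuous_on unit_simplex f" using L by (rule lipschitz_on_continuous_on)
    let ?p = "(?d + real (card J)) / 2"
    let ?F1 = "\<integral>x. f x \<partial>kernel_measure b s" and ?F2 = "\<integral>x. f x \<partial>kernel_measure (b / 2) s"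
    let ?T = "b powr ?p * kernel_sq_const b s"
    let ?c = "(1 / 2) ^ card J * (\<Prod>i\<in>J. central_ratio (k i))"
    let ?e = "b / (1 - l1_norm s) + (\<Sum>i\<in>- J. b / s $ i)
            + (\<Sum>i\<in>J. \<bar>central_ratio (s $ i / b) - central_ratio (k i)\<bar>)"
    define R where "R = ?T * ?F2 - b powr ?p * ?F1\<^sup>2 - psi J s * f s * ?c"
    have psi: "0 \<le> psi J s" by (simp add: psi_def)
    have e: "0 \<le> ?e" using b sD(2,3) by (auto intro!: add_nonneg_nonneg sum_nonneg simp: less_imp_le)
    have sb: "0 \<le> sqrt b" "b \<le> sqrt b" using b powr_half_bandwidth(2)[OF b] by auto
    note T = kernel_sq_const_approx[where J = J and k = k, OF s b k, folded C_def]
    have F2: "\<bar>?F2 - f s\<bar> \<le> L' * sqrt b"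
    proof -
      have "\<bar>?F2 - f s\<bar> \<le> L' * sqrt (b / 2)"
        unfolding L'_def using b by (intro kernel_mean_lipschitz[OF L kde(1) sD(1)]) auto
      also have "\<dots> \<le> L' * sqrt b" using nn b by (intro mult_left_mono) auto
      finally show ?thesis .
    qed
    have F1: "?F1\<^sup>2 \<le> B\<^sup>2"
      using kernel_mean_bounded[OF B(2) integrable_kernel[OF sD(1) b(1) kde(1) fc] sD(1) b(1)]
      by (simp add: abs_le_square_iff[symmetric] B(1))
    have bp: "b powr ?p \<le> sqrt b"
      using powr_mono'[of "1 / 2" ?p b] b CD by (simp add: powr_half_sqrt)
    have t1: "\<bar>?T * (?F2 - f s)\<bar> \<le> (psi J s * (1 + C)) * (L' * sqrt b)"
      unfolding abs_mult[of ?T] using T(1,2) F2 by (intro mult_mono) auto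
    have t2: "\<bar>(?T - psi J s * (1 / 2) ^ card J * (\<Prod>i\<in>J. central_ratio (k i))) * f s\<bar>
        \<le> (psi J s * (C * sqrt b + ?e)) * B"
    proof -
      have "psi J s * (C * b + ?e) \<le> psi J s * (C * sqrt b + ?e)"
        using psi sb nn by (intro mult_left_mono add_right_mono) auto
      then have "\<bar>?T - psi J s * (1 / 2) ^ card J * (\<Prod>i\<in>J. central_ratio (k i))\<bar> \<le> psi J s * (C * sqrt b + ?e)"
        using T(3) by (simp add: add.assoc)
      then show ?thesis unfolding abs_mult[of _ "f s"] using B(2)[OF sD(1)] psi sb e nn by (intro mult_mono) auto
    qed
    have t3: "\<bar>b powr ?p * ?F1\<^sup>2\<bar> \<le> sqrt b * B\<^sup>2"
      unfolding abs_mult using bp F1 sb by (intro mult_mono) auto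
    have Req: "R = ?T * (?F2 - f s) + (?T - psi J s * (1 / 2) ^ card J * (\<Prod>i\<in>J. central_ratio (k i))) * f s
        - b powr ?p * ?F1\<^sup>2"
      by (simp add: R_def algebra_simps)
    have "\<bar>R\<bar> \<le> (psi J s * (1 + C)) * (L' * sqrt b) + (psi J s * (C * sqrt b + ?e)) * B + sqrt b * B\<^sup>2"
    proof -
      have "\<bar>u + v - w\<bar> \<le> p + q + r" if "\<bar>u\<bar> \<le> p" "\<bar>v\<bar> \<le> q" "\<bar>w\<bar> \<le> r" for u v w p q r :: real
        using that by linarith
      from this[OF t1 t2 t3] show ?thesis unfolding Req .
    qed
    also have "\<dots> \<le> K * (1 + psi J s) * (sqrt b + ?e)"
    proof -
      have gen: "(p * (1 + C)) * (L' * r) + (p * (C * r + w)) * B + r * B\<^sup>2 \<le> K * (1 + p) * (r + w)"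
        if "0 \<le> p" "0 \<le> r" "0 \<le> w" for p r w
      proof -
        have id: "K * (1 + p) * (r + w) - ((p * (1 + C)) * (L' * r) + (p * (C * r + w)) * B + r * B\<^sup>2)
          = (1 + C) * L' * (r + w + p * w) + B * (C + 1) * (r + w) + B * (C * (p * w) + p * r)
            + B\<^sup>2 * (w + p * r + p * w)"
          unfolding K_def by (simp add: algebra_simps)
        have "0 \<le> (1 + C) * L' * (r + w + p * w) + B * (C + 1) * (r + w) + B * (C * (p * w) + p * r)
            + B\<^sup>2 * (w + p * r + p * w)"
          using that nn B(1) by (intro add_nonneg_nonneg mult_nonneg_nonneg) auto
        then show ?thesis using id by linarith
      qed
      show ?thesis by (rule gen[OF psi sb(1) e])
    qed
    finally have bound: "\<bar>R\<bar> \<le> K * (1 + psi J s) * (sqrt b + b / (1 - l1_norm s) + (\<Sum>i\<in>- J. b / s $ i)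
            + (\<Sum>i\<in>J. \<bar>central_ratio (s $ i / b) - central_ratio (k i)\<bar>))"
      by (simp only: add.assoc)
    have bb: "b powr (- (?d + real (card J)) / 2) * b powr ?p = 1"
    proof -
      have "- x / 2 + x / 2 = 0" for x :: real by simp
      from this[of "?d + real (card J)"] show ?thesis using b by (simp only: powr_add[symmetric]) simp
    qed
    have "kde_variance M X n b s = 1 / real n * b powr (- (?d + real (card J)) / 2)
            * (psi J s * f s * ?c + R)"
    proof -
      have "psi J s * f s * ?c + R = b powr ?p * (kernel_sq_const b s * ?F2 - ?F1\<^sup>2)"
        by (simp add: R_def algebra_simps)
      then have "1 / real n * b powr (- (?d + real (card J)) / 2) * (psi J s * f s * ?c + R)
          = 1 / real n * (b powr (- (?d + real (card J)) / 2) * b powr ?p) * (kernel_sq_const b s * ?F2 - ?F1\<^sup>2)"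
        by (simp only: mult.assoc)
      then show ?thesis unfolding kde(3) bb by (simp only: mult_1_right)
    qed
    with bound show "\<exists>R. kde_variance M X n b s = 1 / real n * b powr (- (?d + real (card J)) / 2)
            * (psi J s * f s * ?c + R)
        \<and> \<bar>R\<bar> \<le> K * (1 + psi J s) * (sqrt b + b / (1 - l1_norm s) + (\<Sum>i\<in>- J. b / s $ i)
            + (\<Sum>i\<in>J. \<bar>central_ratio (s $ i / b) - central_ratio (k i)\<bar>))" by blast
  qed
qed

lemma half_power_central_ratio:
  fixes k :: "'i \<Rightarrow> real"
  shows "(1 / 2) ^ card J * (\<Prod>i\<in>J. central_ratio (k i))
    = (\<Prod>i\<in>J. Gamma (2 * k i + 1) / (2 powr (2 * k i + 1) * (Gamma (k i + 1))\<^sup>2))"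
proof -
  have "Gamma (2 * k i + 1) / (2 powr (2 * k i + 1) * (Gamma (k i + 1))\<^sup>2) = 1 / 2 * central_ratio (k i)" for i
    by (simp add: central_ratio_def powr_add)
  then show ?thesis by (simp only: prod.distrib prod_constant)
qed

text \<open>
  Setting the coordinates in \<open>J\<close> to zero enlarges the slack \<open>1 - l1_norm s\<close> by their sum. When that sum
  is at most the slack, the slack at most doubles, so bounds in terms of \<open>s\<close> pass to bounds in terms
  of \<open>zero_on J s\<close>.
\<close>
lemma psi_zero_on_bound:
  fixes s :: "real ^ 'd" and J :: "'d set"
  assumes s: "s \<in> int_simplex" and J: "(\<Sum>i\<in>J. s $ i) \<le> 1 - l1_norm s"
  shows "1 - l1_norm (zero_on J s) \<le> 2 * (1 - l1_norm s)" "0 < 1 - l1_norm (zero_on J s)"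
    "psi J s \<le> 2 * psi J (zero_on J s)"
proof -
  have arith: "1 - z \<le> 2 * (1 - l)" if "l = z + S" "S \<le> 1 - l" for l z S :: real
  proof -
    have "1 - z = (1 - l) + S" using that(1) by simp
    also have "\<dots> \<le> (1 - l) + (1 - l)" using that(2) by (rule add_left_mono)
    finally show ?thesis by simp
  qed
  note sD = int_simplexD[OF s]
  define S where "S = (\<Sum>i\<in>J. s $ i)"
  have l: "l1_norm s = l1_norm (zero_on J s) + S"
  proof -
    have "l1_norm s = (\<Sum>i\<in>- J. s $ i) + (\<Sum>i\<in>J. s $ i)"
      unfolding l1_norm_simplex[OF sD(1)] by (subst sum.union_disjoint[symmetric]) auto
    also have "(\<Sum>i\<in>- J. s $ i) = l1_norm (zero_on J s)"
      unfolding l1_norm_def zero_on_def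
      by (rule sum.mono_neutral_cong_left) (use sD(2) in \<open>auto simp: less_imp_le\<close>)
    finally show ?thesis by (simp only: S_def)
  qed
  have J': "S \<le> 1 - l1_norm s" using J by (simp only: S_def)
  have Jn: "0 \<le> S" unfolding S_def using sD(2) by (intro sum_nonneg) (auto intro: less_imp_le)
  show le: "1 - l1_norm (zero_on J s) \<le> 2 * (1 - l1_norm s)" by (rule arith[OF l J'])
  show pos: "0 < 1 - l1_norm (zero_on J s)" using l sD(3) Jn by linarith
  define A where "A = (4 * pi) ^ (CARD('d) - card J) * (\<Prod>i\<in>- J. s $ i)"
  have A: "0 < A" using sD(2) by (auto simp: A_def intro!: mult_pos_pos prod_pos)
  have z: "(\<Prod>i\<in>- J. zero_on J s $ i) = (\<Prod>i\<in>- J. s $ i)"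
    by (rule prod.cong) (auto simp: zero_on_def)
  let ?u = "1 - l1_norm (zero_on J s)"
  have "psi J s = (A * (1 - l1_norm s)) powr (- 1 / 2)" by (simp add: psi_def A_def mult_ac)
  also have "\<dots> \<le> (A * ?u / 4) powr (- 1 / 2)"
  proof (rule powr_mono2')
    have "?u / 4 \<le> ?u / 2" using pos by simp
    also have "?u / 2 \<le> 1 - l1_norm s" using le by simp
    finally have "?u / 4 \<le> 1 - l1_norm s" .
    then have "A * (?u / 4) \<le> A * (1 - l1_norm s)" using A by (intro mult_left_mono) auto
    then show "A * ?u / 4 \<le> A * (1 - l1_norm s)" by simp
  qed (use A pos in auto)
  also have "\<dots> = 2 * (A * ?u) powr (- 1 / 2)"
    using A pos by (simp add: powr_minus powr_half_sqrt real_sqrt_divide divide_simps)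
  also have "(A * ?u) powr (- 1 / 2) = psi J (zero_on J s)" by (simp add: psi_def A_def z mult_ac)
  finally show "psi J s \<le> 2 * psi J (zero_on J s)" .
qed

text \<open>
  With \<open>J\<close> empty, every error term is \<open>sqrt b\<close> times a function of \<open>s\<close>, as \<open>b \<le> sqrt b\<close>.
\<close>
lemma kde_variance_interior:
  fixes M :: "'a measure" and X :: "nat \<Rightarrow> 'a \<Rightarrow> real ^ 'd" and f :: "real ^ 'd \<Rightarrow> real"
  assumes M: "prob_space M" and f0: "\<And>x. 0 \<le> f x" and iid: "iid_sample M X f"
    and L: "L-lipschitz_on unit_simplex f"
  shows "(\<exists>C :: real ^ 'd \<Rightarrow> real. \<forall>b s.
          bandwidth b \<and> (\<forall>n. s n \<in> int_simplex) \<and>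
          (\<forall>i. filterlim (\<lambda>n. s n $ i / b n) at_top sequentially) \<and>
          filterlim (\<lambda>n. (1 - l1_norm (s n)) / b n) at_top sequentially \<longrightarrow>
          (\<forall>\<^sub>F n in sequentially. \<exists>R.
             \<bar>R\<bar> \<le> C (s n) * b n powr (1 / 2) \<and>
             kde_variance M X n (b n) (s n) =
               1 / real n * b n powr (- real CARD('d) / 2) * (psi {} (s n) * f (s n) + R)))"
proof -
  obtain K where K: "0 \<le> K"
    "\<And>n b s J k. 1 \<le> n \<Longrightarrow> 0 < b \<Longrightarrow> b \<le> 1 \<Longrightarrow> s \<in> int_simplex \<Longrightarrow> (\<And>i. i \<in> J \<Longrightarrow> 0 \<le> k i) \<Longrightarrow>
      \<exists>R. kde_variance M X n b s = 1 / real n * b powr (- (real CARD('d) + real (card J)) / 2)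
            * (psi J s * f s * ((1 / 2) ^ card J * (\<Prod>i\<in>J. central_ratio (k i))) + R)
        \<and> \<bar>R\<bar> \<le> K * (1 + psi J s) * (sqrt b + b / (1 - l1_norm s) + (\<Sum>i\<in>- J. b / s $ i)
            + (\<Sum>i\<in>J. \<bar>central_ratio (s $ i / b) - central_ratio (k i)\<bar>))"
    by (rule kde_variance_expansion[OF M f0 iid L]) blast
  show ?thesis
  proof (rule exI[of _ "\<lambda>s. K * (1 + psi {} s) * (1 + 1 / (1 - l1_norm s) + (\<Sum>i\<in>UNIV. 1 / s $ i))"], intro allI impI)
    fix b and s :: "nat \<Rightarrow> real ^ 'd"
    assume A: "bandwidth b \<and> (\<forall>n. s n \<in> int_simplex) \<and>
        (\<forall>i. filterlim (\<lambda>n. s n $ i / b n) at_top sequentially) \<and>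
        filterlim (\<lambda>n. (1 - l1_norm (s n)) / b n) at_top sequentially"
    then have "bandwidth b" by blast
    from bandwidth_eventually_unit[OF this]
    show "\<forall>\<^sub>F n in sequentially. \<exists>R.
           \<bar>R\<bar> \<le> K * (1 + psi {} (s n)) * (1 + 1 / (1 - l1_norm (s n)) + (\<Sum>i\<in>UNIV. 1 / s n $ i)) * b n powr (1 / 2) \<and>
           kde_variance M X n (b n) (s n) =
             1 / real n * b n powr (- real CARD('d) / 2) * (psi {} (s n) * f (s n) + R)"
    proof eventually_elim
      case (elim n)
      then have b: "0 < b n" "b n \<le> 1" and n: "1 \<le> n" by auto
      have s: "s n \<in> int_simplex" using A by blast
      obtain R where R: "kde_variance M X n (b n) (s n) =
             1 / real n * b n powr (- real CARD('d) / 2) * (psi {} (s n) * f (s n) + R)"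
        "\<bar>R\<bar> \<le> K * (1 + psi {} (s n)) * (sqrt (b n) + b n / (1 - l1_norm (s n)) + (\<Sum>i\<in>UNIV. b n / s n $ i))"
        using K(2)[OF n b s, of "{}"] by auto
      have w: "b n * w \<le> sqrt (b n) * w" if "0 \<le> w" for w
        using powr_half_bandwidth(2)[OF b] that by (rule mult_right_mono)
      have "b n / (1 - l1_norm (s n)) \<le> sqrt (b n) * (1 / (1 - l1_norm (s n)))"
        using w[of "1 / (1 - l1_norm (s n))"] int_simplexD(3)[OF s] by simp
      moreover have "(\<Sum>i\<in>UNIV. b n / s n $ i) \<le> (\<Sum>i\<in>UNIV. sqrt (b n) * (1 / s n $ i))"
        using w[of "1 / s n $ i" for i] int_simplexD(2)[OF s] by (intro sum_mono) (simp add: less_imp_le)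
      ultimately have "sqrt (b n) + b n / (1 - l1_norm (s n)) + (\<Sum>i\<in>UNIV. b n / s n $ i)
          \<le> (1 + 1 / (1 - l1_norm (s n)) + (\<Sum>i\<in>UNIV. 1 / s n $ i)) * sqrt (b n)"
        unfolding sum_distrib_left[symmetric] by (simp add: algebra_simps)
      then have "K * (1 + psi {} (s n)) * (sqrt (b n) + b n / (1 - l1_norm (s n)) + (\<Sum>i\<in>UNIV. b n / s n $ i))
          \<le> K * (1 + psi {} (s n)) * ((1 + 1 / (1 - l1_norm (s n)) + (\<Sum>i\<in>UNIV. 1 / s n $ i)) * sqrt (b n))"
        using K(1) psi_nonneg[of "{}" "s n"] by (intro mult_left_mono) auto
      with R(2) have "\<bar>R\<bar> \<le> K * (1 + psi {} (s n)) * (1 + 1 / (1 - l1_norm (s n)) + (\<Sum>i\<in>UNIV. 1 / s n $ i)) * b n powr (1 / 2)"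
        unfolding powr_half_bandwidth(1)[OF b] by (simp only: mult.assoc)
      with R(1) show ?case by blast
    qed
  qed
qed

text \<open>
  The two bounds on the remainder treat the coordinates in \<open>J\<close> differently. If the constant may depend
  on all of \<open>s\<close>, the error of those factors need only be bounded by one, because
  \<open>s $ i / b\<close> stays below \<open>\<kappa> $ i + 1\<close> and so \<open>sqrt b\<close> is at least
  \<open>sqrt (s $ i / (\<kappa> $ i + 1))\<close>. If it may depend only on the coordinates outside \<open>J\<close>, that error is
  measured by the distance of \<open>s $ i / b\<close> from \<open>\<kappa> $ i\<close>.
\<close>
lemma kde_variance_near_faces:
  fixes M :: "'a measure" and X :: "nat \<Rightarrow> 'a \<Rightarrow> real ^ 'd" and f :: "real ^ 'd \<Rightarrow> real"
  assumes M: "prob_space M" and f0: "\<And>x. 0 \<le> f x" and iid: "iid_sample M X f"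
    and L: "L-lipschitz_on unit_simplex f"
    and J: "J \<noteq> {}"
  shows "\<exists>(C :: real ^ 'd \<Rightarrow> real ^ 'd \<Rightarrow> real) (C' :: real ^ 'd \<Rightarrow> real ^ 'd \<Rightarrow> real). \<forall>\<kappa> b s.
            (\<forall>i. 0 < \<kappa> $ i) \<and> bandwidth b \<and> (\<forall>n. s n \<in> int_simplex) \<and>
            (\<forall>i\<in>J. (\<lambda>n. s n $ i / b n) \<longlonglongrightarrow> \<kappa> $ i) \<and>
            (\<forall>i\<in>- J. filterlim (\<lambda>n. s n $ i / b n) at_top sequentially) \<and>
            filterlim (\<lambda>n. (1 - l1_norm (s n)) / b n) at_top sequentially \<longrightarrow>
            (\<forall>\<^sub>F n in sequentially. \<exists>R.
               \<bar>R\<bar> \<le> C \<kappa> (s n) * b n powr (1 / 2) \<and>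
               \<bar>R\<bar> \<le> C' \<kappa> (zero_on J (s n)) *
                       (b n powr (1 / 2) + (\<Sum>i\<in>J. \<bar>s n $ i / b n - \<kappa> $ i\<bar>)) \<and>
               kde_variance M X n (b n) (s n) =
                 1 / real n * b n powr (- (real CARD('d) + real (card J)) / 2) *
                   (psi J (s n) * f (s n) *
                     (\<Prod>i\<in>J. Gamma (2 * \<kappa> $ i + 1)
                              / (2 powr (2 * \<kappa> $ i + 1) * (Gamma (\<kappa> $ i + 1))\<^sup>2)) + R))"
proof -
  obtain K where K: "0 \<le> K"
    "\<And>n b s J k. 1 \<le> n \<Longrightarrow> 0 < b \<Longrightarrow> b \<le> 1 \<Longrightarrow> s \<in> int_simplex \<Longrightarrow> (\<And>i. i \<in> J \<Longrightarrow> 0 \<le> k i) \<Longrightarrow>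
      \<exists>R. kde_variance M X n b s = 1 / real n * b powr (- (real CARD('d) + real (card J)) / 2)
            * (psi J s * f s * ((1 / 2) ^ card J * (\<Prod>i\<in>J. central_ratio (k i))) + R)
        \<and> \<bar>R\<bar> \<le> K * (1 + psi J s) * (sqrt b + b / (1 - l1_norm s) + (\<Sum>i\<in>- J. b / s $ i)
            + (\<Sum>i\<in>J. \<bar>central_ratio (s $ i / b) - central_ratio (k i)\<bar>))"
    by (rule kde_variance_expansion[OF M f0 iid L]) blast
  \<comment> \<open>Chosen before bandwidth and points, since the second constant may involve only \<open>\<kappa>\<close> and the coordinates outside \<open>J\<close>.\<close>
  have "\<exists>l. \<forall>t>0. 0 \<le> l t \<and> (\<forall>\<^sub>F x in nhds t. \<bar>central_ratio x - central_ratio t\<bar> \<le> l t * \<bar>x - t\<bar>)"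
    by (rule choice) (metis central_ratio_lipschitz_at)
  then obtain l where l: "\<And>t. 0 < t \<Longrightarrow> 0 \<le> l t"
    "\<And>t. 0 < t \<Longrightarrow> \<forall>\<^sub>F x in nhds t. \<bar>central_ratio x - central_ratio t\<bar> \<le> l t * \<bar>x - t\<bar>"
    by blast
  obtain i0 where i0: "i0 \<in> J" using J by blast
  let ?C = "\<lambda>(\<kappa> :: real ^ 'd) (s :: real ^ 'd). K * (1 + psi J s) *
      (1 + 1 / (1 - l1_norm s) + (\<Sum>i\<in>- J. 1 / s $ i) + real (card J) * sqrt ((\<kappa> $ i0 + 1) / s $ i0))"
  let ?C' = "\<lambda>(\<kappa> :: real ^ 'd) (s :: real ^ 'd). K * (1 + 2 * psi J s) *
      (1 + 2 / (1 - l1_norm s) + (\<Sum>i\<in>- J. 1 / s $ i) + (\<Sum>i\<in>J. l (\<kappa> $ i)))"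
  show ?thesis
  proof (rule exI[of _ ?C], rule exI[of _ ?C'], intro allI impI)
    fix \<kappa> :: "real ^ 'd" and b and s :: "nat \<Rightarrow> real ^ 'd"
    assume A: "(\<forall>i. 0 < \<kappa> $ i) \<and> bandwidth b \<and> (\<forall>n. s n \<in> int_simplex) \<and>
        (\<forall>i\<in>J. (\<lambda>n. s n $ i / b n) \<longlonglongrightarrow> \<kappa> $ i) \<and>
        (\<forall>i\<in>- J. filterlim (\<lambda>n. s n $ i / b n) at_top sequentially) \<and>
        filterlim (\<lambda>n. (1 - l1_norm (s n)) / b n) at_top sequentially"
    then have k: "\<And>i. 0 < \<kappa> $ i" and bw: "bandwidth b" and lims: "\<And>i. i \<in> J \<Longrightarrow> (\<lambda>n. s n $ i / b n) \<longlonglongrightarrow> \<kappa> $ i"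
      and slack: "filterlim (\<lambda>n. (1 - l1_norm (s n)) / b n) at_top sequentially" by auto
    have ev1: "\<forall>\<^sub>F n in sequentially. \<forall>i\<in>J. s n $ i / b n < \<kappa> $ i + 1"
      by (rule eventually_ball_finite) (use lims in \<open>auto intro!: order_tendstoD(2)\<close>)
    have ev2: "\<forall>\<^sub>F n in sequentially. \<forall>i\<in>J. \<bar>central_ratio (s n $ i / b n) - central_ratio (\<kappa> $ i)\<bar>
        \<le> l (\<kappa> $ i) * \<bar>s n $ i / b n - \<kappa> $ i\<bar>"
      by (rule eventually_ball_finite) (use lims l(2)[OF k] in \<open>auto simp: filterlim_iff\<close>)
    \<comment> \<open>The coordinates in \<open>J\<close> eventually have a sum that is at most the slack, in units of the bandwidth.\<close>
    have ev3: "\<forall>\<^sub>F n in sequentially. (\<Sum>i\<in>J. \<kappa> $ i + 1) \<le> (1 - l1_norm (s n)) / b n"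
      using slack by (simp add: filterlim_at_top)
    show "\<forall>\<^sub>F n in sequentially. \<exists>R.
           \<bar>R\<bar> \<le> ?C \<kappa> (s n) * b n powr (1 / 2) \<and>
           \<bar>R\<bar> \<le> ?C' \<kappa> (zero_on J (s n)) *
                   (b n powr (1 / 2) + (\<Sum>i\<in>J. \<bar>s n $ i / b n - \<kappa> $ i\<bar>)) \<and>
           kde_variance M X n (b n) (s n) =
             1 / real n * b n powr (- (real CARD('d) + real (card J)) / 2) *
               (psi J (s n) * f (s n) *
                 (\<Prod>i\<in>J. Gamma (2 * \<kappa> $ i + 1)
                          / (2 powr (2 * \<kappa> $ i + 1) * (Gamma (\<kappa> $ i + 1))\<^sup>2)) + R)"
      using bandwidth_eventually_unit[OF bw] ev1 ev2 ev3
    proof eventually_elim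
      case (elim n)
      then have b: "0 < b n" "b n \<le> 1" and n: "1 \<le> n" by auto
      have s: "s n \<in> int_simplex" using A by blast
      note sD = int_simplexD[OF s]
      let ?u = "1 - l1_norm (s n)"
      obtain R where R: "kde_variance M X n (b n) (s n) =
             1 / real n * b n powr (- (real CARD('d) + real (card J)) / 2) *
               (psi J (s n) * f (s n) *
                 (\<Prod>i\<in>J. Gamma (2 * \<kappa> $ i + 1)
                          / (2 powr (2 * \<kappa> $ i + 1) * (Gamma (\<kappa> $ i + 1))\<^sup>2)) + R)"
        "\<bar>R\<bar> \<le> K * (1 + psi J (s n)) * (sqrt (b n) + b n / ?u + (\<Sum>i\<in>- J. b n / s n $ i)
          + (\<Sum>i\<in>J. \<bar>central_ratio (s n $ i / b n) - central_ratio (\<kappa> $ i)\<bar>))"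
        using K(2)[OF n b s, of J "\<lambda>i. \<kappa> $ i"] k unfolding half_power_central_ratio by (auto simp: less_imp_le)
      have w: "b n * w \<le> sqrt (b n) * w" if "0 \<le> w" for w
        using powr_half_bandwidth(2)[OF b] that by (rule mult_right_mono)
      have u1: "b n / ?u \<le> sqrt (b n) * (1 / ?u)"
        using w[of "1 / ?u"] sD(3) by simp
      have sJ: "(\<Sum>i\<in>- J. b n / s n $ i) \<le> sqrt (b n) * (\<Sum>i\<in>- J. 1 / s n $ i)"
        unfolding sum_distrib_left
        using w[of "1 / s n $ i" for i] sD(2) by (intro sum_mono) (simp add: less_imp_le)
      have R1: "\<bar>R\<bar> \<le> ?C \<kappa> (s n) * b n powr (1 / 2)"
      proof -
        have "\<bar>central_ratio (s n $ i / b n) - central_ratio (\<kappa> $ i)\<bar> \<le> 1" for i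
        proof -
          have "0 \<le> s n $ i / b n" "0 \<le> \<kappa> $ i" using sD(2)[of i] b k[of i] by auto
          then have "0 < central_ratio (s n $ i / b n)" "central_ratio (s n $ i / b n) \<le> 1"
            "0 < central_ratio (\<kappa> $ i)" "central_ratio (\<kappa> $ i) \<le> 1"
            by (simp_all add: central_ratio_pos central_ratio_le_1)
          then show ?thesis by linarith
        qed
        then have "(\<Sum>i\<in>J. \<bar>central_ratio (s n $ i / b n) - central_ratio (\<kappa> $ i)\<bar>) \<le> (\<Sum>i\<in>J. 1)"
          by (intro sum_mono)
        also have "\<dots> \<le> real (card J) * (sqrt (b n) * sqrt ((\<kappa> $ i0 + 1) / s n $ i0))"
        proof -
          have "s n $ i0 / b n < \<kappa> $ i0 + 1" using elim i0 by blast
          then have "1 \<le> b n * ((\<kappa> $ i0 + 1) / s n $ i0)"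
            using b sD(2)[of i0] by (simp add: field_simps)
          then have "1 \<le> sqrt (b n) * sqrt ((\<kappa> $ i0 + 1) / s n $ i0)"
            by (simp only: real_sqrt_mult[symmetric] real_sqrt_ge_1_iff)
          then have "real (card J) * 1 \<le> real (card J) * (sqrt (b n) * sqrt ((\<kappa> $ i0 + 1) / s n $ i0))"
            by (intro mult_left_mono) auto
          then show ?thesis by simp
        qed
        finally have "sqrt (b n) + b n / ?u + (\<Sum>i\<in>- J. b n / s n $ i)
          + (\<Sum>i\<in>J. \<bar>central_ratio (s n $ i / b n) - central_ratio (\<kappa> $ i)\<bar>)
          \<le> sqrt (b n) + sqrt (b n) * (1 / ?u) + sqrt (b n) * (\<Sum>i\<in>- J. 1 / s n $ i)
            + real (card J) * (sqrt (b n) * sqrt ((\<kappa> $ i0 + 1) / s n $ i0))"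
          using u1 sJ by (intro add_mono order_refl)
        also have "\<dots> = (1 + 1 / ?u + (\<Sum>i\<in>- J. 1 / s n $ i)
            + real (card J) * sqrt ((\<kappa> $ i0 + 1) / s n $ i0)) * sqrt (b n)"
        proof -
          have "r + r * v + r * S + c * (r * q) = (1 + v + S + c * q) * r" for r v S c q :: real
            by (simp add: algebra_simps)
          then show ?thesis .
        qed
        finally have "K * (1 + psi J (s n)) * (sqrt (b n) + b n / ?u + (\<Sum>i\<in>- J. b n / s n $ i)
          + (\<Sum>i\<in>J. \<bar>central_ratio (s n $ i / b n) - central_ratio (\<kappa> $ i)\<bar>))
          \<le> K * (1 + psi J (s n)) * ((1 + 1 / ?u + (\<Sum>i\<in>- J. 1 / s n $ i)
            + real (card J) * sqrt ((\<kappa> $ i0 + 1) / s n $ i0)) * sqrt (b n))"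
          using K(1) psi_nonneg[of J "s n"] by (intro mult_left_mono) auto
        with R(2) show ?thesis unfolding powr_half_bandwidth(1)[OF b] mult.assoc by (rule order_trans)
      qed
      have R2: "\<bar>R\<bar> \<le> ?C' \<kappa> (zero_on J (s n)) *
                   (b n powr (1 / 2) + (\<Sum>i\<in>J. \<bar>s n $ i / b n - \<kappa> $ i\<bar>))"
      proof -
        let ?z = "zero_on J (s n)"
        let ?v = "1 - l1_norm ?z"
        let ?S = "\<Sum>i\<in>- J. 1 / s n $ i" and ?W = "\<Sum>i\<in>J. \<bar>s n $ i / b n - \<kappa> $ i\<bar>" and ?L = "\<Sum>i\<in>J. l (\<kappa> $ i)"
        have "(\<Sum>i\<in>J. s n $ i) \<le> 1 - l1_norm (s n)"
        proof -
          have "(\<Sum>i\<in>J. s n $ i) / b n \<le> (\<Sum>i\<in>J. \<kappa> $ i + 1)"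
            unfolding sum_divide_distrib using elim by (intro sum_mono) (auto simp: less_imp_le)
          also have "\<dots> \<le> ?u / b n" using elim by blast
          finally show ?thesis using b by (simp add: divide_le_cancel)
        qed
        note z = psi_zero_on_bound[OF s this]
        have zS: "(\<Sum>i\<in>- J. 1 / ?z $ i) = ?S" by (rule sum.cong) (auto simp: zero_on_def)
        have "1 / ?u \<le> 2 / ?v"
          using z(1,2) sD(3) by (simp add: divide_simps)
        then have "sqrt (b n) * (1 / ?u) \<le> sqrt (b n) * (2 / ?v)"
          using b by (intro mult_left_mono) auto
        with u1 have u2: "b n / ?u \<le> sqrt (b n) * (2 / ?v)" by (rule order_trans)
        have lW: "(\<Sum>i\<in>J. \<bar>central_ratio (s n $ i / b n) - central_ratio (\<kappa> $ i)\<bar>) \<le> ?L * ?W"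
        proof -
          have "(\<Sum>i\<in>J. \<bar>central_ratio (s n $ i / b n) - central_ratio (\<kappa> $ i)\<bar>)
              \<le> (\<Sum>i\<in>J. l (\<kappa> $ i) * \<bar>s n $ i / b n - \<kappa> $ i\<bar>)"
            using elim by (intro sum_mono) blast
          also have "\<dots> \<le> (\<Sum>i\<in>J. ?L * \<bar>s n $ i / b n - \<kappa> $ i\<bar>)"
            using l(1)[OF k] by (intro sum_mono mult_right_mono member_le_sum) auto
          finally show ?thesis by (simp only: sum_distrib_left)
        qed
        have W: "0 \<le> ?W" and LL: "0 \<le> ?L" and S: "0 \<le> ?S"
          using l(1)[OF k] sD(2) by (auto intro!: sum_nonneg simp: less_imp_le)
        have gen: "r + r * v + r * S + L * W \<le> (1 + v + S + L) * (r + W)"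
          if "0 \<le> r" "0 \<le> v" "0 \<le> S" "0 \<le> L" "0 \<le> W" for r v S L W :: real
        proof -
          have "(1 + v + S + L) * (r + W) - (r + r * v + r * S + L * W) = W + v * W + S * W + L * r"
            by (simp add: algebra_simps)
          moreover have "0 \<le> W + v * W + S * W + L * r" using that by simp
          ultimately show ?thesis by linarith
        qed
        have "sqrt (b n) + b n / ?u + (\<Sum>i\<in>- J. b n / s n $ i)
          + (\<Sum>i\<in>J. \<bar>central_ratio (s n $ i / b n) - central_ratio (\<kappa> $ i)\<bar>)
          \<le> sqrt (b n) + sqrt (b n) * (2 / ?v) + sqrt (b n) * ?S + ?L * ?W"
          by (intro add_mono order_refl u2 sJ lW)
        also have "\<dots> \<le> (1 + 2 / ?v + ?S + ?L) * (sqrt (b n) + ?W)"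
          using z(2) b W LL S by (intro gen) auto
        finally have "K * (1 + psi J (s n)) * (sqrt (b n) + b n / ?u + (\<Sum>i\<in>- J. b n / s n $ i)
          + (\<Sum>i\<in>J. \<bar>central_ratio (s n $ i / b n) - central_ratio (\<kappa> $ i)\<bar>))
          \<le> K * (1 + 2 * psi J ?z) * ((1 + 2 / ?v + ?S + ?L) * (sqrt (b n) + ?W))"
        proof (intro mult_mono)
          show "1 + psi J (s n) \<le> 1 + 2 * psi J ?z" using z(3) by simp
          show "0 \<le> sqrt (b n) + b n / ?u + (\<Sum>i\<in>- J. b n / s n $ i)
            + (\<Sum>i\<in>J. \<bar>central_ratio (s n $ i / b n) - central_ratio (\<kappa> $ i)\<bar>)"
            using b sD(2,3) by (intro add_nonneg_nonneg sum_nonneg) (auto simp: less_imp_le)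
        qed (use K(1) psi_nonneg[of J ?z] psi_nonneg[of J "s n"] in auto)
        with R(2) show ?thesis unfolding powr_half_bandwidth(1)[OF b] zS mult.assoc by (rule order_trans)
      qed
      show ?case using R1 R2 R(1) by blast
    qed
  qed
qed

theorem theorem1:
  fixes M :: "'a measure" and X :: "nat \<Rightarrow> 'a \<Rightarrow> real ^ 'd" and f :: "real ^ 'd \<Rightarrow> real"
  assumes "prob_space M"
    and "\<And>x. 0 \<le> f x" and "\<And>x. x \<notin> unit_simplex \<Longrightarrow> f x = 0"
    and "iid_sample M X f"
  shows
    "(C2_on unit_simplex f \<longrightarrow>
       (\<forall>b. bandwidth b \<longrightarrow>
          uniform_limit unit_simplex
            (\<lambda>n s. ((kde_mean M X n (b n) s - f s) - b n * bias_term f s) / b n) (\<lambda>_. 0) sequentially))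
     \<and>
     ((\<exists>L. L-lipschitz_on unit_simplex f) \<longrightarrow>
       (\<exists>C :: real ^ 'd \<Rightarrow> real. \<forall>b s.
          bandwidth b \<and> (\<forall>n. s n \<in> int_simplex) \<and>
          (\<forall>i. filterlim (\<lambda>n. s n $ i / b n) at_top sequentially) \<and>
          filterlim (\<lambda>n. (1 - l1_norm (s n)) / b n) at_top sequentially \<longrightarrow>
          (\<forall>\<^sub>F n in sequentially. \<exists>R.
             \<bar>R\<bar> \<le> C (s n) * b n powr (1 / 2) \<and>
             kde_variance M X n (b n) (s n) =
               1 / real n * b n powr (- real CARD('d) / 2) * (psi {} (s n) * f (s n) + R)))
       \<and>
       (\<forall>J :: 'd set. J \<noteq> {} \<longrightarrow>
         (\<exists>(C :: real ^ 'd \<Rightarrow> real ^ 'd \<Rightarrow> real) (C' :: real ^ 'd \<Rightarrow> real ^ 'd \<Rightarrow> real). \<forall>\<kappa> b s.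
            (\<forall>i. 0 < \<kappa> $ i) \<and> bandwidth b \<and> (\<forall>n. s n \<in> int_simplex) \<and>
            (\<forall>i\<in>J. (\<lambda>n. s n $ i / b n) \<longlonglongrightarrow> \<kappa> $ i) \<and>
            (\<forall>i\<in>- J. filterlim (\<lambda>n. s n $ i / b n) at_top sequentially) \<and>
            filterlim (\<lambda>n. (1 - l1_norm (s n)) / b n) at_top sequentially \<longrightarrow>
            (\<forall>\<^sub>F n in sequentially. \<exists>R.
               \<bar>R\<bar> \<le> C \<kappa> (s n) * b n powr (1 / 2) \<and>
               \<bar>R\<bar> \<le> C' \<kappa> (zero_on J (s n)) *
                       (b n powr (1 / 2) + (\<Sum>i\<in>J. \<bar>s n $ i / b n - \<kappa> $ i\<bar>)) \<and>
               kde_variance M X n (b n) (s n) =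
                 1 / real n * b n powr (- (real CARD('d) + real (card J)) / 2) *
                   (psi J (s n) * f (s n) *
                     (\<Prod>i\<in>J. Gamma (2 * \<kappa> $ i + 1)
                              / (2 powr (2 * \<kappa> $ i + 1) * (Gamma (\<kappa> $ i + 1))\<^sup>2)) + R)))))"
proof (intro conjI impI allI)
  fix b :: "nat \<Rightarrow> real"
  assume "C2_on unit_simplex f" "bandwidth b"
  then show "uniform_limit unit_simplex
      (\<lambda>n s. ((kde_mean M X n (b n) s - f s) - b n * bias_term f s) / b n) (\<lambda>_. 0) sequentially"
    by (rule kde_bias_uniform[OF assms(1,2,4)])
qed (use kde_variance_interior[OF assms(1,2,4)] kde_variance_near_faces[OF assms(1,2,4)] in blast)+

end
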